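(* Let $k$ be a field of characteristic $p>0$, let $F=xy(x-y)(x-ty)\in k[t][x,y]$, let $R_F=k[t][x,y]/(F)$ and let $M_F=R_F/(x,y)R_F$. Then the set $\bigcup_{e>0}\operatorname{Ass}_{R_F}F^e_{R_F}(M_F)$ has infinitely many maximal elements (with respect to inclusion). On the other hand, for every integer $e>0$, with $q=p^e$, one has $G^e_{R_F}(M_F)\cong R_F/(x,y)^qR_F$ and $\operatorname{Ass}G^e_{R_F}(M_F)=\{(x,y)R_F\}$.
   Context: Here $t,x,y$ are indeterminates. For a Noetherian commutative ring $R$ of prime characteristic $p$ and $q=p^e$, let $S$ be $R$ viewed as an $R$-algebra via the iterated Frobenius $r\mapsto r^q$; $F^e_R(M)=S\otimes_R M$ (Peskine–Szpiro functor), regarded as an $R$-module through the left factor, so that $F^e_R(R/I)=R/I^{[q]}$ where $I^{[q]}$ is generated by the $q$-th powers of the elements of $I$. For $m\in M$, $m^q$ denotes the image $1\otimes m$ of $m$ in $F^e_R(M)$, and for $N\subset M$, $N^{[q]}_M=\operatorname{Im}(F^e_R(N)\to F^e_R(M))$. $R^0$ is the set of elements of $R$ not in any minimal prime of $R$. The tight closure $N^*_M$ of $N$ in $M$ is the set of all $m\in M$ for which there is $c\in R^0$ with $cm^q\in N^{[q]}_M$ for all large $q$. $G^e_R(M)=F^e_R(M)/0^*_{F^e_R(M)}$. *)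

theory Defs
  imports "HOL-Algebra.Algebra" "HOL-Algebra.Algebraic_Closure_Type"
begin

section \<open>Modules\<close>

text \<open>The record type of modules extends that of rings. The fields \<open>mult\<close> and \<open>one\<close> play no role
  in the locale \<^locale>\<open>module\<close> and are left undefined where there is no natural value.\<close>

definition ring_module :: "('a, 'c) ring_scheme \<Rightarrow> ('a, 'a) module" where
  "ring_module R = \<lparr>carrier = carrier R, monoid.mult = monoid.mult R, monoid.one = \<one>\<^bsub>R\<^esub>,
     ring.zero = \<zero>\<^bsub>R\<^esub>, ring.add = ring.add R,
     module.smult = monoid.mult R\<rparr>"

definition quotient_module :: "('a, 'm) module \<Rightarrow> 'm set \<Rightarrow> ('a, 'm set) module" where
  "quotient_module M N = \<lparr>carrier = a_rcosets\<^bsub>M\<^esub> N, monoid.mult = undefined,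
     monoid.one = undefined, ring.zero = N, ring.add = set_add M,
     module.smult = (\<lambda>a T. \<Union>m\<in>T. N +>\<^bsub>M\<^esub> (a \<odot>\<^bsub>M\<^esub> m))\<rparr>"

definition module_iso ::
    "('a, 'c) ring_scheme \<Rightarrow> ('a, 'm) module \<Rightarrow> ('a, 'n) module \<Rightarrow> ('m \<Rightarrow> 'n) set" where
  "module_iso R M N = {h \<in> iso (add_monoid M) (add_monoid N).
     \<forall>a\<in>carrier R. \<forall>m\<in>carrier M. h (a \<odot>\<^bsub>M\<^esub> m) = a \<odot>\<^bsub>N\<^esub> h m}"

definition isomorphic_modules ::
    "('a, 'c) ring_scheme \<Rightarrow> ('a, 'm) module \<Rightarrow> ('a, 'n) module \<Rightarrow> bool" where
  "isomorphic_modules R M N \<longleftrightarrow> module_iso R M N \<noteq> {}"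

definition Ass :: "('a, 'c) ring_scheme \<Rightarrow> ('a, 'm) module \<Rightarrow> 'a set set" where
  "Ass R M = {P. primeideal P R \<and>
     (\<exists>m\<in>carrier M. P = {a \<in> carrier R. a \<odot>\<^bsub>M\<^esub> m = \<zero>\<^bsub>M\<^esub>})}"

section \<open>The tensor product with an algebra\<close>

text \<open>Let \<open>\<phi> : R \<rightarrow> S\<close> be a homomorphism of commutative rings and \<open>M\<close> an \<open>R\<close>-module. The tensor
  product of \<open>S\<close> and \<open>M\<close> over \<open>R\<close> is the free abelian group on \<open>S \<times> M\<close> (written additively on
  the elements, as finitely supported functions to the integers) modulo the subgroup generated by
  the usual relations. It is an \<open>S\<close>-module through the left factor.\<close>

definition tensor_free :: "('s, 'd) ring_scheme \<Rightarrow> ('r, 'm) module \<Rightarrow> (('s \<times> 'm) \<Rightarrow>\<^sub>0 int) monoid"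
  where "tensor_free S M = free_Abelian_group (carrier S \<times> carrier M)"

definition tensor_relations :: "('s, 'd) ring_scheme \<Rightarrow> ('r, 'c) ring_scheme \<Rightarrow> ('r \<Rightarrow> 's) \<Rightarrow>
    ('r, 'm) module \<Rightarrow> (('s \<times> 'm) \<Rightarrow>\<^sub>0 int) set" where
  "tensor_relations S R \<phi> M =
     {frag_of (s \<oplus>\<^bsub>S\<^esub> s', m) - frag_of (s, m) - frag_of (s', m) | s s' m.
        s \<in> carrier S \<and> s' \<in> carrier S \<and> m \<in> carrier M}
   \<union> {frag_of (s, m \<oplus>\<^bsub>M\<^esub> m') - frag_of (s, m) - frag_of (s, m') | s m m'.
        s \<in> carrier S \<and> m \<in> carrier M \<and> m' \<in> carrier M}
   \<union> {frag_of (s \<otimes>\<^bsub>S\<^esub> \<phi> r, m) - frag_of (s, r \<odot>\<^bsub>M\<^esub> m) | s r m.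
        s \<in> carrier S \<and> r \<in> carrier R \<and> m \<in> carrier M}"

definition tensor_subgroup :: "('s, 'd) ring_scheme \<Rightarrow> ('r, 'c) ring_scheme \<Rightarrow> ('r \<Rightarrow> 's) \<Rightarrow>
    ('r, 'm) module \<Rightarrow> (('s \<times> 'm) \<Rightarrow>\<^sub>0 int) set" where
  "tensor_subgroup S R \<phi> M = generate (tensor_free S M) (tensor_relations S R \<phi> M)"

definition tensor_class :: "('s, 'd) ring_scheme \<Rightarrow> ('r, 'c) ring_scheme \<Rightarrow> ('r \<Rightarrow> 's) \<Rightarrow>
    ('r, 'm) module \<Rightarrow> (('s \<times> 'm) \<Rightarrow>\<^sub>0 int) \<Rightarrow> (('s \<times> 'm) \<Rightarrow>\<^sub>0 int) set" where
  "tensor_class S R \<phi> M c = tensor_subgroup S R \<phi> M #>\<^bsub>tensor_free S M\<^esub> c"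

definition pure_tensor :: "('s, 'd) ring_scheme \<Rightarrow> ('r, 'c) ring_scheme \<Rightarrow> ('r \<Rightarrow> 's) \<Rightarrow>
    ('r, 'm) module \<Rightarrow> 's \<Rightarrow> 'm \<Rightarrow> (('s \<times> 'm) \<Rightarrow>\<^sub>0 int) set" where
  "pure_tensor S R \<phi> M s m = tensor_class S R \<phi> M (frag_of (s, m))"

definition tensor_module :: "('s, 'd) ring_scheme \<Rightarrow> ('r, 'c) ring_scheme \<Rightarrow> ('r \<Rightarrow> 's) \<Rightarrow>
    ('r, 'm) module \<Rightarrow> ('s, (('s \<times> 'm) \<Rightarrow>\<^sub>0 int) set) module" where
  "tensor_module S R \<phi> M =
     \<lparr>carrier = rcosets\<^bsub>tensor_free S M\<^esub> (tensor_subgroup S R \<phi> M),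
      monoid.mult = undefined, monoid.one = undefined,
      ring.zero = tensor_subgroup S R \<phi> M,
      ring.add = set_mult (tensor_free S M),
      module.smult = (\<lambda>a T. \<Union>c\<in>T. tensor_class S R \<phi> M
                 (frag_extend (\<lambda>(s, m). frag_of (a \<otimes>\<^bsub>S\<^esub> s, m)) c))\<rparr>"

text \<open>The map induced on tensor products by an \<open>R\<close>-linear map \<open>f : M \<rightarrow> N\<close>.\<close>

definition tensor_map :: "('s, 'd) ring_scheme \<Rightarrow> ('r, 'c) ring_scheme \<Rightarrow> ('r \<Rightarrow> 's) \<Rightarrow>
    ('r, 'm) module \<Rightarrow> ('r, 'n) module \<Rightarrow> ('m \<Rightarrow> 'n) \<Rightarrow>
    (('s \<times> 'm) \<Rightarrow>\<^sub>0 int) set \<Rightarrow> (('s \<times> 'n) \<Rightarrow>\<^sub>0 int) set" where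
  "tensor_map S R \<phi> M N f T =
     (\<Union>c\<in>T. tensor_class S R \<phi> N (frag_extend (\<lambda>(s, m). frag_of (s, f m)) c))"

section \<open>The Peskine-Szpiro functor and tight closure\<close>

text \<open>Throughout, \<open>R\<close> is a commutative ring of prime characteristic \<open>p\<close> and \<open>q\<close> is a power of \<open>p\<close>.
  \<open>PS_functor R (p ^ e) M\<close> is the \<open>e\<close>-th Peskine-Szpiro functor applied to \<open>M\<close>.\<close>

definition frobenius :: "('a, 'c) ring_scheme \<Rightarrow> nat \<Rightarrow> 'a \<Rightarrow> 'a" where
  "frobenius R q = (\<lambda>r. r [^]\<^bsub>R\<^esub> q)"

definition PS_functor ::
    "('a, 'c) ring_scheme \<Rightarrow> nat \<Rightarrow> ('a, 'm) module \<Rightarrow> ('a, (('a \<times> 'm) \<Rightarrow>\<^sub>0 int) set) module" where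
  "PS_functor R q M = tensor_module R R (frobenius R q) M"

definition PS_power ::
    "('a, 'c) ring_scheme \<Rightarrow> nat \<Rightarrow> ('a, 'm) module \<Rightarrow> 'm \<Rightarrow> (('a \<times> 'm) \<Rightarrow>\<^sub>0 int) set" where
  "PS_power R q M m = pure_tensor R R (frobenius R q) M \<one>\<^bsub>R\<^esub> m"

definition PS_submodule ::
    "('a, 'c) ring_scheme \<Rightarrow> nat \<Rightarrow> ('a, 'm) module \<Rightarrow> 'm set \<Rightarrow> (('a \<times> 'm) \<Rightarrow>\<^sub>0 int) set set" where
  "PS_submodule R q M N =
     tensor_map R R (frobenius R q) (M\<lparr>carrier := N\<rparr>) M (\<lambda>n. n)
       ` carrier (PS_functor R q (M\<lparr>carrier := N\<rparr>))"

definition minimal_primes :: "('a, 'c) ring_scheme \<Rightarrow> 'a set set" where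
  "minimal_primes R = {P. primeideal P R \<and> (\<forall>Q. primeideal Q R \<and> Q \<subseteq> P \<longrightarrow> Q = P)}"

definition off_minimal_primes :: "('a, 'c) ring_scheme \<Rightarrow> 'a set" where
  "off_minimal_primes R = carrier R - \<Union> (minimal_primes R)"

definition tight_closure ::
    "('a, 'c) ring_scheme \<Rightarrow> nat \<Rightarrow> ('a, 'm) module \<Rightarrow> 'm set \<Rightarrow> 'm set" where
  "tight_closure R p M N = {m \<in> carrier M. \<exists>c \<in> off_minimal_primes R. \<exists>e0. \<forall>e\<ge>e0.
     c \<odot>\<^bsub>PS_functor R (p ^ e) M\<^esub> PS_power R (p ^ e) M m \<in> PS_submodule R (p ^ e) M N}"

definition G_functor :: "('a, 'c) ring_scheme \<Rightarrow> nat \<Rightarrow> nat \<Rightarrow> ('a, 'm) module \<Rightarrow>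
    ('a, (('a \<times> 'm) \<Rightarrow>\<^sub>0 int) set set) module" where
  "G_functor R p e M = quotient_module (PS_functor R (p ^ e) M)
     (tight_closure R p (PS_functor R (p ^ e) M) {\<zero>\<^bsub>PS_functor R (p ^ e) M\<^esub>})"

definition maximal_elements :: "'a set set \<Rightarrow> 'a set set" where
  "maximal_elements A = {P \<in> A. \<forall>Q\<in>A. P \<subseteq> Q \<longrightarrow> Q = P}"

section \<open>The ring $k[t][x,y]/(xy(x-y)(x-ty))$\<close>

text \<open>$k[t][x,y]$ is the iterated polynomial ring with \<open>t\<close> innermost and \<open>y\<close> outermost.\<close>

definition var_t :: "'k::field poly poly poly" where "var_t = [:[:[:0, 1:]:]:]"
definition var_x :: "'k::field poly poly poly" where "var_x = [:[:0, 1:]:]"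
definition var_y :: "'k::field poly poly poly" where "var_y = [:0, 1:]"

definition quartic :: "'k::field poly poly poly" where
  "quartic = var_x * var_y * (var_x - var_y) * (var_x - var_t * var_y)"

definition quartic_ideal :: "'k::field poly poly poly set" where
  "quartic_ideal = PIdl\<^bsub>ring_of_type_algebra\<^esub> quartic"

definition R_F :: "'k::field itself \<Rightarrow> 'k poly poly poly set ring" where
  "R_F _ = ring_of_type_algebra Quot quartic_ideal"

definition xy_ideal :: "'k::field itself \<Rightarrow> 'k poly poly poly set set" where
  "xy_ideal K = Idl\<^bsub>R_F K\<^esub> {quartic_ideal +>\<^bsub>ring_of_type_algebra\<^esub> var_x,
                           quartic_ideal +>\<^bsub>ring_of_type_algebra\<^esub> var_y}"

definition M_F ::
    "'k::field itself \<Rightarrow> ('k poly poly poly set, 'k poly poly poly set set) module" where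
  "M_F K = quotient_module (ring_module (R_F K)) (xy_ideal K)"

end

theory Submission
  imports Defs
begin

text \<open>The module \<open>M_F\<close> is cyclic, hence so are its Frobenius powers and their quotients, and everything
  reduces to ideals: \<open>F\<^sup>e(M_F) = R_F/(x\<^sup>q, y\<^sup>q)\<close>. Modulo \<open>x\<^sup>q\<close> and \<open>y\<^sup>q\<close>, the relation \<open>F\<close> makes the component
  of degree \<open>q + 2\<close> vanish, and the component of degree \<open>q + 1\<close> becomes the cyclic \<open>k[t]\<close>-module
  \<open>k[t]/(1 + t + ... + t\<^bsup>q-2\<^esup>)\<close>, generated by \<open>x\<^sup>2 y\<^bsup>q-1\<^esup>\<close>. Every irreducible factor \<open>\<pi>\<close> of this sum therefore gives
  an associated prime \<open>(x, y, \<pi>)\<close>, which is a maximal ideal, and as \<open>q\<close> grows infinitely many factors appear.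

  The tight closure of \<open>(x\<^sup>q, y\<^sup>q)\<close> is \<open>(x, y)\<^sup>q\<close>. It contains \<open>(x, y)\<^sup>q\<close> because a quadratic form vanishing on
  none of the four lines \<open>F = 0\<close> multiplies \<open>(x, y)\<^bsup>qq'\<^esup>\<close> into degree \<open>qq' + 2\<close>. Conversely, restriction to the
  lines shows that an element of the tight closure vanishes to order \<open>q\<close> on each of them, and such functions
  form \<open>(x, y)\<^sup>q + (F)\<close>, because a form that vanishes on all four lines is divisible by \<open>F\<close>.\<close>

section \<open>Geometry of the four lines\<close>

text \<open>The ideals attached to the lines are studied over a general coefficient ring with
  \<open>t\<close> an element of it. Where domain arguments enter, \<open>t\<close> different from 0
  and 1 keeps the four lines distinct; exponents there are arbitrary. Characteristic p enters
  through the additivity of Frobenius and the coprimality of the factors of the geometric sums.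

  The pivot is \<open>order_ideal\<close>. Being defined by divisibility on each line, it shows its
  zero divisors: an element with nonzero constant term in k[t] has order 0 at the origin of every
  line and can be cancelled. So (x, y) is the only associated prime modulo this ideal, while the
  k[t]-torsion of the Frobenius powers sits in degree q + 1, inside (x, y)^q, and disappears.

  The tensor products and quotients are coset constructions with different element types. Each is
  therefore tracked by a generator and its annihilator. The annihilators are images of ideals of
  k[t][x,y] that contain F, so that membership is decided in the polynomial ring.\<close>

definition coord_x :: "'a::comm_ring_1 poly poly" where "coord_x = [:[:0, 1:]:]"
definition coord_y :: "'a::comm_ring_1 poly poly" where "coord_y = [:0, 1:]"
definition cst :: "'a::comm_ring_1 \<Rightarrow> 'a poly poly" where "cst a = [:[:a:]:]"

lemma cst_simps [simp]:
  "cst 0 = 0" "cst 1 = 1" "cst (a + b) = cst a + cst b" "cst (a * b) = cst a * cst b"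
  "cst (- a) = - cst a" "cst (a - b) = cst a - cst b"
  by (simp_all add: cst_def one_pCons)

lemma poly_poly_decomp: "\<exists>u v. f = cst (coeff (coeff f 0) 0) + coord_x * u + coord_y * v"
proof -
  obtain c g where f: "f = pCons c g" by (cases f)
  obtain a d where c: "c = pCons a d" by (cases c)
  have "f = cst (coeff (coeff f 0) 0) + coord_x * [:d:] + coord_y * g"
    by (simp add: f c cst_def coord_x_def coord_y_def)
  then show ?thesis by blast
qed

text \<open>Equation of the line through the origin with direction (a, b).\<close>

definition linear_factor :: "'a::comm_ring_1 \<Rightarrow> 'a \<Rightarrow> 'a poly poly" where
  "linear_factor a b = cst b * coord_x - cst a * coord_y"

definition quartic_at :: "'a::comm_ring_1 \<Rightarrow> 'a poly poly" where
  "quartic_at t = coord_x * coord_y * (coord_x - coord_y) * (coord_x - cst t * coord_y)"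

lemma poly_poly_induct [case_names add cst x y]:
  assumes add: "\<And>f g. P f \<Longrightarrow> P g \<Longrightarrow> P (f + g)"
    and cst: "\<And>a. P (cst a)"
    and x: "\<And>f. P f \<Longrightarrow> P (coord_x * f)"
    and y: "\<And>f. P f \<Longrightarrow> P (coord_y * f)"
  shows "P f"
proof (induction f)
  case 0
  from cst[of 0] show ?case by simp
next
  case (pCons c f)
  have "P [:c:]"
  proof (induction c)
    case 0
    from cst[of 0] show ?case by simp
  next
    case (pCons a c)
    have "[:pCons a c:] = cst a + coord_x * [:c:]" by (simp add: cst_def coord_x_def)
    with add[OF cst x[OF pCons(2)]] show ?case by simp
  qed
  moreover have "pCons c f = [:c:] + coord_y * f" by (simp add: coord_y_def)
  ultimately show ?case using add y pCons by metis
qed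

subsection \<open>Restriction to lines through the origin\<close>

text \<open>Pullback along the parametrization s -> (a s, b s): x sits in the coefficients and is
  substituted by \<open>pcompose\<close>, y is substituted by evaluation.\<close>

definition restrict_line :: "'a \<Rightarrow> 'a \<Rightarrow> 'a::comm_ring_1 poly poly \<Rightarrow> 'a poly" where
  "restrict_line a b f = poly (map_poly (\<lambda>c. pcompose c [:0, a:]) f) [:0, b:]"

lemma restrict_line_pCons:
  "restrict_line a b (pCons c f) = pcompose c [:0, a:] + [:0, b:] * restrict_line a b f"
  by (simp add: restrict_line_def map_poly_pCons)

lemma restrict_line_0 [simp]: "restrict_line a b 0 = 0"
  by (simp add: restrict_line_def)

lemma restrict_line_add [simp]: "restrict_line a b (f + g) = restrict_line a b f + restrict_line a b g"
  by (induction f g rule: poly_induct2)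
    (simp_all add: restrict_line_pCons pcompose_add algebra_simps)

lemma restrict_line_smult: "restrict_line a b (smult c f) = pcompose c [:0, a:] * restrict_line a b f"
  by (induction f) (simp_all add: restrict_line_pCons pcompose_mult algebra_simps)

lemma restrict_line_mult [simp]: "restrict_line a b (f * g) = restrict_line a b f * restrict_line a b g"
proof (induction f)
  case (pCons c f)
  have "restrict_line a b (pCons c f * g) = 
      restrict_line a b (smult c g) + restrict_line a b (pCons 0 (f * g))"
    by (simp flip: restrict_line_add)
  then show ?case
    by (simp add: restrict_line_pCons restrict_line_smult pCons algebra_simps)
qed simp

lemma restrict_line_coords [simp]:
  "restrict_line a b coord_x = [:0, a:]" "restrict_line a b coord_y = [:0, b:]"
  "restrict_line a b (cst c) = [:c:]"
  by (simp_all add: coord_x_def coord_y_def cst_def restrict_line_pCons pcompose_pCons one_pCons)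

lemma restrict_line_1 [simp]: "restrict_line a b 1 = 1"
  using restrict_line_coords(3)[of a b 1] by (simp add: one_pCons)

lemma restrict_line_minus [simp]: "restrict_line a b (- f) = - restrict_line a b f"
  using restrict_line_add[of a b f "- f"] by (simp add: eq_neg_iff_add_eq_0 add.commute)

lemma restrict_line_diff [simp]: "restrict_line a b (f - g) = restrict_line a b f - restrict_line a b g"
  using restrict_line_add[of a b f "- g"] by simp

lemma restrict_line_power [simp]: "restrict_line a b (f ^ n) = restrict_line a b f ^ n"
  by (induction n) simp_all

text \<open>One direction vector for each factor of F, scaled so that the second coordinate is 1 or
  the vector is (1, 0).\<close>

definition lines :: "'a::comm_ring_1 \<Rightarrow> ('a \<times> 'a) set" where
  "lines t = {(0, 1), (1, 0), (1, 1), (t, 1)}"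

lemma restrict_line_linear_factor:
  "restrict_line a b (linear_factor c d) = [:0, d * a - c * b:]"
  by (simp add: linear_factor_def)

text \<open>The sign arises because \<open>linear_factor 1 0\<close> is -y.\<close>

lemma quartic_at_eq_prod:
  "quartic_at t = - (linear_factor 0 1 * linear_factor 1 0 * linear_factor 1 1 * linear_factor t 1)"
  by (simp add: quartic_at_def linear_factor_def)

lemma restrict_line_quartic_at: "(a, b) \<in> lines t \<Longrightarrow> restrict_line a b (quartic_at t) = 0"
  by (auto simp: lines_def quartic_at_eq_prod restrict_line_linear_factor)

text \<open>The scaling of the direction makes one coordinate \<open>h\<close> restrict to the
  parameter s itself. Substituting \<open>h\<close> for s is a section \<open>\<iota>\<close> of the
  restriction, and f is congruent to the image of its restriction because x and y are congruent to a
  h and b h.\<close>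

lemma linear_factor_dvd_diff:
  fixes f :: "'a::comm_ring_1 poly poly"
  assumes "b = 1 \<or> a = 1 \<and> b = 0"
  shows "\<exists>h. linear_factor a b dvd f - poly (map_poly cst (restrict_line a b f)) h"
proof -
  define h :: "'a poly poly" where "h = (if b = 1 then coord_y else coord_x)"
  define \<iota> :: "'a poly \<Rightarrow> 'a poly poly" where "\<iota> = (\<lambda>g. poly (map_poly cst g) h)"
  have pC: "\<iota> (pCons c g) = cst c + h * \<iota> g" for c g
    by (simp add: \<iota>_def map_poly_pCons)
  have [simp]: "\<iota> 0 = 0" by (simp add: \<iota>_def)
  have add: "\<iota> (g + g') = \<iota> g + \<iota> g'" for g g'
    by (induction g g' rule: poly_induct2) (simp_all add: pC algebra_simps)
  have smult: "\<iota> (smult c g) = cst c * \<iota> g" for c g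
    by (induction g) (simp_all add: pC algebra_simps)
  have xh: "linear_factor a b dvd coord_x - cst a * h"
    using assms by (auto simp: linear_factor_def h_def)
  have yh: "linear_factor a b dvd coord_y - cst b * h"
    using assms by (auto simp: linear_factor_def h_def)
  have "linear_factor a b dvd f - \<iota> (restrict_line a b f)"
  proof (induction f rule: poly_poly_induct)
    case (add f g)
    have "f + g - \<iota> (restrict_line a b (f + g))
        = (f - \<iota> (restrict_line a b f)) + (g - \<iota> (restrict_line a b g))"
      by (simp add: \<open>\<And>g g'. \<iota> (g + g') = \<iota> g + \<iota> g'\<close>)
    with add show ?case by (metis dvd_add)
  next
    case (cst c)
    show ?case by (simp add: pC)
  next
    case (x f)
    have "coord_x * f - \<iota> (restrict_line a b (coord_x * f))
       = coord_x * (f - \<iota> (restrict_line a b f)) + (coord_x - cst a * h) * \<iota> (restrict_line a b f)"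
      by (simp add: pC smult algebra_simps)
    with x xh show ?case by (metis dvd_add dvd_mult dvd_mult2)
  next
    case (y f)
    have "coord_y * f - \<iota> (restrict_line a b (coord_y * f))
       = coord_y * (f - \<iota> (restrict_line a b f)) + (coord_y - cst b * h) * \<iota> (restrict_line a b f)"
      by (simp add: pC smult algebra_simps)
    with y yh show ?case by (metis dvd_add dvd_mult dvd_mult2)
  qed
  then show ?thesis unfolding \<iota>_def by blast
qed

lemma restrict_line_eq_0_iff:
  fixes f :: "'a::comm_ring_1 poly poly"
  assumes "(a, b) \<in> lines t"
  shows "restrict_line a b f = 0 \<longleftrightarrow> linear_factor a b dvd f"
proof
  assume "restrict_line a b f = 0"
  with linear_factor_dvd_diff[of b a f] assms show "linear_factor a b dvd f"
    by (auto simp: lines_def)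
qed (auto simp: restrict_line_linear_factor algebra_simps)

subsection \<open>Powers of the ideal of the origin\<close>

text \<open>The ideal (x, y)^n. The recursive form splits an element into two of the previous power,
  which suits induction on n.\<close>

fun origin_power :: "nat \<Rightarrow> 'a::comm_ring_1 poly poly set" where
  "origin_power 0 = UNIV"
| "origin_power (Suc n) = {coord_x * u + coord_y * v | u v. u \<in> origin_power n \<and> v \<in> origin_power n}"

lemma origin_power_add: "f \<in> origin_power n \<Longrightarrow> g \<in> origin_power n \<Longrightarrow> f + g \<in> origin_power n"
proof (induction n arbitrary: f g)
  case (Suc n)
  then obtain u v u' v' where *: "f = coord_x * u + coord_y * v" "g = coord_x * u' + coord_y * v'"
      "u \<in> origin_power n" "v \<in> origin_power n" "u' \<in> origin_power n" "v' \<in> origin_power n"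
    by auto
  then have "f + g = coord_x * (u + u') + coord_y * (v + v')" by (simp add: algebra_simps)
  with * Suc.IH show ?case by auto
qed simp

lemma origin_power_0 [simp]: "0 \<in> origin_power n"
proof (induction n)
  case (Suc n)
  then show ?case by (simp, intro exI[of _ 0]) simp
qed simp

lemma origin_power_x: "f \<in> origin_power n \<Longrightarrow> coord_x * f \<in> origin_power (Suc n)"
  using origin_power_0[of n] by (simp, intro exI[of _ f] exI[of _ 0]) simp

lemma origin_power_y: "f \<in> origin_power n \<Longrightarrow> coord_y * f \<in> origin_power (Suc n)"
  using origin_power_0[of n] by (simp, intro exI[of _ 0] exI[of _ f]) simp

lemma origin_power_monomial: "coord_x ^ i * coord_y ^ j \<in> origin_power (i + j)"
proof (induction i)
  case 0
  show ?case by (induction j) (simp_all add: origin_power_y del: origin_power.simps(2))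
next
  case (Suc i)
  from origin_power_x[OF this] show ?case by (simp add: mult_ac del: origin_power.simps(2))
qed

lemma origin_power_subset:
  assumes "\<And>f g. f \<in> I \<Longrightarrow> g \<in> I \<Longrightarrow> f + g \<in> I" and "\<And>f g. f \<in> I \<Longrightarrow> g * f \<in> I"
    and "\<And>i j. i + j = n \<Longrightarrow> coord_x ^ i * coord_y ^ j \<in> I"
  shows "origin_power n \<subseteq> I"
proof -
  \<comment> \<open>The multiplier \<open>m\<close> collects the coordinates that the recursion
    strips off \<open>f\<close>.\<close>
  have "m * f \<in> I" if "f \<in> origin_power n" "\<And>i j. i + j = n \<Longrightarrow> m * coord_x ^ i * coord_y ^ j \<in> I" for m f
    using that
  proof (induction n arbitrary: m f)
    case 0
    then show ?case using assms(2)[of m f] by (simp add: mult.commute)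
  next
    case (Suc n)
    then obtain u v where *: "f = coord_x * u + coord_y * v" "u \<in> origin_power n" "v \<in> origin_power n"
      by auto
    have "(m * coord_x) * u \<in> I"
    proof (rule Suc.IH[OF *(2)])
      fix i j assume "i + j = n"
      then show "m * coord_x * coord_x ^ i * coord_y ^ j \<in> I" using Suc.prems(2)[of "Suc i" j]
        by (simp add: mult_ac)
    qed
    moreover have "(m * coord_y) * v \<in> I"
    proof (rule Suc.IH[OF *(3)])
      fix i j assume "i + j = n"
      then show "m * coord_y * coord_x ^ i * coord_y ^ j \<in> I" using Suc.prems(2)[of i "Suc j"]
        by (simp add: mult_ac)
    qed
    moreover have "m * f = (m * coord_x) * u + (m * coord_y) * v" by (simp add: * algebra_simps)
    ultimately show ?case using assms(1) by simp
  qed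
  from this[of _ 1] show ?thesis using assms(3) by auto
qed

lemma restrict_line_origin_power:
  "f \<in> origin_power n \<Longrightarrow> [:0, 1:] ^ n dvd restrict_line a b f"
proof (induction n arbitrary: f)
  case (Suc n)
  then obtain u v where *: "f = coord_x * u + coord_y * v" "u \<in> origin_power n" "v \<in> origin_power n"
    by auto
  have "[:0, c:] = [:0, 1:] * [:c:]" for c :: 'a by simp
  moreover have "[:0, 1:] ^ Suc n dvd ([:0, 1:] * [:c:]) * r" if "[:0, 1:] ^ n dvd r" for c :: 'a and r
    using mult_dvd_mono[OF dvd_refl[of "[:0,1:]"] dvd_mult[OF that, of "[:c:]"]] 
    by (metis (no_types, lifting) mult.assoc power_Suc)
  ultimately have "[:0, 1:] ^ Suc n dvd [:0, c:] * r" if "[:0, 1:] ^ n dvd r" for c :: 'a and r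
    using that by metis
  then show ?case unfolding *(1) restrict_line_add restrict_line_mult restrict_line_coords
    using Suc.IH *(2,3) by (blast intro: dvd_add)
qed simp

section \<open>Leading forms as homogenized univariate polynomials\<close>

definition homogenize :: "nat \<Rightarrow> 'a::comm_ring_1 poly \<Rightarrow> 'a poly poly" where
  "homogenize n p = (\<Sum>i\<le>n. cst (coeff p i) * coord_x ^ i * coord_y ^ (n - i))"

lemma homogenize_add: "homogenize n (p + q) = homogenize n p + homogenize n q"
  by (simp add: homogenize_def algebra_simps sum.distrib)

lemma homogenize_0 [simp]: "homogenize n 0 = 0"
  by (simp add: homogenize_def)

lemma homogenize_smult: "homogenize n (smult c p) = cst c * homogenize n p"
  by (simp add: homogenize_def sum_distrib_left mult_ac)

text \<open>Setting y to 1 in the form gives back \<open>p\<close>, so a degree below the formal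
  degree reappears as a factor y. This is the root at infinity.\<close>

lemma homogenize_y:
  assumes "degree p \<le> n"
  shows "homogenize (Suc n) p = coord_y * homogenize n p"
proof -
  have "coeff p (Suc n) = 0" using assms by (simp add: coeff_eq_0)
  then have "homogenize (Suc n) p = (\<Sum>i\<le>n. cst (coeff p i) * coord_x ^ i * coord_y ^ (Suc n - i))"
    by (simp add: homogenize_def)
  also have "\<dots> = (\<Sum>i\<le>n. coord_y * (cst (coeff p i) * coord_x ^ i * coord_y ^ (n - i)))"
    by (intro sum.cong) (auto simp: Suc_diff_le mult_ac)
  finally show ?thesis by (simp add: homogenize_def sum_distrib_left)
qed

lemma homogenize_x: "homogenize (Suc n) (pCons 0 p) = coord_x * homogenize n p"
  unfolding homogenize_def by (subst sum.atMost_Suc_shift) (simp add: sum_distrib_left mult_ac)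

lemma homogenize_root:
  assumes "degree p \<le> n"
  shows "homogenize (Suc n) ([:- a, 1:] * p) = (coord_x - cst a * coord_y) * homogenize n p"
proof -
  have "[:- a, 1:] * p = smult (- a) p + pCons 0 p" by simp
  then show ?thesis
    using assms by (simp add: homogenize_add homogenize_smult homogenize_x homogenize_y algebra_simps
      del: mult_pCons_left smult_minus_left)
qed

text \<open>On dehomogenized leading forms, multiplication by x is a shift of coefficients and
  multiplication by y changes nothing, whence the witness \<open>pCons 0 p + q\<close>.\<close>

lemma origin_power_leading_form:
  assumes "f \<in> origin_power n"
  shows "\<exists>p. degree p \<le> n \<and> f - homogenize n p \<in> origin_power (Suc n)"
  using assms
proof (induction n arbitrary: f)
  case 0
  obtain u v where f: "f = cst (coeff (coeff f 0) 0) + coord_x * u + coord_y * v"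
    using poly_poly_decomp by blast
  have "f - homogenize 0 [:coeff (coeff f 0) 0:] = coord_x * u + coord_y * v"
    by (subst f) (simp add: homogenize_def)
  then show ?case by (intro exI[of _ "[:coeff (coeff f 0) 0:]"]) auto
next
  case (Suc n)
  then obtain u v where *: "f = coord_x * u + coord_y * v" "u \<in> origin_power n" "v \<in> origin_power n"
    by auto
  obtain p where p: "degree p \<le> n" "u - homogenize n p \<in> origin_power (Suc n)"
    using Suc.IH *(2) by blast
  obtain q where q: "degree q \<le> n" "v - homogenize n q \<in> origin_power (Suc n)"
    using Suc.IH *(3) by blast
  have "f - homogenize (Suc n) (pCons 0 p + q) 
      = coord_x * (u - homogenize n p) + coord_y * (v - homogenize n q)"
    using q(1) by (simp add: homogenize_add homogenize_x homogenize_y * algebra_simps)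
  moreover have "degree (pCons 0 p + q) \<le> Suc n"
    using p(1) q(1) by (intro degree_add_le) (auto simp: degree_pCons_eq_if)
  ultimately show ?case using p(2) q(2)
    by (metis origin_power_add origin_power_x origin_power_y)
qed

lemma restrict_line_homogenize:
  assumes "degree p \<le> n"
  shows "restrict_line a 1 (homogenize n p) = smult (poly p a) ([:0, 1:] ^ n)"
  using assms
proof (induction p arbitrary: n)
  case (pCons c p)
  have cx: "[:0, a:] = smult a [:0, 1:]" by simp
  show ?case
  proof (cases n)
    case 0
    with pCons have "p = 0" by (auto simp: degree_pCons_eq_if split: if_splits)
    with 0 show ?thesis by (simp add: homogenize_def)
  next
    case (Suc m)
    have c: "homogenize n [:c:] = cst c * coord_y ^ n"
      unfolding homogenize_def by (subst sum.atMost_shift) simp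
    have "pCons c p = [:c:] + pCons 0 p" by simp
    then have "homogenize n (pCons c p) = cst c * coord_y ^ n + coord_x * homogenize m p"
      using Suc by (metis c homogenize_add homogenize_x)
    moreover have "degree p \<le> m" using pCons Suc by (auto simp: degree_pCons_eq_if split: if_splits)
    ultimately have "restrict_line a 1 (homogenize n (pCons c p))
        = [:c:] * [:0, 1:] ^ n + smult a [:0, 1:] * smult (poly p a) ([:0, 1:] ^ m)"
      using pCons.IH[of m] unfolding cx[symmetric] by simp
    moreover have "[:c:] * g = smult c g" for g by simp
    ultimately show ?thesis using Suc
      by (simp only: poly_pCons smult_add_left mult_smult_left mult_smult_right smult_smult power_Suc mult.commute)
  qed
qed simp

text \<open>The direction (1, 0) is the point at infinity for \<open>p\<close>, where the top
  coefficient replaces the value \<open>poly p a\<close>.\<close>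

lemma restrict_line_1_0_homogenize:
  "restrict_line 1 0 (homogenize n p) = smult (coeff p n) ([:0, 1:] ^ n)"
proof -
  have sum: "restrict_line a b (sum f A) = (\<Sum>i\<in>A. restrict_line a b (f i))" for a b :: 'a and f and A :: "nat set"
    by (induction A rule: infinite_finite_induct) simp_all
  have "restrict_line 1 0 (homogenize n p) = (\<Sum>i\<le>n. if i = n then smult (coeff p n) ([:0, 1:] ^ n) else 0)"
    unfolding homogenize_def sum by (intro sum.cong) (auto simp: power_0_left)
  then show ?thesis by simp
qed

subsection \<open>Functions vanishing to high order on the four lines\<close>

text \<open>Functions vanishing at the origin to order n along each of the four lines. For t the
  indeterminate this is the preimage both of (x, y)^n and of the tight closure of (x^n, y^n) in
  \<open>R_F\<close>.\<close>

definition order_ideal :: "'a::comm_ring_1 \<Rightarrow> nat \<Rightarrow> 'a poly poly set" where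
  "order_ideal t n = {f. \<forall>a b. (a, b) \<in> lines t \<longrightarrow> [:0, 1:] ^ n dvd restrict_line a b f}"

lemma order_ideal_add: "f \<in> order_ideal t n \<Longrightarrow> g \<in> order_ideal t n \<Longrightarrow> f + g \<in> order_ideal t n"
  unfolding order_ideal_def by (simp add: dvd_add)

lemma order_ideal_mono: "m \<le> n \<Longrightarrow> order_ideal t n \<subseteq> order_ideal t m"
  unfolding order_ideal_def using dvd_trans[OF le_imp_power_dvd[of m n]] by blast

lemma order_ideal_mult: "f \<in> order_ideal t m \<Longrightarrow> g \<in> order_ideal t n \<Longrightarrow> f * g \<in> order_ideal t (m + n)"
  unfolding order_ideal_def by (simp add: power_add mult_dvd_mono)

lemma order_ideal_0 [simp]: "order_ideal t 0 = UNIV"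
  by (auto simp: order_ideal_def)

lemma order_ideal_power: "f \<in> order_ideal t m \<Longrightarrow> f ^ n \<in> order_ideal t (m * n)"
proof (induction n)
  case (Suc n)
  from order_ideal_mult[OF Suc(2) Suc(1)[OF Suc(2)]] show ?case by simp
qed simp

lemma order_ideal_mult_left: "f \<in> order_ideal t n \<Longrightarrow> g * f \<in> order_ideal t n"
  using order_ideal_mult[of g t 0 f n] by simp

lemma order_ideal_quartic: "quartic_at t \<in> order_ideal t n"
  by (auto simp: order_ideal_def restrict_line_quartic_at)

lemma origin_power_subset_order_ideal: "origin_power n \<subseteq> order_ideal t n"
  by (auto simp: order_ideal_def restrict_line_origin_power)

text \<open>A form of degree n restricts to c s^n on a line, so order n + 1 forces c = 0. Hence
  \<open>p\<close> has the roots 0, 1 and t, which are distinct, and a root at infinity, and these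
  account for the four factors of F.\<close>

lemma quartic_dvd_homogenize:
  fixes p :: "'a::idom poly"
  assumes t: "t \<noteq> 0" "t \<noteq> 1" and deg: "degree p \<le> n" and ord: "homogenize n p \<in> order_ideal t (Suc n)"
  shows "quartic_at t dvd homogenize n p"
proof (cases "p = 0")
  case False
  have nd: "c = 0" if "[:0, 1:] ^ Suc n dvd smult c ([:0, 1:] ^ n)" for c :: 'a
  proof (rule ccontr)
    assume "c \<noteq> 0"
    then have "smult c ([:0, 1:] ^ n) \<noteq> 0" by simp
    from dvd_imp_degree_le[OF that this] \<open>c \<noteq> 0\<close> show False
      by (simp add: degree_power_eq)
  qed
  have root: "poly p a = 0" if "(a, 1) \<in> lines t" for a
  proof -
    have "[:0, 1:] ^ Suc n dvd restrict_line a 1 (homogenize n p)"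
      using ord that unfolding order_ideal_def by blast
    then show ?thesis unfolding restrict_line_homogenize[OF deg] by (rule nd)
  qed
  have top: "coeff p n = 0"
  proof -
    have "(1, 0) \<in> lines t" by (simp add: lines_def)
    then have "[:0, 1:] ^ Suc n dvd restrict_line 1 0 (homogenize n p)"
      using ord unfolding order_ideal_def by blast
    then show ?thesis unfolding restrict_line_1_0_homogenize by (rule nd)
  qed
  have "poly p 0 = 0" using root by (simp add: lines_def)
  then obtain p1 where p1: "p = [:- 0, 1:] * p1"  unfolding poly_eq_0_iff_dvd by blast
  have "poly p1 1 = 0" using root[of 1] by (simp add: lines_def p1)
  then obtain p2 where p2: "p1 = [:- 1, 1:] * p2" unfolding poly_eq_0_iff_dvd by blast
  have "poly p2 t = 0" using root[of t] t by (simp add: lines_def p1 p2)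
  then obtain r where r: "p2 = [:- t, 1:] * r" unfolding poly_eq_0_iff_dvd by blast
  have p: "p = [:- 0, 1:] * ([:- 1, 1:] * ([:- t, 1:] * r))" by (simp only: p1 p2 r)
  have "p1 \<noteq> 0" using False p1 by auto
  then have "p2 \<noteq> 0" using p2 by auto
  then have "r \<noteq> 0" using r by auto
  have deg_factor: "degree ([:- a, 1:] * s) = Suc (degree s)" if "s \<noteq> 0" for a :: 'a and s
    using degree_mult_eq[of "[:- a, 1:]" s] that by (simp del: mult_pCons_left)
  have "degree p = Suc (Suc (Suc (degree r)))"
    using deg_factor[OF \<open>p1 \<noteq> 0\<close>] deg_factor[OF \<open>p2 \<noteq> 0\<close>] deg_factor[OF \<open>r \<noteq> 0\<close>] p1 p2 r by metis
  moreover have "degree p \<noteq> n" using top False leading_coeff_neq_0 by blast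
  \<comment> \<open>The root at infinity makes this strict. The slack is the fourth factor y, so n
    is at least 4 and the cofactor gets formal degree n - 4.\<close>
  ultimately have "Suc (Suc (Suc (degree r))) < n" using deg by simp
  then obtain m where m: "n = Suc (Suc (Suc (Suc m)))" "degree r \<le> m"
    by (intro that[of "n - 4"]) arith+
  have le: "degree ([:- a, 1:] * s) \<le> Suc k" if "degree s \<le> k" for a :: 'a and s k
    using degree_mult_le[of "[:- a, 1:]" s] that by (simp del: mult_pCons_left)
  have "degree p \<le> Suc (Suc (Suc m))"
    using p by (metis le m(2))
  then have "homogenize n p = coord_y * homogenize (Suc (Suc (Suc m))) p"
    unfolding m(1) by (rule homogenize_y)
  also have "\<dots> = coord_y * ((coord_x - cst 0 * coord_y) * ((coord_x - cst 1 * coord_y)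
      * ((coord_x - cst t * coord_y) * homogenize m r)))"
    by (subst p) (simp only: homogenize_root le m(2))
  also have "\<dots> = quartic_at t * homogenize m r"
    by (simp add: quartic_at_def mult_ac)
  finally show ?thesis by simp
next
  case True
  then show ?thesis by (simp only: homogenize_0 dvd_0_right)
qed

text \<open>Successive approximation: once f is congruent modulo F to some g in (x, y)^n, the
  leading form of g also has order n + 1 on the lines. It is then a multiple of F and can be
  subtracted, which moves g into (x, y)^(n + 1).\<close>

lemma order_ideal_eq:
  fixes f :: "'a::idom poly poly"
  assumes t: "t \<noteq> 0" "t \<noteq> 1" and "f \<in> order_ideal t n"
  shows "\<exists>g\<in>origin_power n. quartic_at t dvd f - g"
  using assms(3)
proof (induction n)
  case 0
  then show ?case by (intro bexI[of _ f]) auto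
next
  case (Suc n)
  have "f \<in> order_ideal t n"
    using Suc.prems order_ideal_mono[of n "Suc n"] by auto
  from Suc.IH[OF this] obtain g h where g: "g \<in> origin_power n" "f - g = quartic_at t * h"
    unfolding dvd_def by blast
  obtain p where p: "degree p \<le> n" "g - homogenize n p \<in> origin_power (Suc n)"
    using origin_power_leading_form[OF g(1)] by blast
  have "homogenize n p = f + (- 1) * (g - homogenize n p) + (- h) * quartic_at t"
    using g(2) by (simp add: algebra_simps)
  also have "\<dots> \<in> order_ideal t (Suc n)"
    using Suc.prems p(2) origin_power_subset_order_ideal[of "Suc n" t]
    by (intro order_ideal_add order_ideal_mult_left order_ideal_quartic) auto
  finally have "quartic_at t dvd homogenize n p"
    using quartic_dvd_homogenize t p(1) by blast
  then have "quartic_at t dvd (f - g) + homogenize n p" using g(2) by (metis dvd_add dvd_triv_left)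
  with p(2) show ?case by (intro bexI[of _ "g - homogenize n p"]) (simp_all add: algebra_simps del: origin_power.simps)
qed

subsection \<open>The Frobenius powers of the ideal of the origin\<close>

text \<open>Preimage in the polynomial ring of the ideal (x^n, y^n) of the quotient by F.\<close>

definition bracket_ideal :: "'a::comm_ring_1 \<Rightarrow> nat \<Rightarrow> 'a poly poly set" where
  "bracket_ideal t n = {u * coord_x ^ n + v * coord_y ^ n + w * quartic_at t | u v w. True}"

lemma bracket_idealI: "u * coord_x ^ n + v * coord_y ^ n + w * quartic_at t \<in> bracket_ideal t n"
  unfolding bracket_ideal_def by blast

lemma bracket_ideal_add:
  assumes "f \<in> bracket_ideal t n" "g \<in> bracket_ideal t n"
  shows "f + g \<in> bracket_ideal t n"
proof -
  from assms obtain u v w u' v' w' where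
    "f = u * coord_x ^ n + v * coord_y ^ n + w * quartic_at t"
    "g = u' * coord_x ^ n + v' * coord_y ^ n + w' * quartic_at t"
    unfolding bracket_ideal_def by blast
  then have "f + g = (u + u') * coord_x ^ n + (v + v') * coord_y ^ n + (w + w') * quartic_at t"
    by (simp add: algebra_simps)
  then show ?thesis by (simp only: bracket_idealI)
qed

lemma bracket_ideal_mult:
  assumes "f \<in> bracket_ideal t n"
  shows "g * f \<in> bracket_ideal t n"
proof -
  from assms obtain u v w where "f = u * coord_x ^ n + v * coord_y ^ n + w * quartic_at t"
    unfolding bracket_ideal_def by blast
  then have "g * f = (g * u) * coord_x ^ n + (g * v) * coord_y ^ n + (g * w) * quartic_at t"
    by (simp add: algebra_simps)
  then show ?thesis by (simp only: bracket_idealI)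
qed

lemma bracket_ideal_x: "n \<le> i \<Longrightarrow> g * coord_x ^ i \<in> bracket_ideal t n"
  using bracket_idealI[of "g * coord_x ^ (i - n)" n 0 0 t] by (simp add: mult.assoc flip: power_add)

lemma bracket_ideal_y: "n \<le> i \<Longrightarrow> g * coord_y ^ i \<in> bracket_ideal t n"
  using bracket_idealI[of 0 n "g * coord_y ^ (i - n)" 0 t] by (simp add: mult.assoc flip: power_add)

lemma bracket_ideal_quartic: "quartic_at t dvd f \<Longrightarrow> f \<in> bracket_ideal t n"
  using bracket_idealI[of 0 n 0 _ t] by (auto simp: dvd_def mult.commute)

lemma bracket_ideal_diff:
  "f \<in> bracket_ideal t n \<Longrightarrow> g \<in> bracket_ideal t n \<Longrightarrow> f - g \<in> bracket_ideal t n"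
  using bracket_ideal_add[of f t n "(- 1) * g"] bracket_ideal_mult[of g t n "- 1"] by simp

lemma quartic_at_expand:
  "quartic_at t = coord_x ^ 3 * coord_y - (1 + cst t) * coord_x ^ 2 * coord_y ^ 2
     + cst t * coord_x * coord_y ^ 3"
  by (simp add: quartic_at_def power2_eq_square power3_eq_cube algebra_simps)

text \<open>F is solved for its monomial x^3 y, which trades a monomial for two of the same degree
  with smaller exponent of x.\<close>

lemma quartic_at_recurrence:
  "coord_x ^ (i + 3) * coord_y ^ (j + 1) = (1 + cst t) * (coord_x ^ (i + 2) * coord_y ^ (j + 2))
     - cst t * (coord_x ^ (i + 1) * coord_y ^ (j + 3)) + coord_x ^ i * coord_y ^ j * quartic_at t"
  by (simp add: quartic_at_expand power_add power2_eq_square power3_eq_cube algebra_simps)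

text \<open>If the exponent of x is at most 2, then y has exponent at least n. If it is at least n,
  the monomial is a multiple of x^n. In between, the recurrence lowers it by 1 or 2 within the same
  degree.\<close>

lemma monomial_in_bracket_ideal:
  "i + j = n + 2 \<Longrightarrow> coord_x ^ i * coord_y ^ j \<in> bracket_ideal t n"
proof (induction i arbitrary: j rule: less_induct)
  case (less i)
  consider "i \<le> 2" | "n \<le> i" | i' j' where "i = i' + 3" "j = j' + 1"
  proof -
    have "i = (i - 3) + 3 \<and> j = (j - 1) + 1" if "\<not> i \<le> 2" "\<not> n \<le> i" using that less.prems by auto
    then show ?thesis using that by blast
  qed
  then show ?case
  proof cases
    case 1
    then show ?thesis using less.prems by (intro bracket_ideal_y) auto
  next
    case 2
    then show ?thesis using bracket_ideal_x[of n i "coord_y ^ j"] by (simp add: mult.commute)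
  next
    case 3
    have ih: "coord_x ^ (i' + 2) * coord_y ^ (j' + 2) \<in> bracket_ideal t n"
      "coord_x ^ (i' + 1) * coord_y ^ (j' + 3) \<in> bracket_ideal t n"
      using 3 less.prems by (intro less.IH; simp)+
    show ?thesis unfolding 3 quartic_at_recurrence[of i' j' t]
      by (rule bracket_ideal_add[OF bracket_ideal_diff[OF ih[THEN bracket_ideal_mult]]
            bracket_ideal_mult[OF bracket_ideal_quartic[OF dvd_refl]]])
  qed
qed

lemma origin_power_subset_bracket_ideal: "origin_power (n + 2) \<subseteq> bracket_ideal t n"
  by (intro origin_power_subset bracket_ideal_add bracket_ideal_mult monomial_in_bracket_ideal)

lemma order_ideal_subset_bracket_ideal:
  fixes t :: "'a::idom"
  assumes "t \<noteq> 0" "t \<noteq> 1"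
  shows "order_ideal t (n + 2) \<subseteq> bracket_ideal t n"
proof
  fix f assume "f \<in> order_ideal t (n + 2)"
  then obtain g where g: "g \<in> origin_power (n + 2)" "quartic_at t dvd f - g"
    using order_ideal_eq[OF assms] by blast
  then have "g + (f - g) \<in> bracket_ideal t n"
    using origin_power_subset_bracket_ideal by (blast intro: bracket_ideal_add bracket_ideal_quartic)
  then show "f \<in> bracket_ideal t n" by simp
qed

lemma restrict_line_bracket_ideal:
  assumes "f \<in> bracket_ideal t n" "(a, b) \<in> lines t"
  shows "[:0, 1:] ^ n dvd restrict_line a b f"
proof -
  from assms(1) obtain u v w where "f = u * coord_x ^ n + v * coord_y ^ n + w * quartic_at t"
    unfolding bracket_ideal_def by blast
  moreover have "[:0, 1:] ^ n dvd [:0, c:] ^ n" for c :: 'a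
  proof -
    have "[:0, c:] = [:0, 1:] * [:c:]" by simp
    then show ?thesis by (metis dvd_triv_left power_mult_distrib)
  qed
  ultimately show ?thesis using restrict_line_quartic_at[OF assms(2)]
    by (auto intro!: dvd_add dvd_mult)
qed

subsection \<open>Tight closure of the Frobenius powers\<close>

text \<open>A quadratic form whose values t, 1, 1 + t and t (t + 1) at the four directions are
  nonzero as soon as t and t + 1 are. It serves as the multiplier c for every tight closure
  below.\<close>

definition test_form :: "'a::comm_ring_1 \<Rightarrow> 'a poly poly" where
  "test_form t = coord_x ^ 2 + cst t * coord_y ^ 2"

lemma restrict_line_test_form:
  assumes "(a, b) \<in> lines t" and "t \<noteq> 0" "t + 1 \<noteq> (0::'a::idom)"
  shows "restrict_line a b (test_form t) \<noteq> 0"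
proof -
  have "restrict_line a b (test_form t) = [:0, 0, a ^ 2 + t * b ^ 2:]"
    by (simp add: test_form_def power2_eq_square)
  moreover have "t ^ 2 + t = t * (t + 1)" by (simp add: power2_eq_square algebra_simps)
  ultimately show ?thesis using assms by (auto simp: lines_def add.commute)
qed

text \<open>The degree 2 of the test form supplies the two extra orders that separate
  \<open>order_ideal\<close> from \<open>bracket_ideal\<close>.\<close>

lemma test_form_mult_power:
  fixes t :: "'a::idom"
  assumes t: "t \<noteq> 0" "t \<noteq> 1" and f: "f \<in> order_ideal t n"
  shows "test_form t * f ^ m \<in> bracket_ideal t (n * m)"
proof -
  have "coord_x ^ 2 \<in> order_ideal t 2" "coord_y ^ 2 \<in> order_ideal t 2"
    using subsetD[OF origin_power_subset_order_ideal origin_power_monomial[of 2 0]]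
      subsetD[OF origin_power_subset_order_ideal origin_power_monomial[of 0 2]]
    by (simp_all del: add_2_eq_Suc add_2_eq_Suc')
  then have "test_form t \<in> order_ideal t 2"
    unfolding test_form_def by (intro order_ideal_add order_ideal_mult_left)
  from order_ideal_mult[OF order_ideal_power[OF f, of m] this]
  show ?thesis using order_ideal_subset_bracket_ideal[OF t] by (auto simp: mult.commute)
qed

lemma order_power: "p \<noteq> 0 \<Longrightarrow> order a (p ^ n) = n * order a (p::'a::idom poly)"
  by (induction n) (simp_all add: order_mult)

text \<open>On each line, comparison of orders at the origin gives n m <= ord c + m ord f. If ord f
  were below n, this would give m <= ord c, which fails for large m.\<close>

lemma order_ideal_of_multiplier:
  fixes t :: "'a::idom"
  assumes c: "\<And>a b. (a, b) \<in> lines t \<Longrightarrow> restrict_line a b c \<noteq> 0"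
    and m: "\<And>k. \<exists>m>k. c * f ^ m \<in> bracket_ideal t (n * m)"
  shows "f \<in> order_ideal t n"
  unfolding order_ideal_def
proof (intro CollectI allI impI)
  fix a b assume L: "(a, b) \<in> lines t"
  define g where "g = restrict_line a b c"
  define r where "r = restrict_line a b f"
  show "[:0, 1:] ^ n dvd r"
  proof (cases "r = 0")
    case False
    have "g \<noteq> 0" using c[OF L] by (simp add: g_def)
    obtain m where "m > order 0 g" and "c * f ^ m \<in> bracket_ideal t (n * m)" using m by blast
    from restrict_line_bracket_ideal[OF this(2) L] have "[:- 0, 1:] ^ (n * m) dvd g * r ^ m"
      by (simp add: g_def r_def)
    then have "n * m \<le> order 0 (g * r ^ m)"
      using order_divides[of 0 "n * m" "g * r ^ m"] \<open>g \<noteq> 0\<close> False by simp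
    then have "n * m \<le> order 0 g + m * order 0 r"
      using \<open>g \<noteq> 0\<close> False by (simp add: order_mult order_power)
    have "n \<le> order 0 r"
    proof (rule ccontr)
      assume "\<not> n \<le> order 0 r"
      then have "Suc (order 0 r) * m \<le> n * m" by (intro mult_le_mono1) simp
      with \<open>n * m \<le> order 0 g + m * order 0 r\<close> \<open>m > order 0 g\<close> show False by (simp add: mult.commute)
    qed
    then show ?thesis using order_divides[of 0 n r] by simp
  qed simp
qed

subsection \<open>The socle in degree one more than the exponent\<close>

lemma monomial_eq_monom: "cst a * coord_x ^ i * coord_y ^ j = monom (monom a i) j"
proof -
  have "cst a * coord_x ^ i = [:monom a i:]"
    by (simp add: cst_def coord_x_def poly_const_pow monom_altdef)
  moreover have "coord_y ^ j = monom (1::'a poly) j"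
    by (simp add: coord_y_def monom_altdef)
  ultimately show ?thesis by (simp add: smult_monom)
qed

lemma monomial_induct [case_names add monomial]:
  assumes add: "\<And>f g. P f \<Longrightarrow> P g \<Longrightarrow> P (f + g)"
    and monomial: "\<And>a i j. P (cst a * coord_x ^ i * coord_y ^ j)"
  shows "P f"
proof -
  have "P (f * coord_x ^ i * coord_y ^ j)" for i j
  proof (induction f arbitrary: i j rule: poly_poly_induct)
    case (x f)
    from x[of "Suc i" j] show ?case by (simp add: mult_ac)
  next
    case (y f)
    from y[of i "Suc j"] show ?case by (simp add: mult_ac)
  qed (simp_all add: add monomial distrib_right)
  from this[of 0 0] show ?thesis by simp
qed

text \<open>In degree \<open>n + 1\<close>, the recurrence \<open>c (j + 1) = (1 + t) * c j - t * c (j - 1)\<close> imposed by the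
  quartic has the solution \<open>c j = 1 + t + ... + t ^ (j - 2)\<close>.\<close>

definition socle_functional :: "'a::comm_ring_1 \<Rightarrow> nat \<Rightarrow> 'a poly poly \<Rightarrow> 'a" where
  "socle_functional t n f = (\<Sum>j\<le>n. coeff (coeff f (Suc n - j)) j * (\<Sum>i<j - 1. t ^ i))"

lemma socle_functional_add: "socle_functional t n (f + g) = socle_functional t n f + socle_functional t n g"
  by (simp add: socle_functional_def algebra_simps sum.distrib)

lemma socle_functional_minus: "socle_functional t n (- f) = - socle_functional t n f"
  using socle_functional_add[of t n f "- f"]
  by (simp add: eq_neg_iff_add_eq_0 add.commute socle_functional_def)

lemma socle_functional_monomial:
  "socle_functional t n (cst a * coord_x ^ i * coord_y ^ j)
     = (if i \<le> n \<and> i + j = Suc n then a * (\<Sum>i<i - 1. t ^ i) else 0)"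
proof -
  have "socle_functional t n (cst a * coord_x ^ i * coord_y ^ j)
      = (\<Sum>k\<le>n. if k = i then (if i + j = Suc n then a * (\<Sum>i<i - 1. t ^ i) else 0) else 0)"
    unfolding socle_functional_def monomial_eq_monom by (intro sum.cong) auto
  then show ?thesis by simp
qed

text \<open>F has degree 4, so a monomial x^i y^j contributes only if i + j + 3 = n. The weights of
  the three resulting monomials then cancel by the recurrence.\<close>

lemma socle_functional_quartic: "socle_functional t n (f * quartic_at t) = 0"
proof (induction f rule: monomial_induct)
  case (monomial a i j)
  have eq: "cst a * coord_x ^ i * coord_y ^ j * quartic_at t
      = cst a * coord_x ^ (i + 3) * coord_y ^ (j + 1)
        + - (cst (a * (1 + t)) * coord_x ^ (i + 2) * coord_y ^ (j + 2))
        + cst (a * t) * coord_x ^ (i + 1) * coord_y ^ (j + 3)"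
    by (simp add: quartic_at_expand power_add power2_eq_square power3_eq_cube algebra_simps)
  show ?case
    unfolding eq socle_functional_add socle_functional_minus socle_functional_monomial
    by (cases "i + j + 3 = n") (auto simp: algebra_simps)
qed (simp add: distrib_right socle_functional_add)

text \<open>In degree n + 1 a multiple of y^n involves only x^0 and x^1, and both weights are empty
  sums.\<close>

lemma socle_functional_y:
  assumes "n > 0"
  shows "socle_functional t n (f * coord_y ^ n) = 0"
proof (induction f rule: monomial_induct)
  case (monomial a i j)
  have "cst a * coord_x ^ i * coord_y ^ j * coord_y ^ n = cst a * coord_x ^ i * coord_y ^ (j + n)"
    by (simp add: power_add mult_ac)
  then show ?case using assms by (auto simp: socle_functional_monomial)
qed (simp add: distrib_right socle_functional_add)

text \<open>In degree n + 1 only x^n y and x^(n + 1) can occur. The weight of the former is the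
  geometric sum itself; the latter is dropped by the cutoff at n in the definition. The cutoff is
  compatible with multiples of F because they are divisible by y.\<close>

lemma socle_functional_x: "(\<Sum>i<n - 1. t ^ i) dvd socle_functional t n (f * coord_x ^ n)"
proof (induction f rule: monomial_induct)
  case (monomial a i j)
  have "cst a * coord_x ^ i * coord_y ^ j * coord_x ^ n = cst a * coord_x ^ (i + n) * coord_y ^ j"
    by (simp add: power_add mult_ac)
  then show ?case by (auto simp: socle_functional_monomial)
qed (simp add: distrib_right socle_functional_add)

lemma socle_functional_bracket_ideal:
  assumes "n > 0" "f \<in> bracket_ideal t n"
  shows "(\<Sum>i<n - 1. t ^ i) dvd socle_functional t n f"
  using assms unfolding bracket_ideal_def
  by (auto simp: socle_functional_add socle_functional_quartic socle_functional_y
      socle_functional_x[simplified])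

text \<open>Shows that x^2 y^(n - 1) generates degree n + 1 with the weights of
  \<open>socle_functional\<close>: x y^n has weight 0, the generator has weight 1, and the
  recurrence does the rest.\<close>

lemma monomial_mod_bracket_ideal:
  assumes "i + j = Suc n" "i \<ge> 1" "j \<ge> 1"
  shows "coord_x ^ i * coord_y ^ j - cst (\<Sum>k<i - 1. t ^ k) * coord_x ^ 2 * coord_y ^ (n - 1) \<in> bracket_ideal t n"
  using assms
proof (induction i arbitrary: j rule: less_induct)
  case (less i)
  consider "i = 1" | "i = 2" | i' j' where "i = i' + 3" "j = j' + 1"
  proof -
    have "i = (i - 3) + 3 \<and> j = (j - 1) + 1" if "i \<noteq> 1" "i \<noteq> 2" using that less.prems by auto
    then show ?thesis using that by blast
  qed
  then show ?case
  proof cases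
    case 1
    then show ?thesis using less.prems by (simp add: bracket_ideal_y)
  next
    case 2
    with less.prems have "j = n - 1" by simp
    then show ?thesis using 2 bracket_ideal_mult[of _ t n 0] bracket_ideal_x[of n n 0 t] by simp
  next
    case 3
    define E where "E = (\<lambda>i j. coord_x ^ i * coord_y ^ j
      - cst (\<Sum>k<i - 1. t ^ k) * coord_x ^ 2 * coord_y ^ (n - 1))"
    have E: "E (i' + 2) (j' + 2) \<in> bracket_ideal t n" "E (i' + 1) (j' + 3) \<in> bracket_ideal t n"
      unfolding E_def using 3 less.prems by (intro less.IH; simp)+
    have "(\<Sum>k<i' + 2. t ^ k) = (1 + t) * (\<Sum>k<i' + 1. t ^ k) - t * (\<Sum>k<i'. t ^ k)"
      by (simp add: algebra_simps)
    then have "E i j = (1 + cst t) * E (i' + 2) (j' + 2) - cst t * E (i' + 1) (j' + 3)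
        + coord_x ^ i' * coord_y ^ j' * quartic_at t"
      unfolding E_def 3 quartic_at_recurrence[of i' j' t]
      by (simp add: algebra_simps)
    also have "\<dots> \<in> bracket_ideal t n"
      by (rule bracket_ideal_add[OF bracket_ideal_diff[OF E[THEN bracket_ideal_mult]]
            bracket_ideal_mult[OF bracket_ideal_quartic[OF dvd_refl]]])
    finally show ?thesis by (simp add: E_def)
  qed
qed

text \<open>Multiplying x^2 y^(n - 1) by x or y reaches degree n + 2, which vanishes, so only the
  constant term a of f acts. By the functional, a g annihilates the generator only if
  \<open>\<pi> * g\<close> divides a g, that is, if \<open>\<pi>\<close> divides a.\<close>

lemma bracket_ideal_annihilator:
  fixes t :: "'a::idom"
  assumes n: "n \<ge> 2" and \<pi>: "(\<Sum>i<n - 1. t ^ i) = \<pi> * g" and nz: "(\<Sum>i<n - 1. t ^ i) \<noteq> 0"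
  shows "f * (cst g * coord_x ^ 2 * coord_y ^ (n - 1)) \<in> bracket_ideal t n
      \<longleftrightarrow> \<pi> dvd coeff (coeff f 0) 0"
proof -
  define m :: "'a poly poly" where "m = coord_x ^ 2 * coord_y ^ (n - 1)"
  define a where "a = coeff (coeff f 0) 0"
  obtain u v where f: "f = cst a + coord_x * u + coord_y * v"
    using poly_poly_decomp[of f] unfolding a_def by blast
  have "coord_x ^ Suc 2 * coord_y ^ (n - 1) \<in> bracket_ideal t n"
    and "coord_x ^ 2 * coord_y ^ Suc (n - 1) \<in> bracket_ideal t n"
    using n by (intro monomial_in_bracket_ideal; simp)+
  then have xy: "coord_x * m \<in> bracket_ideal t n" "coord_y * m \<in> bracket_ideal t n"
    by (simp_all add: m_def mult_ac eval_nat_numeral)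
  define r where "r = (cst g * u) * (coord_x * m) + (cst g * v) * (coord_y * m)"
  have r: "r \<in> bracket_ideal t n" 
    unfolding r_def using xy[THEN bracket_ideal_mult] by (rule bracket_ideal_add)
  have fm: "f * (cst g * coord_x ^ 2 * coord_y ^ (n - 1)) = cst (a * g) * m + r"
    by (simp add: m_def r_def algebra_simps) (simp add: f algebra_simps)
  have "cst (a * g) * m + r \<in> bracket_ideal t n \<longleftrightarrow> cst (a * g) * m \<in> bracket_ideal t n"
    using r bracket_ideal_add bracket_ideal_diff[of "cst (a * g) * m + r" t n r] by auto
  also have "\<dots> \<longleftrightarrow> \<pi> dvd a"
  proof
    assume "cst (a * g) * m \<in> bracket_ideal t n"
    then have "(\<Sum>i<n - 1. t ^ i) dvd socle_functional t n (cst (a * g) * coord_x ^ 2 * coord_y ^ (n - 1))"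
      using n by (intro socle_functional_bracket_ideal) (simp_all add: m_def mult_ac)
    then have "\<pi> * g dvd a * g"
      using n unfolding \<pi>[symmetric] by (simp add: socle_functional_monomial del: cst_simps)
    then show "\<pi> dvd a" using nz \<pi> by auto
  next
    assume "\<pi> dvd a"
    then obtain b where b: "a = \<pi> * b" ..
    \<comment> \<open>The relation of the socle: x^n y lies in the ideal and reduces to the
      geometric sum times the generator.\<close>
    have "coord_x ^ n * coord_y ^ 1 - cst (\<pi> * g) * coord_x ^ 2 * coord_y ^ (n - 1) \<in> bracket_ideal t n"
      using monomial_mod_bracket_ideal[of n 1 n t] n \<pi> by simp
    moreover have "coord_x ^ n * coord_y ^ 1 \<in> bracket_ideal t n"
      using bracket_ideal_x[of n n coord_y t] by (simp add: mult.commute)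
    ultimately have "cst (\<pi> * g) * m \<in> bracket_ideal t n"
      using bracket_ideal_diff[of "coord_x ^ n * coord_y ^ 1"] by (fastforce simp: m_def mult.assoc)
    from bracket_ideal_mult[OF this, of "cst b"] show "cst (a * g) * m \<in> bracket_ideal t n"
      by (simp add: b mult_ac)
  qed
  finally show ?thesis unfolding fm a_def .
qed

subsection \<open>Irreducible factors of the geometric sums\<close>

lemma poly_irreducible_factor:
  fixes f :: "'a::field poly"
  shows "degree f > 0 \<Longrightarrow> \<exists>g. Factorial_Ring.irreducible g \<and> g dvd f"
proof (induction "degree f" arbitrary: f rule: less_induct)
  case less
  show ?case
  proof (cases "Factorial_Ring.irreducible f")
    case False
    have "f \<noteq> 0" using less.prems by auto
    then have "\<not> f dvd 1" using less.prems by (simp add: is_unit_iff_degree)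
    then obtain a b where ab: "f = a * b" "\<not> a dvd 1" "\<not> b dvd 1"
      using False \<open>f \<noteq> 0\<close> by (auto simp: Factorial_Ring.irreducible_def)
    then have "a \<noteq> 0" "b \<noteq> 0" "degree a > 0" "degree b > 0"
      using \<open>f \<noteq> 0\<close> by (auto simp: is_unit_iff_degree)
    then have "degree a < degree f" using ab by (simp add: degree_mult_eq)
    from less.hyps[OF this \<open>degree a > 0\<close>] ab show ?thesis by auto
  qed auto
qed

text \<open>The exponents are grouped into n consecutive blocks of length m.\<close>

lemma geometric_sum_mult:
  fixes t :: "'a::comm_ring_1"
  shows "(\<Sum>i<m * n. t ^ i) = (\<Sum>i<m. t ^ i) * (\<Sum>i<n. t ^ (m * i))"
proof (induction n)
  case (Suc n)
  have "(\<Sum>i<m * n + k. t ^ i) = (\<Sum>i<m * n. t ^ i) + t ^ (m * n) * (\<Sum>i<k. t ^ i)" for k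
    by (induction k) (simp_all add: power_add algebra_simps)
  from this[of m] Suc show ?case by (simp add: algebra_simps)
qed simp

text \<open>With \<open>q i = p ^ 2 ^ i\<close> the factors \<open>h i = (t ^ (q i ^ 2 - 1) - 1) / (t ^ (q i - 1) - 1)\<close> are
  pairwise coprime, because \<open>h i\<close> is congruent to \<open>q i + 1 = 1\<close> modulo \<open>t ^ (q i - 1) - 1\<close>.\<close>

lemma geometric_sum_irreducible_factors:
  fixes t :: "'k::field poly"
  assumes p: "CHAR('k) = p" "p > 0" and t: "t = [:0, 1:]"
  obtains \<pi> :: "nat \<Rightarrow> 'k poly" where
    "\<And>i. Factorial_Ring.irreducible (\<pi> i)" "\<And>i. \<pi> i dvd (\<Sum>j<p ^ 2 ^ Suc i - 1. t ^ j)"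
    "\<And>i j. i < j \<Longrightarrow> \<not> \<pi> i dvd \<pi> j"
proof -
  have "p \<ge> 2" using p prime_CHAR_semidom[where 'a='k] prime_ge_2_nat by auto
  define q where "q = (\<lambda>i::nat. p ^ 2 ^ i)"
  define s where "s = (\<lambda>i. \<Sum>j<q i - 1. t ^ j)"
  define h where "h = (\<lambda>i. \<Sum>j<q i + 1. t ^ ((q i - 1) * j))"
  have q2: "q i \<ge> 2" for i
    using self_le_power[of p "2 ^ i"] \<open>p \<ge> 2\<close> by (auto simp: q_def)
  have "q (Suc i) = q i * q i" for i by (simp add: q_def mult_2 flip: power_add)
  then have "q (Suc i) - 1 = (q i - 1) * (q i + 1)" for i
    using q2[of i] by (cases "q i") auto
  then have s_Suc: "s (Suc i) = s i * h i" for i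
    unfolding s_def h_def by (simp only: geometric_sum_mult)
  have s_dvd: "s i dvd s j" if "i \<le> j" for i j
    using that by (induction j rule: dec_induct) (auto simp: s_Suc)
  have s_h: "s i dvd h i - 1" for i
  proof -
    have s1: "t ^ (q i - 1) - 1 = (t - 1) * s i" by (simp add: s_def power_diff_1_eq)
    \<comment> \<open>The sum \<open>h i\<close> has q + 1 terms, and q + 1 = 1 in characteristic p,
      so subtracting 1 from every term subtracts 1 in total.\<close>
    have "(of_nat (q i) :: 'k poly) = 0"
      using p by (auto simp: of_nat_eq_0_iff_char_dvd q_def)
    then have "h i - 1 = (\<Sum>j<q i + 1. t ^ ((q i - 1) * j) - 1)"
      by (simp add: h_def sum_subtractf)
    moreover have "s i dvd t ^ ((q i - 1) * j) - 1" for j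
    proof -
      have "t ^ (q i - 1) - 1 dvd (t ^ (q i - 1)) ^ j - 1"
        by (metis dvd_triv_left power_diff_1_eq)
      then show ?thesis using s1 by (metis dvd_mult_right power_mult)
    qed
    ultimately show ?thesis by (metis (no_types, lifting) dvd_sum)
  qed
  \<comment> \<open>The top power of t comes from the single term j = q, so \<open>h i\<close> is
    not constant and has an irreducible factor.\<close>
  have "degree (h i) > 0" for i
  proof -
    have "t ^ k = monom 1 k" for k by (simp add: t monom_altdef)
    then have "coeff (h i) ((q i - 1) * q i) = (\<Sum>j<q i + 1. if j = q i then 1 else 0)"
      unfolding h_def coeff_sum using q2[of i] by (intro sum.cong) auto
    also have "\<dots> = 1" by simp
    finally have "(q i - 1) * q i \<le> degree (h i)" by (intro le_degree) simp
    moreover have "(q i - 1) * q i > 0" using q2[of i] by simp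
    ultimately show ?thesis by linarith
  qed
  then have "\<forall>i. \<exists>\<pi>. Factorial_Ring.irreducible \<pi> \<and> \<pi> dvd h i" using poly_irreducible_factor by blast
  then obtain \<pi> where \<pi>: "\<And>i. Factorial_Ring.irreducible (\<pi> i)" "\<And>i. \<pi> i dvd h i" by metis
  have \<pi>s: "\<pi> i dvd s (Suc i)" for i using \<pi>(2)[of i] by (simp add: s_Suc)
  show ?thesis
  proof (rule that[OF \<pi>(1)])
    show "\<pi> i dvd (\<Sum>j<p ^ 2 ^ Suc i - 1. t ^ j)" for i
      using \<pi>s[of i] by (simp add: s_def q_def)
    show "\<not> \<pi> i dvd \<pi> j" if "i < j" for i j
    proof
      assume "\<pi> i dvd \<pi> j"
      then have "\<pi> i dvd h j" using \<pi>(2) dvd_trans by blast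
      \<comment> \<open>For i < j, \<open>\<pi> i\<close> divides s (i + 1), which divides s j,
        which divides h j - 1.\<close>
      moreover have "\<pi> i dvd h j - 1"
        using \<pi>s s_dvd[of "Suc i" j] s_h[of j] that by (meson Suc_leI dvd_trans)
      ultimately have "\<pi> i dvd h j - (h j - 1)" by (rule dvd_diff)
      then show False using \<pi>(1) by (simp add: Factorial_Ring.irreducible_def)
    qed
  qed
qed

section \<open>Cyclic modules and base change\<close>

subsection \<open>Cyclic modules\<close>

text \<open>Presents M as R/I through a chosen generator u. The later constructions transform only
  I, and isomorphism type and associated primes depend on I alone.\<close>

definition cyclic_module ::
    "('a, 'c) ring_scheme \<Rightarrow> ('a, 'm) module \<Rightarrow> 'm \<Rightarrow> 'a set \<Rightarrow> bool" where
  "cyclic_module R M u I \<longleftrightarrow> module R M \<and> u \<in> carrier M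
     \<and> carrier M = (\<lambda>r. r \<odot>\<^bsub>M\<^esub> u) ` carrier R
     \<and> I = {r \<in> carrier R. r \<odot>\<^bsub>M\<^esub> u = \<zero>\<^bsub>M\<^esub>}"

lemma (in module) annihilator_ideal:
  assumes "u \<in> carrier M"
  shows "ideal {r \<in> carrier R. r \<odot>\<^bsub>M\<^esub> u = \<zero>\<^bsub>M\<^esub>} R"
proof (rule idealI)
  show "ring R" by (rule R.ring_axioms)
  show "subgroup {r \<in> carrier R. r \<odot>\<^bsub>M\<^esub> u = \<zero>\<^bsub>M\<^esub>} (add_monoid R)"
    using assms
    by unfold_locales
      (auto simp: smult_l_distr smult_l_minus simp flip: a_inv_def)
  show "x \<otimes> a \<in> {r \<in> carrier R. r \<odot>\<^bsub>M\<^esub> u = \<zero>\<^bsub>M\<^esub>}"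
    and "a \<otimes> x \<in> {r \<in> carrier R. r \<odot>\<^bsub>M\<^esub> u = \<zero>\<^bsub>M\<^esub>}"
    if "a \<in> {r \<in> carrier R. r \<odot>\<^bsub>M\<^esub> u = \<zero>\<^bsub>M\<^esub>}" "x \<in> carrier R" for a x
    using that assms smult_assoc1[of x a u] R.m_comm[of a x] by auto
qed

lemma (in module) smult_eq_iff:
  assumes "u \<in> carrier M" "r \<in> carrier R" "s \<in> carrier R"
  shows "r \<odot>\<^bsub>M\<^esub> u = s \<odot>\<^bsub>M\<^esub> u \<longleftrightarrow> (r \<ominus> s) \<odot>\<^bsub>M\<^esub> u = \<zero>\<^bsub>M\<^esub>"
proof -
  have "(r \<ominus> s) \<odot>\<^bsub>M\<^esub> u = r \<odot>\<^bsub>M\<^esub> u \<ominus>\<^bsub>M\<^esub> s \<odot>\<^bsub>M\<^esub> u"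
    using assms by (simp add: R.minus_eq M.minus_eq smult_l_distr smult_l_minus)
  then show ?thesis using assms M.minus_equality M.minus_minus
    by (metis M.minus_eq M.r_neg M.a_inv_closed smult_closed)
qed

lemma cyclic_moduleD:
  assumes "cyclic_module R M u I"
  shows "module R M" "u \<in> carrier M" "carrier M = (\<lambda>r. r \<odot>\<^bsub>M\<^esub> u) ` carrier R"
    "I = {r \<in> carrier R. r \<odot>\<^bsub>M\<^esub> u = \<zero>\<^bsub>M\<^esub>}" "ideal I R"
proof -
  show "module R M" "u \<in> carrier M" "carrier M = (\<lambda>r. r \<odot>\<^bsub>M\<^esub> u) ` carrier R"
    and I: "I = {r \<in> carrier R. r \<odot>\<^bsub>M\<^esub> u = \<zero>\<^bsub>M\<^esub>}"
    using assms unfolding cyclic_module_def by blast+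
  show "ideal I R"
    unfolding I by (rule module.annihilator_ideal) fact+
qed

lemma cyclic_module_smult_eq_iff:
  assumes "cyclic_module R M u I" "r \<in> carrier R" "s \<in> carrier R"
  shows "r \<odot>\<^bsub>M\<^esub> u = s \<odot>\<^bsub>M\<^esub> u \<longleftrightarrow> r \<ominus>\<^bsub>R\<^esub> s \<in> I"
proof -
  interpret module R M using assms(1) by (rule cyclic_moduleD)
  show ?thesis
    using smult_eq_iff[OF cyclic_moduleD(2)[OF assms(1)] assms(2,3)] assms(2,3)
    unfolding cyclic_moduleD(4)[OF assms(1)] by simp
qed

lemma cyclic_module_ring_module:
  assumes "cring R"
  shows "cyclic_module R (ring_module R) \<one>\<^bsub>R\<^esub> {\<zero>\<^bsub>R\<^esub>}"
proof -
  interpret cring R by fact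
  have "abelian_group (ring_module R)"
    by (rule abelian_groupI) (auto simp: ring_module_def a_ac intro: bexI[of _ "\<ominus>\<^bsub>R\<^esub> _"] l_neg)
  then have "module R (ring_module R)"
    by (intro moduleI) (auto simp: ring_module_def l_distr r_distr m_assoc intro: cring_axioms)
  then show ?thesis unfolding cyclic_module_def
    by (auto simp: ring_module_def image_iff)
qed

text \<open>The map r u -> r v is well defined and injective for the same reason: on both sides
  equality means that the difference of the coefficients lies in I.\<close>

lemma isomorphic_cyclic_modules:
  assumes M: "cyclic_module R M u I" and N: "cyclic_module R N v I"
  shows "isomorphic_modules R M N"
proof -
  interpret M: module R M using M by (rule cyclic_moduleD)
  interpret N: module R N using N by (rule cyclic_moduleD)
  note cM = cyclic_moduleD(3)[OF M] and cN = cyclic_moduleD(3)[OF N]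
  note u = cyclic_moduleD(2)[OF M] and v = cyclic_moduleD(2)[OF N]
  have eq: "r \<odot>\<^bsub>M\<^esub> u = s \<odot>\<^bsub>M\<^esub> u \<longleftrightarrow> r \<odot>\<^bsub>N\<^esub> v = s \<odot>\<^bsub>N\<^esub> v"
    if "r \<in> carrier R" "s \<in> carrier R" for r s
    using cyclic_module_smult_eq_iff[OF M that] cyclic_module_smult_eq_iff[OF N that] by simp
  define h where "h = (\<lambda>m. (SOME r. r \<in> carrier R \<and> m = r \<odot>\<^bsub>M\<^esub> u) \<odot>\<^bsub>N\<^esub> v)"
  have h: "h (r \<odot>\<^bsub>M\<^esub> u) = r \<odot>\<^bsub>N\<^esub> v" if "r \<in> carrier R" for r
  proof -
    define s where "s = (SOME s. s \<in> carrier R \<and> r \<odot>\<^bsub>M\<^esub> u = s \<odot>\<^bsub>M\<^esub> u)"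
    have "\<exists>s. s \<in> carrier R \<and> r \<odot>\<^bsub>M\<^esub> u = s \<odot>\<^bsub>M\<^esub> u" using that by blast
    from someI_ex[OF this] have "s \<in> carrier R" "r \<odot>\<^bsub>M\<^esub> u = s \<odot>\<^bsub>M\<^esub> u" by (simp_all add: s_def)
    then have "s \<odot>\<^bsub>N\<^esub> v = r \<odot>\<^bsub>N\<^esub> v" using eq[OF that, of s] by metis
    then show ?thesis by (simp only: h_def s_def)
  qed
  have "h \<in> iso (add_monoid M) (add_monoid N)"
  proof (intro isoI homI)
    have "inj_on h ((\<lambda>r. r \<odot>\<^bsub>M\<^esub> u) ` carrier R)"
      using h eq by (simp add: inj_on_def)
    moreover have "h ` (\<lambda>r. r \<odot>\<^bsub>M\<^esub> u) ` carrier R = (\<lambda>r. r \<odot>\<^bsub>N\<^esub> v) ` carrier R"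
      using h by (simp add: image_image)
    ultimately show "bij_betw h (carrier (add_monoid M)) (carrier (add_monoid N))"
      unfolding bij_betw_def by (metis cM cN partial_object.select_convs(1))
    fix x assume "x \<in> carrier (add_monoid M)"
    then obtain r where r: "r \<in> carrier R" "x = r \<odot>\<^bsub>M\<^esub> u" using cM by auto
    show "h x \<in> carrier (add_monoid N)" using h r v by simp
    fix y assume "y \<in> carrier (add_monoid M)"
    then obtain s where s: "s \<in> carrier R" "y = s \<odot>\<^bsub>M\<^esub> u" using cM by auto
    have "x \<oplus>\<^bsub>M\<^esub> y = (r \<oplus>\<^bsub>R\<^esub> s) \<odot>\<^bsub>M\<^esub> u" using r s u by (simp add: M.smult_l_distr)
    then show "h (x \<otimes>\<^bsub>add_monoid M\<^esub> y) = h x \<otimes>\<^bsub>add_monoid N\<^esub> h y"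
      using h r s v by (simp add: N.smult_l_distr)
  qed
  moreover have "h (a \<odot>\<^bsub>M\<^esub> m) = a \<odot>\<^bsub>N\<^esub> h m" if "a \<in> carrier R" "m \<in> carrier M" for a m
  proof -
    from that obtain r where r: "r \<in> carrier R" "m = r \<odot>\<^bsub>M\<^esub> u" using cM by auto
    have "a \<odot>\<^bsub>M\<^esub> m = (a \<otimes>\<^bsub>R\<^esub> r) \<odot>\<^bsub>M\<^esub> u" using r that u by (simp add: M.smult_assoc1)
    then show ?thesis using h r that v by (simp add: N.smult_assoc1)
  qed
  ultimately have "h \<in> module_iso R M N" by (simp add: module_iso_def)
  then show ?thesis unfolding isomorphic_modules_def by blast
qed

text \<open>The annihilator of r u is the colon ideal (I : r).\<close>

lemma Ass_cyclic_module:
  assumes "cyclic_module R M u I"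
  shows "Ass R M = {P. primeideal P R \<and> (\<exists>r\<in>carrier R. P = {a \<in> carrier R. a \<otimes>\<^bsub>R\<^esub> r \<in> I})}"
proof -
  interpret module R M using assms by (rule cyclic_moduleD)
  note D = cyclic_moduleD[OF assms]
  have eq: "{a \<in> carrier R. a \<odot>\<^bsub>M\<^esub> (r \<odot>\<^bsub>M\<^esub> u) = \<zero>\<^bsub>M\<^esub>} = {a \<in> carrier R. a \<otimes>\<^bsub>R\<^esub> r \<in> I}"
    if "r \<in> carrier R" for r
    using that D(2) unfolding D(4) by (auto simp: smult_assoc1)
  show ?thesis unfolding Ass_def D(3) bex_simps(7) by (simp add: eq cong: bex_cong)
qed

subsection \<open>Quotients of cyclic modules\<close>

lemma quotient_module:
  fixes M :: "('a, 'm) module" and R (structure)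
  assumes "module R M" and "submodule N R M"
  shows "module R (quotient_module M N)"
    and "carrier (quotient_module M N) = (\<lambda>m. N +>\<^bsub>M\<^esub> m) ` carrier M"
    and "\<And>a m. a \<in> carrier R \<Longrightarrow> m \<in> carrier M \<Longrightarrow>
      a \<odot>\<^bsub>quotient_module M N\<^esub> (N +>\<^bsub>M\<^esub> m) = N +>\<^bsub>M\<^esub> (a \<odot>\<^bsub>M\<^esub> m)"
    and "\<And>m. m \<in> carrier M \<Longrightarrow> N +>\<^bsub>M\<^esub> m = \<zero>\<^bsub>quotient_module M N\<^esub> \<longleftrightarrow> m \<in> N"
proof -
  interpret module R M by fact
  interpret N: submodule N R M by fact
  have sub: "subgroup N (add_monoid M)" by (rule N.subgroup_axioms)
  interpret N: abelian_subgroup N M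
    by (rule abelian_subgroupI3) (use sub in \<open>auto intro: additive_subgroup.intro M.abelian_group_axioms\<close>)
  show carr: "carrier (quotient_module M N) = (\<lambda>m. N +>\<^bsub>M\<^esub> m) ` carrier M"
    by (auto simp: quotient_module_def A_RCOSETS_def')
  have add: "(N +>\<^bsub>M\<^esub> m) \<oplus>\<^bsub>quotient_module M N\<^esub> (N +>\<^bsub>M\<^esub> n) = N +>\<^bsub>M\<^esub> (m \<oplus>\<^bsub>M\<^esub> n)"
    if "m \<in> carrier M" "n \<in> carrier M" for m n
    using that by (simp add: quotient_module_def N.a_rcos_sum)
  have mem: "n \<in> N +>\<^bsub>M\<^esub> m \<longleftrightarrow> n \<ominus>\<^bsub>M\<^esub> m \<in> N" if "m \<in> carrier M" "n \<in> carrier M" for m n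
    using that N.a_rcos_module by (simp add: M.minus_eq)
  show smult: "a \<odot>\<^bsub>quotient_module M N\<^esub> (N +>\<^bsub>M\<^esub> m) = N +>\<^bsub>M\<^esub> (a \<odot>\<^bsub>M\<^esub> m)"
    if "a \<in> carrier R" "m \<in> carrier M" for a m
  proof -
    \<comment> \<open>Independence of the representative: all cosets in the union that defines
      scalar multiplication coincide, so the union is a single coset.\<close>
    have "N +>\<^bsub>M\<^esub> (a \<odot>\<^bsub>M\<^esub> n) = N +>\<^bsub>M\<^esub> (a \<odot>\<^bsub>M\<^esub> m)" if n: "n \<in> N +>\<^bsub>M\<^esub> m" for n
    proof -
      have "n \<in> carrier M" using n \<open>m \<in> carrier M\<close> N.a_elemrcos_carrier by blast
      then have "n \<ominus>\<^bsub>M\<^esub> m \<in> N" using n mem \<open>m \<in> carrier M\<close> by simp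
      then have "a \<odot>\<^bsub>M\<^esub> (n \<ominus>\<^bsub>M\<^esub> m) \<in> N" using \<open>a \<in> carrier R\<close> N.smult_closed by simp
      moreover have "a \<odot>\<^bsub>M\<^esub> (n \<ominus>\<^bsub>M\<^esub> m) = a \<odot>\<^bsub>M\<^esub> n \<ominus>\<^bsub>M\<^esub> a \<odot>\<^bsub>M\<^esub> m"
        using \<open>a \<in> carrier R\<close> \<open>n \<in> carrier M\<close> \<open>m \<in> carrier M\<close>
        by (simp add: M.minus_eq smult_r_distr smult_r_minus)
      ultimately have "a \<odot>\<^bsub>M\<^esub> n \<in> N +>\<^bsub>M\<^esub> (a \<odot>\<^bsub>M\<^esub> m)"
        using mem \<open>a \<in> carrier R\<close> \<open>n \<in> carrier M\<close> \<open>m \<in> carrier M\<close> by simp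
      moreover have "a \<odot>\<^bsub>M\<^esub> m \<in> carrier M" using \<open>a \<in> carrier R\<close> \<open>m \<in> carrier M\<close> by simp
      ultimately show ?thesis using M.a_repr_independence[OF _ _ sub] by metis
    qed
    moreover have "N +>\<^bsub>M\<^esub> m \<noteq> {}" using that N.a_rcos_self by blast
    ultimately have "(\<Union>n\<in>N +>\<^bsub>M\<^esub> m. N +>\<^bsub>M\<^esub> (a \<odot>\<^bsub>M\<^esub> n)) = N +>\<^bsub>M\<^esub> (a \<odot>\<^bsub>M\<^esub> m)"
      by (intro SUP_eq_const)
    then show ?thesis by (simp add: quotient_module_def)
  qed
  have zero: "\<zero>\<^bsub>quotient_module M N\<^esub> = N +>\<^bsub>M\<^esub> \<zero>\<^bsub>M\<^esub>"
    using N.a_rcos_const by (simp add: quotient_module_def)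
  have "abelian_group (quotient_module M N)"
  proof (rule abelian_groupI)
    fix x assume "x \<in> carrier (quotient_module M N)"
    then obtain m where m: "m \<in> carrier M" "x = N +>\<^bsub>M\<^esub> m" using carr by auto
    then have "(N +>\<^bsub>M\<^esub> (\<ominus>\<^bsub>M\<^esub> m)) \<oplus>\<^bsub>quotient_module M N\<^esub> x = \<zero>\<^bsub>quotient_module M N\<^esub>"
      by (simp add: add zero M.l_neg)
    then show "\<exists>y\<in>carrier (quotient_module M N). y \<oplus>\<^bsub>quotient_module M N\<^esub> x = \<zero>\<^bsub>quotient_module M N\<^esub>"
      using m carr by auto
  qed (auto simp: carr add zero M.a_ac)
  then show "module R (quotient_module M N)"
    by (intro moduleI)
      (auto simp: carr smult add smult_l_distr smult_r_distr smult_assoc1 intro: R.cring_axioms)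
  show "N +>\<^bsub>M\<^esub> m = \<zero>\<^bsub>quotient_module M N\<^esub> \<longleftrightarrow> m \<in> N" if "m \<in> carrier M" for m
    using that N.a_rcos_self N.a_rcos_const by (auto simp: quotient_module_def)
qed

text \<open>The submodule is J u. Since I is contained in J, r u in J u forces r in J, so the new
  annihilator is exactly J.\<close>

lemma cyclic_module_quotient:
  assumes M: "cyclic_module R M u I" and J: "ideal J R" and "I \<subseteq> J" and K: "K = (\<lambda>r. r \<odot>\<^bsub>M\<^esub> u) ` J"
  shows "cyclic_module R (quotient_module M K) (K +>\<^bsub>M\<^esub> u) J"
proof -
  interpret module R M using M by (rule cyclic_moduleD)
  interpret J: ideal J R by fact
  note D = cyclic_moduleD[OF M]
  have "submodule K R M"
  proof (rule submoduleI)
    show "K \<subseteq> carrier M" using K D(2) by auto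
    have KI: "r \<odot>\<^bsub>M\<^esub> u \<in> K" if "r \<in> J" for r using that K by blast
    show "\<zero>\<^bsub>M\<^esub> \<in> K" using KI[of "\<zero>\<^bsub>R\<^esub>"] D(2) by simp
    fix a assume "a \<in> K"
    then obtain r where r: "r \<in> J" "a = r \<odot>\<^bsub>M\<^esub> u" using K by blast
    show "\<ominus>\<^bsub>M\<^esub> a \<in> K" using KI[of "\<ominus>\<^bsub>R\<^esub> r"] r D(2) by (simp add: smult_l_minus)
    show "b \<odot>\<^bsub>M\<^esub> a \<in> K" if "b \<in> carrier R" for b
      using KI[of "b \<otimes>\<^bsub>R\<^esub> r"] r D(2) that by (simp add: smult_assoc1 J.I_l_closed)
    fix b assume "b \<in> K"
    then obtain s where s: "s \<in> J" "b = s \<odot>\<^bsub>M\<^esub> u" using K by blast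
    show "a \<oplus>\<^bsub>M\<^esub> b \<in> K" using KI[of "r \<oplus>\<^bsub>R\<^esub> s"] r s D(2) by (simp add: smult_l_distr)
  qed
  note Q = quotient_module[OF cyclic_moduleD(1)[OF M] this]
  have "r \<odot>\<^bsub>M\<^esub> u \<in> K \<longleftrightarrow> r \<in> J" if "r \<in> carrier R" for r
  proof
    assume "r \<odot>\<^bsub>M\<^esub> u \<in> K"
    then obtain s where s: "s \<in> J" "r \<odot>\<^bsub>M\<^esub> u = s \<odot>\<^bsub>M\<^esub> u" using K by auto
    then have "r \<ominus>\<^bsub>R\<^esub> s \<in> J" using cyclic_module_smult_eq_iff[OF M] that \<open>I \<subseteq> J\<close> by auto
    then have "(r \<ominus>\<^bsub>R\<^esub> s) \<oplus>\<^bsub>R\<^esub> s \<in> J" using s by simp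
    then show "r \<in> J" using s that by (simp add: R.minus_eq R.a_assoc R.l_neg)
  qed (use K in auto)
  then have "r \<odot>\<^bsub>quotient_module M K\<^esub> (K +>\<^bsub>M\<^esub> u) = \<zero>\<^bsub>quotient_module M K\<^esub> \<longleftrightarrow> r \<in> J"
    if "r \<in> carrier R" for r
    using Q(3)[OF that D(2)] Q(4)[of "r \<odot>\<^bsub>M\<^esub> u"] that D(2) by simp
  then have "J = {r \<in> carrier R. r \<odot>\<^bsub>quotient_module M K\<^esub> (K +>\<^bsub>M\<^esub> u) = \<zero>\<^bsub>quotient_module M K\<^esub>}"
    using J.a_subset by blast
  moreover have "carrier (quotient_module M K) = (\<lambda>r. r \<odot>\<^bsub>quotient_module M K\<^esub> (K +>\<^bsub>M\<^esub> u)) ` carrier R"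
    unfolding Q(2) by (subst D(3)) (simp add: image_image Q(3) D(2) cong: image_cong_simp)
  moreover have "K +>\<^bsub>M\<^esub> u \<in> carrier (quotient_module M K)" using Q(2) D(2) by blast
  ultimately show ?thesis using Q(1) unfolding cyclic_module_def by blast
qed

lemma cyclic_module_ring_quotient:
  assumes R: "cring R" and J: "ideal J R"
  shows "cyclic_module R (quotient_module (ring_module R) J) (J +>\<^bsub>ring_module R\<^esub> \<one>\<^bsub>R\<^esub>) J"
proof -
  interpret cring R by fact
  interpret J: ideal J R by fact
  have "r \<odot>\<^bsub>ring_module R\<^esub> \<one>\<^bsub>R\<^esub> = r" if "r \<in> J" for r
    using that J.a_subset by (auto simp: ring_module_def)
  then have "J = (\<lambda>r. r \<odot>\<^bsub>ring_module R\<^esub> \<one>\<^bsub>R\<^esub>) ` J" by simp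
  with J.zero_closed show ?thesis
    by (intro cyclic_module_quotient[OF cyclic_module_ring_module[OF R] J]) simp_all
qed

subsection \<open>Base change\<close>

locale base_change = module R M + S: cring S
  for R (structure) and M :: "('r, 'm) module" (structure) and S :: "('s, 'd) ring_scheme" +
  fixes \<phi> :: "'r \<Rightarrow> 's"
  assumes \<phi>: "\<phi> \<in> ring_hom R S"
begin

abbreviation "frag_carrier \<equiv> {c :: ('s \<times> 'm) \<Rightarrow>\<^sub>0 int. Poly_Mapping.keys c \<subseteq> carrier S \<times> carrier M}"
abbreviation "H \<equiv> tensor_subgroup S R \<phi> M"
abbreviation "T \<equiv> tensor_module S R \<phi> M"
abbreviation "cls \<equiv> tensor_class S R \<phi> M"
abbreviation "scale a \<equiv> frag_extend (\<lambda>(s, m). frag_of (a \<otimes>\<^bsub>S\<^esub> s, m))"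

lemma \<phi>_closed [simp]: "r \<in> carrier R \<Longrightarrow> \<phi> r \<in> carrier S"
  using \<phi> by (rule ring_hom_closed)

lemma frag_carrier_add: "c \<in> frag_carrier \<Longrightarrow> d \<in> frag_carrier \<Longrightarrow> c + d \<in> frag_carrier"
  using order_trans[OF keys_add[of c d], of "carrier S \<times> carrier M"] by simp

lemma frag_carrier_diff: "c \<in> frag_carrier \<Longrightarrow> d \<in> frag_carrier \<Longrightarrow> c - d \<in> frag_carrier"
  using order_trans[OF keys_diff[of c d], of "carrier S \<times> carrier M"] by simp

lemma frag_carrier_frag_of: "s \<in> carrier S \<Longrightarrow> m \<in> carrier M \<Longrightarrow> frag_of (s, m) \<in> frag_carrier"
  by simp

lemma frag_carrier_induct [consumes 1, case_names zero diff frag]: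
  assumes "c \<in> frag_carrier" "P 0" "\<And>c d. c \<in> frag_carrier \<Longrightarrow> d \<in> frag_carrier \<Longrightarrow> P c \<Longrightarrow> P d \<Longrightarrow> P (c - d)"
    "\<And>s m. s \<in> carrier S \<Longrightarrow> m \<in> carrier M \<Longrightarrow> P (frag_of (s, m))"
  shows "P c"
  by (rule free_Abelian_group_induct[of c "carrier S \<times> carrier M"]) (use assms in auto)

lemma tensor_relations_subset: "tensor_relations S R \<phi> M \<subseteq> frag_carrier"
  unfolding tensor_relations_def
  by (intro Un_least subsetI; elim CollectE exE conjE; hypsubst)
    (intro frag_carrier_diff frag_carrier_frag_of; simp)+

lemma carrier_tensor_free: "carrier (tensor_free S M) = frag_carrier"
  by (simp add: tensor_free_def free_Abelian_group_def)

lemma subgroup_H: "subgroup H (tensor_free S M)"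
  unfolding tensor_subgroup_def
  by (rule group.generate_is_subgroup)
    (use tensor_relations_subset carrier_tensor_free in \<open>simp_all add: tensor_free_def\<close>)

lemma H_frag_carrier: "c \<in> H \<Longrightarrow> c \<in> frag_carrier"
  using subgroup.subset[OF subgroup_H] carrier_tensor_free by blast

lemma H_0 [simp]: "0 \<in> H"
  using subgroup.one_closed[OF subgroup_H] by (simp add: tensor_free_def)

lemma H_add: "c \<in> H \<Longrightarrow> d \<in> H \<Longrightarrow> c + d \<in> H"
  using subgroup.m_closed[OF subgroup_H] by (simp add: tensor_free_def)

lemma H_minus: "c \<in> H \<Longrightarrow> - c \<in> H"
  using subgroup.m_inv_closed[OF subgroup_H, of c] H_frag_carrier[of c] by (simp add: tensor_free_def)

lemma H_diff: "c \<in> H \<Longrightarrow> d \<in> H \<Longrightarrow> c - d \<in> H"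
  using H_add[of c "- d"] H_minus by simp

lemma H_relations:
  assumes "s \<in> carrier S" "m \<in> carrier M"
  shows "s' \<in> carrier S \<Longrightarrow> frag_of (s \<oplus>\<^bsub>S\<^esub> s', m) - frag_of (s, m) - frag_of (s', m) \<in> H"
    and "m' \<in> carrier M \<Longrightarrow> frag_of (s, m \<oplus>\<^bsub>M\<^esub> m') - frag_of (s, m) - frag_of (s, m') \<in> H"
    and "r \<in> carrier R \<Longrightarrow> frag_of (s \<otimes>\<^bsub>S\<^esub> \<phi> r, m) - frag_of (s, r \<odot>\<^bsub>M\<^esub> m) \<in> H"
proof -
  have incl: "c \<in> H" if "c \<in> tensor_relations S R \<phi> M" for c
    using that unfolding tensor_subgroup_def by (rule generate.incl)
  show "frag_of (s \<oplus>\<^bsub>S\<^esub> s', m) - frag_of (s, m) - frag_of (s', m) \<in> H" if "s' \<in> carrier S"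
    using assms that unfolding tensor_relations_def
    by (intro incl[unfolded tensor_relations_def] UnI1 CollectI exI) (rule conjI[OF refl], simp)
  show "frag_of (s, m \<oplus>\<^bsub>M\<^esub> m') - frag_of (s, m) - frag_of (s, m') \<in> H" if "m' \<in> carrier M"
    using assms that unfolding tensor_relations_def
    by (intro incl[unfolded tensor_relations_def] UnI1[OF UnI2] CollectI exI) (rule conjI[OF refl], simp)
  show "frag_of (s \<otimes>\<^bsub>S\<^esub> \<phi> r, m) - frag_of (s, r \<odot>\<^bsub>M\<^esub> m) \<in> H" if "r \<in> carrier R"
    using assms that unfolding tensor_relations_def
    by (intro incl[unfolded tensor_relations_def] UnI2 CollectI exI) (rule conjI[OF refl], simp)
qed

lemma H_induct [consumes 1, case_names zero diff add_left add_right scalar]: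
  assumes "c \<in> H" "P 0" "\<And>c d. c \<in> H \<Longrightarrow> d \<in> H \<Longrightarrow> P c \<Longrightarrow> P d \<Longrightarrow> P (c - d)"
    and "\<And>s s' m. s \<in> carrier S \<Longrightarrow> s' \<in> carrier S \<Longrightarrow> m \<in> carrier M \<Longrightarrow>
      P (frag_of (s \<oplus>\<^bsub>S\<^esub> s', m) - frag_of (s, m) - frag_of (s', m))"
    and "\<And>s m m'. s \<in> carrier S \<Longrightarrow> m \<in> carrier M \<Longrightarrow> m' \<in> carrier M \<Longrightarrow>
      P (frag_of (s, m \<oplus>\<^bsub>M\<^esub> m') - frag_of (s, m) - frag_of (s, m'))"
    and "\<And>s r m. s \<in> carrier S \<Longrightarrow> r \<in> carrier R \<Longrightarrow> m \<in> carrier M \<Longrightarrow>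
      P (frag_of (s \<otimes>\<^bsub>S\<^esub> \<phi> r, m) - frag_of (s, r \<odot>\<^bsub>M\<^esub> m))"
  shows "P c"
proof -
  \<comment> \<open>Membership in \<open>H\<close> is carried along with P because the difference
    rule asks for it.\<close>
  have rel: "c \<in> H \<and> P c" if "c \<in> tensor_relations S R \<phi> M" for c
  proof
    show "c \<in> H" using that unfolding tensor_subgroup_def by (rule generate.incl)
    show "P c" using that unfolding tensor_relations_def
      by (elim UnE CollectE exE conjE) (simp_all only: assms(4-6))
  qed
  have neg: "- c \<in> H \<and> P (- c)" if "c \<in> H \<and> P c" for c
    using that assms(3)[of 0 c] assms(2) H_minus by simp
  have "c \<in> generate (tensor_free S M) (tensor_relations S R \<phi> M)"
    using assms(1) by (simp add: tensor_subgroup_def)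
  then have "c \<in> H \<and> P c"
  proof (induction rule: generate.induct)
    case one
    show ?case using assms(2) by (simp add: tensor_free_def)
  next
    case (incl c)
    then show ?case by (rule rel)
  next
    case (inv c)
    then have "Poly_Mapping.keys c \<subseteq> carrier S \<times> carrier M" using tensor_relations_subset by blast
    then show ?case using neg[OF rel[OF inv]] by (simp add: tensor_free_def)
  next
    case (eng c d)
    then show ?case using assms(3)[of c "- d"] neg[of d] H_add by (simp add: tensor_free_def)
  qed
  then show ?thesis ..
qed

lemma cls_eq: "cls c = (\<lambda>h. h + c) ` H"
  by (auto simp: tensor_class_def r_coset_def tensor_free_def)

lemma cls_eq_iff: "cls c = cls d \<longleftrightarrow> c - d \<in> H"
proof
  assume "cls c = cls d"
  moreover have "0 + c \<in> cls c" unfolding cls_eq by (rule imageI) simp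
  ultimately obtain h where "h \<in> H" "0 + c = h + d" unfolding cls_eq by auto
  then show "c - d \<in> H" by simp
next
  assume cd: "c - d \<in> H"
  show "cls c = cls d"
  proof
    show "cls c \<subseteq> cls d"
    proof
      fix x assume "x \<in> cls c"
      then obtain h where "h \<in> H" "x = h + c" unfolding cls_eq by auto
      then have "x = (h + (c - d)) + d" "h + (c - d) \<in> H" using cd H_add by auto
      then show "x \<in> cls d" unfolding cls_eq by (rule image_eqI)
    qed
    show "cls d \<subseteq> cls c"
    proof
      fix x assume "x \<in> cls d"
      then obtain h where "h \<in> H" "x = h + d" unfolding cls_eq by auto
      then have "x = (h - (c - d)) + c" "h - (c - d) \<in> H" using cd H_diff by auto
      then show "x \<in> cls c" unfolding cls_eq by (rule image_eqI)
    qed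
  qed
qed

lemma carrier_T: "carrier T = cls ` frag_carrier"
  by (auto simp: tensor_module_def RCOSETS_def tensor_class_def carrier_tensor_free)

lemma cls_closed: "c \<in> frag_carrier \<Longrightarrow> cls c \<in> carrier T"
  unfolding carrier_T by (rule imageI)

lemma carrier_T_cases:
  assumes "x \<in> carrier T"
  obtains c where "c \<in> frag_carrier" "x = cls c"
  using assms unfolding carrier_T by blast

lemma zero_T: "\<zero>\<^bsub>T\<^esub> = cls 0"
  by (simp add: tensor_module_def cls_eq)

lemma cls_eq_zero_iff: "cls c = \<zero>\<^bsub>T\<^esub> \<longleftrightarrow> c \<in> H"
  by (simp add: zero_T cls_eq_iff)

lemma add_T: "cls c \<oplus>\<^bsub>T\<^esub> cls d = cls (c + d)"
proof -
  have "cls c \<oplus>\<^bsub>T\<^esub> cls d = {(h + c) + (k + d) |h k. h \<in> H \<and> k \<in> H}"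
    by (auto simp: tensor_module_def cls_eq set_mult_def tensor_free_def)
  also have "\<dots> = cls (c + d)"
  proof
    show "{(h + c) + (k + d) |h k. h \<in> H \<and> k \<in> H} \<subseteq> cls (c + d)"
    proof clarify
      fix h k assume "h \<in> H" "k \<in> H"
      then have "h + c + (k + d) = (h + k) + (c + d)" "h + k \<in> H" by (auto intro: H_add)
      then show "h + c + (k + d) \<in> cls (c + d)" unfolding cls_eq by (rule image_eqI)
    qed
    show "cls (c + d) \<subseteq> {(h + c) + (k + d) |h k. h \<in> H \<and> k \<in> H}"
    proof
      fix x assume "x \<in> cls (c + d)"
      then obtain h where "h \<in> H" "x = h + (c + d)" unfolding cls_eq by auto
      then have "x = (h + c) + (0 + d)" by (simp add: add.assoc)
      with \<open>h \<in> H\<close> H_0 show "x \<in> {(h + c) + (k + d) |h k. h \<in> H \<and> k \<in> H}" by blast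
    qed
  qed
  finally show ?thesis .
qed

lemma frag_carrier_scale: "a \<in> carrier S \<Longrightarrow> c \<in> frag_carrier \<Longrightarrow> scale a c \<in> frag_carrier"
proof -
  assume a: "a \<in> carrier S" and c: "c \<in> frag_carrier"
  have "Poly_Mapping.keys (case x of (s, m) \<Rightarrow> frag_of (a \<otimes>\<^bsub>S\<^esub> s, m)) \<subseteq> carrier S \<times> carrier M"
    if "x \<in> Poly_Mapping.keys c" for x
    using that a c by (cases x) auto
  from order_trans[OF keys_frag_extend UN_least[OF this]] show ?thesis by simp
qed

text \<open>Scaling maps each kind of relation to a relation of the same kind; this makes scalar
  multiplication on classes well defined.\<close>

lemma scale_H:
  assumes "c \<in> H" and a: "a \<in> carrier S"
  shows "scale a c \<in> H"
proof (rule H_induct[OF assms(1), of "\<lambda>c. scale a c \<in> H"], goal_cases)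
  case 1
  show ?case unfolding frag_extend_0 by (rule H_0)
next
  case (2 c d)
  show ?case unfolding frag_extend_diff by (rule H_diff[OF 2(3,4)])
next
  case (3 s s' m)
  show ?case
    using H_relations(1)[OF S.m_closed[OF a 3(1)] 3(3) S.m_closed[OF a 3(2)]]
    unfolding frag_extend_diff frag_extend_of prod.case S.r_distr[OF 3(1,2) a] .
next
  case (4 s m m')
  show ?case
    using H_relations(2)[OF S.m_closed[OF a 4(1)] 4(2,3)]
    unfolding frag_extend_diff frag_extend_of prod.case .
next
  case (5 s r m)
  show ?case
    using H_relations(3)[OF S.m_closed[OF a 5(1)] 5(3,2)]
    unfolding frag_extend_diff frag_extend_of prod.case S.m_assoc[OF a 5(1) \<phi>_closed[OF 5(2)]] .
qed

lemma smult_T: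
  assumes "a \<in> carrier S"
  shows "a \<odot>\<^bsub>T\<^esub> cls c = cls (scale a c)"
proof -
  have "cls (scale a d) = cls (scale a c)" if "d \<in> cls c" for d
  proof -
    from that obtain h where "h \<in> H" "d = h + c" unfolding cls_eq by auto
    then have "scale a d - scale a c \<in> H"
      using scale_H assms by (simp add: frag_extend_add)
    then show ?thesis by (simp add: cls_eq_iff)
  qed
  moreover have "cls c \<noteq> {}" using H_0 unfolding cls_eq by blast
  ultimately have "(\<Union>d\<in>cls c. cls (scale a d)) = cls (scale a c)" by (intro SUP_eq_const)
  then show ?thesis by (simp add: tensor_module_def)
qed

lemma tensor_module: "module S T"
proof (intro moduleI)
  show "cring S" ..
  show "abelian_group T"
  proof (rule abelian_groupI)
    show "x \<oplus>\<^bsub>T\<^esub> y \<in> carrier T" if "x \<in> carrier T" "y \<in> carrier T" for x y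
    proof -
      obtain c where "c \<in> frag_carrier" "x = cls c" using \<open>x \<in> carrier T\<close> by (rule carrier_T_cases)
      moreover obtain d where "d \<in> frag_carrier" "y = cls d" using \<open>y \<in> carrier T\<close> by (rule carrier_T_cases)
      ultimately show ?thesis unfolding add_T by (metis add_T cls_closed frag_carrier_add)
    qed
    show "\<zero>\<^bsub>T\<^esub> \<in> carrier T" unfolding zero_T by (rule cls_closed) simp
    fix x assume x: "x \<in> carrier T"
    then obtain c where c: "c \<in> frag_carrier" "x = cls c" by (rule carrier_T_cases)
    then show "\<zero>\<^bsub>T\<^esub> \<oplus>\<^bsub>T\<^esub> x = x" by (simp add: add_T zero_T)
    have "cls (- c) \<in> carrier T" "cls (- c) \<oplus>\<^bsub>T\<^esub> x = \<zero>\<^bsub>T\<^esub>"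
      using c by (auto simp: add_T zero_T intro!: cls_closed)
    then show "\<exists>y\<in>carrier T. y \<oplus>\<^bsub>T\<^esub> x = \<zero>\<^bsub>T\<^esub>" by blast
    fix y assume "y \<in> carrier T"
    then obtain d where d: "y = cls d" by (rule carrier_T_cases)
    then show "x \<oplus>\<^bsub>T\<^esub> y = y \<oplus>\<^bsub>T\<^esub> x" by (simp add: add_T c add.commute)
    fix z assume "z \<in> carrier T"
    then obtain e where "z = cls e" by (rule carrier_T_cases)
    then show "x \<oplus>\<^bsub>T\<^esub> y \<oplus>\<^bsub>T\<^esub> z = x \<oplus>\<^bsub>T\<^esub> (y \<oplus>\<^bsub>T\<^esub> z)" by (simp add: add_T c d add.assoc)
  qed
  fix x assume "x \<in> carrier T"
  then obtain c where c: "c \<in> frag_carrier" "x = cls c" by (rule carrier_T_cases)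
  have "scale \<one>\<^bsub>S\<^esub> c = c"
    using c(1) by (induction rule: frag_carrier_induct) (simp_all add: frag_extend_diff)
  then show "\<one>\<^bsub>S\<^esub> \<odot>\<^bsub>T\<^esub> x = x" using c by (simp add: smult_T)
  fix a assume a: "a \<in> carrier S"
  then show "a \<odot>\<^bsub>T\<^esub> x \<in> carrier T" unfolding c(2) smult_T[OF a]
    by (intro cls_closed frag_carrier_scale c(1))
  show "a \<odot>\<^bsub>T\<^esub> (x \<oplus>\<^bsub>T\<^esub> y) = a \<odot>\<^bsub>T\<^esub> x \<oplus>\<^bsub>T\<^esub> a \<odot>\<^bsub>T\<^esub> y" if "y \<in> carrier T" for y
    using that by (rule carrier_T_cases) (simp add: a c smult_T add_T frag_extend_add)
  fix b assume b: "b \<in> carrier S"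
  \<comment> \<open>Unlike the other scalar axioms, which hold on the free group already, additivity
    in the scalar holds only modulo the relations.\<close>
  have "scale (a \<oplus>\<^bsub>S\<^esub> b) c - (scale a c + scale b c) \<in> H"
    using c(1)
  proof (induction rule: frag_carrier_induct)
    case (diff c d)
    from H_diff[OF diff(3,4)] show ?case by (simp add: frag_extend_diff algebra_simps)
  next
    case (frag s m)
    then show ?case using H_relations(1)[of "a \<otimes>\<^bsub>S\<^esub> s" m "b \<otimes>\<^bsub>S\<^esub> s"] a b
      by (simp add: S.l_distr algebra_simps)
  qed simp
  then show "(a \<oplus>\<^bsub>S\<^esub> b) \<odot>\<^bsub>T\<^esub> x = a \<odot>\<^bsub>T\<^esub> x \<oplus>\<^bsub>T\<^esub> b \<odot>\<^bsub>T\<^esub> x"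
    using a b by (simp add: c smult_T add_T cls_eq_iff)
  have "scale (a \<otimes>\<^bsub>S\<^esub> b) c = scale a (scale b c)"
    using c(1) by (induction rule: frag_carrier_induct) (use a b in \<open>simp_all add: frag_extend_diff S.m_assoc\<close>)
  then show "(a \<otimes>\<^bsub>S\<^esub> b) \<odot>\<^bsub>T\<^esub> x = a \<odot>\<^bsub>T\<^esub> (b \<odot>\<^bsub>T\<^esub> x)"
    using a b by (simp add: c smult_T)
qed

lemma pure_tensor_eq: "pure_tensor S R \<phi> M s m = cls (frag_of (s, m))"
  by (simp add: pure_tensor_def)

lemma pure_tensor_closed:
  "s \<in> carrier S \<Longrightarrow> m \<in> carrier M \<Longrightarrow> pure_tensor S R \<phi> M s m \<in> carrier T"
  unfolding pure_tensor_eq carrier_T by (intro imageI frag_carrier_frag_of)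

lemma smult_pure_tensor:
  "a \<in> carrier S \<Longrightarrow> a \<odot>\<^bsub>T\<^esub> pure_tensor S R \<phi> M s m = pure_tensor S R \<phi> M (a \<otimes>\<^bsub>S\<^esub> s) m"
  by (simp add: pure_tensor_eq smult_T)

lemma pure_tensor_smult:
  assumes "s \<in> carrier S" "r \<in> carrier R" "m \<in> carrier M"
  shows "pure_tensor S R \<phi> M s (r \<odot>\<^bsub>M\<^esub> m) = pure_tensor S R \<phi> M (s \<otimes>\<^bsub>S\<^esub> \<phi> r) m"
  using H_relations(3)[OF assms(1,3,2)] unfolding pure_tensor_eq by (metis cls_eq_iff)

lemma pure_tensor_zero:
  assumes "s \<in> carrier S"
  shows "frag_of (s, \<zero>\<^bsub>M\<^esub>) \<in> H"
  using H_relations(2)[OF assms M.zero_closed M.zero_closed] H_minus by fastforce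

text \<open>The isomorphism of S \<otimes> R/I with S/IS in terms of generators. The annihilator of
  the generator contains IS by moving scalars across; that it is no larger is seen by a map to S/IS
  defined on the free group and killing all relations.\<close>

lemma cyclic_module_base_change:
  assumes "cyclic_module R M u I"
  shows "cyclic_module S T (pure_tensor S R \<phi> M \<one>\<^bsub>S\<^esub> u) (Idl\<^bsub>S\<^esub> (\<phi> ` I))"
proof -
  interpret T: module S T by (rule tensor_module)
  note D = cyclic_moduleD[OF assms]
  interpret I: ideal I R by (rule D)
  have I_iff: "r \<in> I \<longleftrightarrow> r \<in> carrier R \<and> r \<odot>\<^bsub>M\<^esub> u = \<zero>\<^bsub>M\<^esub>" for r
    by (subst D(4)) simp
  have ex: "\<exists>r. r \<in> carrier R \<and> m = r \<odot>\<^bsub>M\<^esub> u" if "m \<in> carrier M" for m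
    using that by (subst (asm) D(3)) blast
  define v where "v = pure_tensor S R \<phi> M \<one>\<^bsub>S\<^esub> u"
  have v: "v \<in> carrier T" unfolding v_def using D(2) by (intro pure_tensor_closed) simp
  have pure: "pure_tensor S R \<phi> M s (r \<odot>\<^bsub>M\<^esub> u) = (s \<otimes>\<^bsub>S\<^esub> \<phi> r) \<odot>\<^bsub>T\<^esub> v"
    if "s \<in> carrier S" "r \<in> carrier R" for s r
    using that D(2) by (simp add: v_def pure_tensor_smult smult_pure_tensor)
  have "cls c \<in> (\<lambda>s. s \<odot>\<^bsub>T\<^esub> v) ` carrier S" if "c \<in> frag_carrier" for c
    using that
  proof (induction rule: frag_carrier_induct)
    case zero
    show ?case unfolding zero_T[symmetric] using v by (intro image_eqI[of _ _ "\<zero>\<^bsub>S\<^esub>"]) simp_all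
  next
    case (diff c d)
    then obtain s s' where s: "s \<in> carrier S" "cls c = s \<odot>\<^bsub>T\<^esub> v" "s' \<in> carrier S" "cls d = s' \<odot>\<^bsub>T\<^esub> v"
      by auto
    have "cls (c - d) \<oplus>\<^bsub>T\<^esub> cls d = s \<odot>\<^bsub>T\<^esub> v" by (simp add: add_T flip: s(2))
    also have "\<dots> = (s \<ominus>\<^bsub>S\<^esub> s') \<odot>\<^bsub>T\<^esub> v \<oplus>\<^bsub>T\<^esub> cls d"
      using s v by (simp add: S.minus_eq T.smult_l_distr T.smult_l_minus T.M.a_assoc T.M.l_neg)
    finally have "cls (c - d) \<oplus>\<^bsub>T\<^esub> cls d = (s \<ominus>\<^bsub>S\<^esub> s') \<odot>\<^bsub>T\<^esub> v \<oplus>\<^bsub>T\<^esub> cls d" .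
    moreover have "cls (c - d) \<in> carrier T" "cls d \<in> carrier T"
      using diff frag_carrier_diff unfolding carrier_T by blast+
    ultimately have "cls (c - d) = (s \<ominus>\<^bsub>S\<^esub> s') \<odot>\<^bsub>T\<^esub> v"
      using s v by (metis T.M.add.right_cancel S.minus_closed T.smult_closed)
    then show ?case using s by (intro image_eqI[of _ _ "s \<ominus>\<^bsub>S\<^esub> s'"]) simp_all
  next
    case (frag s m)
    then obtain r where r: "r \<in> carrier R" "m = r \<odot>\<^bsub>M\<^esub> u" using ex by blast
    show ?case using pure[OF frag(1) r(1)] frag(1) r
      by (intro image_eqI[of _ _ "s \<otimes>\<^bsub>S\<^esub> \<phi> r"]) (simp_all add: pure_tensor_eq)
  qed
  then have "carrier T \<subseteq> (\<lambda>s. s \<odot>\<^bsub>T\<^esub> v) ` carrier S"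
    unfolding carrier_T by (rule image_subsetI)
  moreover have "(\<lambda>s. s \<odot>\<^bsub>T\<^esub> v) ` carrier S \<subseteq> carrier T"
    using v by (intro image_subsetI T.smult_closed)
  ultimately have "carrier T = (\<lambda>s. s \<odot>\<^bsub>T\<^esub> v) ` carrier S" by (rule subset_antisym)
  moreover have "Idl\<^bsub>S\<^esub> (\<phi> ` I) = {s \<in> carrier S. s \<odot>\<^bsub>T\<^esub> v = \<zero>\<^bsub>T\<^esub>}"
  proof
    have "\<phi> r \<odot>\<^bsub>T\<^esub> v = \<zero>\<^bsub>T\<^esub>" if "r \<in> I" for r
    proof -
      have r: "r \<in> carrier R" "r \<odot>\<^bsub>M\<^esub> u = \<zero>\<^bsub>M\<^esub>" using that I_iff by blast+
      from pure[OF S.one_closed r(1)] r(1)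
      have "\<phi> r \<odot>\<^bsub>T\<^esub> v = pure_tensor S R \<phi> M \<one>\<^bsub>S\<^esub> \<zero>\<^bsub>M\<^esub>" by (simp add: r(2))
      then show ?thesis
        by (metis S.one_closed cls_eq_zero_iff pure_tensor_eq pure_tensor_zero)
    qed
    then show "Idl\<^bsub>S\<^esub> (\<phi> ` I) \<subseteq> {s \<in> carrier S. s \<odot>\<^bsub>T\<^esub> v = \<zero>\<^bsub>T\<^esub>}"
      using \<phi>_closed I.a_subset by (intro S.genideal_minimal T.annihilator_ideal v) blast
    show "{s \<in> carrier S. s \<odot>\<^bsub>T\<^esub> v = \<zero>\<^bsub>T\<^esub>} \<subseteq> Idl\<^bsub>S\<^esub> (\<phi> ` I)"
    proof clarify
      define J where "J = Idl\<^bsub>S\<^esub> (\<phi> ` I)"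
      have "\<phi> ` I \<subseteq> carrier S" using I.a_subset by auto
      then interpret J: ideal J S unfolding J_def by (rule S.genideal_ideal)
      have \<phi>J: "\<phi> r \<in> J" if "r \<in> I" for r
        unfolding J_def using S.genideal_self[OF \<open>\<phi> ` I \<subseteq> carrier S\<close>] that by blast
      interpret Q: abelian_group "S Quot J"
        using ring.is_abelian_group[OF J.quotient_is_ring] .
      define \<rho> where "\<rho> = (\<lambda>m. SOME r. r \<in> carrier R \<and> m = r \<odot>\<^bsub>M\<^esub> u)"
      have \<rho>: "\<rho> m \<in> carrier R" "m = \<rho> m \<odot>\<^bsub>M\<^esub> u" if "m \<in> carrier M" for m
      proof -
        from someI_ex[OF ex[OF that]] show "\<rho> m \<in> carrier R" "m = \<rho> m \<odot>\<^bsub>M\<^esub> u"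
          unfolding \<rho>_def by blast+
      qed
      \<comment> \<open>The bilinear map (s, r u) -> s \<phi>(r) modulo J. The coefficient r is a
        choice, but two choices differ by an element of I, whose image lies in J.\<close>
      define f where "f = (\<lambda>(s, m). J +>\<^bsub>S\<^esub> (s \<otimes>\<^bsub>S\<^esub> \<phi> (\<rho> m)))"
      have cQ: "J +>\<^bsub>S\<^esub> s \<in> carrier (S Quot J)" if "s \<in> carrier S" for s
        using that J.a_subset by (auto simp: FactRing_simps)
      have aQ: "(J +>\<^bsub>S\<^esub> s) \<oplus>\<^bsub>S Quot J\<^esub> (J +>\<^bsub>S\<^esub> s') = J +>\<^bsub>S\<^esub> (s \<oplus>\<^bsub>S\<^esub> s')"
        if "s \<in> carrier S" "s' \<in> carrier S" for s s'
        using that by (simp add: FactRing_simps J.a_rcos_sum)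
      have eqQ: "J +>\<^bsub>S\<^esub> s = J +>\<^bsub>S\<^esub> s' \<longleftrightarrow> s \<ominus>\<^bsub>S\<^esub> s' \<in> J"
        if "s \<in> carrier S" "s' \<in> carrier S" for s s'
        using that S.quotient_eq_iff_same_a_r_cos[OF J.ideal_axioms] by simp
      have f: "f (s, r \<odot>\<^bsub>M\<^esub> u) = J +>\<^bsub>S\<^esub> (s \<otimes>\<^bsub>S\<^esub> \<phi> r)" if "s \<in> carrier S" "r \<in> carrier R" for s r
      proof -
        define r' where "r' = \<rho> (r \<odot>\<^bsub>M\<^esub> u)"
        have "r \<odot>\<^bsub>M\<^esub> u \<in> carrier M" using that D(2) by simp
        then have r': "r' \<in> carrier R" "r \<odot>\<^bsub>M\<^esub> u = r' \<odot>\<^bsub>M\<^esub> u" unfolding r'_def using \<rho> by blast+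
        then have "r' \<ominus> r \<in> I" using cyclic_module_smult_eq_iff[OF assms] that by metis
        then have "s \<otimes>\<^bsub>S\<^esub> \<phi> (r' \<ominus> r) \<in> J" using \<phi>J that J.I_l_closed by simp
        moreover have "\<phi> r' = \<phi> (r' \<ominus> r) \<oplus>\<^bsub>S\<^esub> \<phi> r"
          using ring_hom_add[OF \<phi>, of "r' \<ominus> r" r] that r'
          by (simp add: R.minus_eq R.a_assoc R.l_neg)
        ultimately have "s \<otimes>\<^bsub>S\<^esub> \<phi> r' \<ominus>\<^bsub>S\<^esub> s \<otimes>\<^bsub>S\<^esub> \<phi> r \<in> J"
          using that r' by (simp add: S.minus_eq S.r_distr S.a_assoc S.r_neg)
        then have "J +>\<^bsub>S\<^esub> (s \<otimes>\<^bsub>S\<^esub> \<phi> r') = J +>\<^bsub>S\<^esub> (s \<otimes>\<^bsub>S\<^esub> \<phi> r)"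
          using that r' by (subst eqQ) simp_all
        then show ?thesis by (simp only: f_def prod.case r'_def)
      qed
      have cg: "comm_group (add_monoid (S Quot J))" by (rule Q.a_comm_group)
      have "f ` (carrier S \<times> carrier M) \<subseteq> carrier (add_monoid (S Quot J))"
        using \<rho> by (auto simp: f_def intro!: cQ)
      then obtain \<theta> where \<theta>: "\<theta> \<in> hom (free_Abelian_group (carrier S \<times> carrier M)) (add_monoid (S Quot J))"
        and \<theta>f: "\<And>x. x \<in> carrier S \<times> carrier M \<Longrightarrow> \<theta> (frag_of x) = f x"
        using comm_group.free_Abelian_group_universal[OF cg] by metis
      interpret \<theta>: group_hom "free_Abelian_group (carrier S \<times> carrier M)" "add_monoid (S Quot J)" \<theta>
        using \<theta> Q.a_group by (simp add: group_hom_def group_hom_axioms_def)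
      have \<theta>_diff: "\<theta> (c - d) = \<theta> c \<ominus>\<^bsub>S Quot J\<^esub> \<theta> d" if "c \<in> frag_carrier" "d \<in> frag_carrier" for c d
        using \<theta>.hom_mult[of c "- d"] \<theta>.hom_inv[of d] that by (simp add: a_minus_def a_inv_def)
      have \<theta>_pure: "\<theta> (frag_of (s, r \<odot>\<^bsub>M\<^esub> u)) = J +>\<^bsub>S\<^esub> (s \<otimes>\<^bsub>S\<^esub> \<phi> r)"
        if "s \<in> carrier S" "r \<in> carrier R" for s r
        using that D(2) by (simp add: \<theta>f f)
      have \<theta>_closed: "\<theta> c \<in> carrier (S Quot J)" if "c \<in> frag_carrier" for c
        using \<theta>.hom_closed[of c] that by simp
      have minus2: "(a \<oplus>\<^bsub>S Quot J\<^esub> b) \<ominus>\<^bsub>S Quot J\<^esub> a \<ominus>\<^bsub>S Quot J\<^esub> b = \<zero>\<^bsub>S Quot J\<^esub>"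
        if "a \<in> carrier (S Quot J)" "b \<in> carrier (S Quot J)" for a b
      proof -
        have "(a \<oplus>\<^bsub>S Quot J\<^esub> b) \<ominus>\<^bsub>S Quot J\<^esub> a \<ominus>\<^bsub>S Quot J\<^esub> b
            = (a \<oplus>\<^bsub>S Quot J\<^esub> b) \<oplus>\<^bsub>S Quot J\<^esub> \<ominus>\<^bsub>S Quot J\<^esub> (a \<oplus>\<^bsub>S Quot J\<^esub> b)"
          using that by (simp add: Q.minus_eq Q.a_assoc Q.minus_add)
        then show ?thesis using that by (simp add: Q.r_neg)
      qed
      have "\<theta> c = \<zero>\<^bsub>S Quot J\<^esub>" if "c \<in> H" for c
        using that
      proof (induction rule: H_induct)
        case zero
        show ?case using \<theta>.hom_one by simp
      next
        case (diff c d)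
        then show ?case using H_frag_carrier by (simp add: \<theta>_diff Q.minus_eq)
      next
        case (add_left s s' m)
        then obtain r where r: "r \<in> carrier R" "m = r \<odot>\<^bsub>M\<^esub> u" using ex by blast
        have "\<theta> (frag_of (s \<oplus>\<^bsub>S\<^esub> s', m)) = \<theta> (frag_of (s, m)) \<oplus>\<^bsub>S Quot J\<^esub> \<theta> (frag_of (s', m))"
          using add_left r(1) unfolding r(2) by (simp add: \<theta>_pure aQ S.l_distr)
        then show ?case using add_left
          by (simp add: \<theta>_diff frag_carrier_diff[simplified] \<theta>_closed minus2)
      next
        case (add_right s m m')
        then obtain r r' where r: "r \<in> carrier R" "m = r \<odot>\<^bsub>M\<^esub> u" "r' \<in> carrier R" "m' = r' \<odot>\<^bsub>M\<^esub> u"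
          using ex by blast
        have "m \<oplus>\<^bsub>M\<^esub> m' = (r \<oplus> r') \<odot>\<^bsub>M\<^esub> u" using r D(2) by (simp add: smult_l_distr)
        then have "\<theta> (frag_of (s, m \<oplus>\<^bsub>M\<^esub> m')) = \<theta> (frag_of (s, m)) \<oplus>\<^bsub>S Quot J\<^esub> \<theta> (frag_of (s, m'))"
          using add_right r(1,3) unfolding r(2,4)
          by (simp add: \<theta>_pure aQ S.r_distr ring_hom_add[OF \<phi>])
        then show ?case using add_right
          by (simp add: \<theta>_diff frag_carrier_diff[simplified] \<theta>_closed minus2)
      next
        case (scalar s a m)
        then obtain r where r: "r \<in> carrier R" "m = r \<odot>\<^bsub>M\<^esub> u" using ex by blast
        have "a \<odot>\<^bsub>M\<^esub> m = (a \<otimes> r) \<odot>\<^bsub>M\<^esub> u" using r D(2) scalar by (simp add: smult_assoc1)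
        then have "\<theta> (frag_of (s, a \<odot>\<^bsub>M\<^esub> m)) = \<theta> (frag_of (s \<otimes>\<^bsub>S\<^esub> \<phi> a, m))"
          using scalar r(1) unfolding r(2)
          by (simp add: \<theta>_pure S.m_assoc ring_hom_mult[OF \<phi>])
        then show ?case using scalar
          by (simp add: \<theta>_diff \<theta>_closed Q.minus_eq Q.r_neg)
      qed
      note \<theta>_H = this
      fix s assume s: "s \<in> carrier S" "s \<odot>\<^bsub>T\<^esub> v = \<zero>\<^bsub>T\<^esub>"
      then have "frag_of (s, u) \<in> H"
        by (simp add: v_def smult_pure_tensor)
          (simp add: pure_tensor_eq cls_eq_zero_iff)
      \<comment> \<open>Writing u as 1 u makes the formula for pure tensors give the class of s
        itself.\<close>
      then have "\<theta> (frag_of (s, \<one> \<odot>\<^bsub>M\<^esub> u)) = \<zero>\<^bsub>S Quot J\<^esub>" using \<theta>_H D(2) by simp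
      then have "J +>\<^bsub>S\<^esub> s = J"
        using s \<theta>_pure[OF s(1) R.one_closed] ring_hom_one[OF \<phi>] by (simp add: FactRing_simps)
      then show "s \<in> Idl\<^bsub>S\<^esub> (\<phi> ` I)" using s J.a_rcos_self[of s] by (simp flip: J_def)
    qed
  qed
  ultimately show ?thesis
    using tensor_module v unfolding cyclic_module_def v_def[symmetric] by blast
qed

end

text \<open>Needed because the tight closure of 0 refers to the image of the tensor product with the
  zero submodule. Every chain supported on pairs (s, 0) is already a relation for M.\<close>

lemma (in base_change) tensor_map_zero_submodule:
  "tensor_map S R \<phi> (M\<lparr>carrier := {\<zero>\<^bsub>M\<^esub>}\<rparr>) M (\<lambda>n. n)
     ` carrier (tensor_module S R \<phi> (M\<lparr>carrier := {\<zero>\<^bsub>M\<^esub>}\<rparr>)) = {\<zero>\<^bsub>T\<^esub>}"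
proof -
  define N where "N = M\<lparr>carrier := {\<zero>\<^bsub>M\<^esub>}\<rparr>"
  define Z :: "(('s \<times> 'm) \<Rightarrow>\<^sub>0 int) set"
    where "Z = {c. Poly_Mapping.keys c \<subseteq> carrier S \<times> {\<zero>\<^bsub>M\<^esub>}}"
  have free: "tensor_free S N = free_Abelian_group (carrier S \<times> {\<zero>\<^bsub>M\<^esub>})"
    by (simp add: tensor_free_def N_def)
  have Z: "carrier (tensor_free S N) = Z" by (simp add: free free_Abelian_group_def Z_def)
  have Z_diff: "c - d \<in> Z" if "c \<in> Z" "d \<in> Z" for c d
    using order_trans[OF keys_diff[of c d], of "carrier S \<times> {\<zero>\<^bsub>M\<^esub>}"] that by (simp add: Z_def)
  have Z_add: "c + d \<in> Z" if "c \<in> Z" "d \<in> Z" for c d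
    using order_trans[OF keys_add[of c d], of "carrier S \<times> {\<zero>\<^bsub>M\<^esub>}"] that by (simp add: Z_def)
  have Z_neg: "- c \<in> Z" if "c \<in> Z" for c using that by (simp add: Z_def)
  have Z_frag: "frag_of (s, \<zero>\<^bsub>M\<^esub>) \<in> Z" if "s \<in> carrier S" for s using that by (simp add: Z_def)
  have "c \<in> Z" if "c \<in> tensor_relations S R \<phi> N" for c
    using that unfolding tensor_relations_def
    by (elim UnE CollectE exE conjE) (simp_all add: N_def Z_diff Z_neg Z_frag)
  then have "tensor_relations S R \<phi> N \<subseteq> carrier (tensor_free S N)" unfolding Z by blast
  then have "subgroup (tensor_subgroup S R \<phi> N) (tensor_free S N)"
    unfolding tensor_subgroup_def free by (intro group.generate_is_subgroup group_free_Abelian_group)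
  then have sub: "tensor_subgroup S R \<phi> N \<subseteq> Z" "0 \<in> tensor_subgroup S R \<phi> N"
    using subgroup.subset Z subgroup.one_closed[of _ "tensor_free S N"] by (force simp: free)+
  have ZH: "c \<in> H" if "c \<in> Z" for c
  proof (rule free_Abelian_group_induct[of c "carrier S \<times> {\<zero>\<^bsub>M\<^esub>}"])
    show "Poly_Mapping.keys c \<subseteq> carrier S \<times> {\<zero>\<^bsub>M\<^esub>}" using that by (simp add: Z_def)
    show "frag_of a \<in> H" if "a \<in> carrier S \<times> {\<zero>\<^bsub>M\<^esub>}" for a
      using that pure_tensor_zero by (cases a) auto
  qed (auto intro: H_diff)
  have map: "tensor_map S R \<phi> N M (\<lambda>n. n) V = \<zero>\<^bsub>T\<^esub>"
    if "V \<in> carrier (tensor_module S R \<phi> N)" for V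
  proof -
    have "V \<in> rcosets\<^bsub>tensor_free S N\<^esub> (tensor_subgroup S R \<phi> N)"
      using that unfolding tensor_module_def by simp
    then obtain c where c: "c \<in> Z" "V = tensor_subgroup S R \<phi> N #>\<^bsub>tensor_free S N\<^esub> c"
      unfolding RCOSETS_def Z by blast
    then have V: "V = (\<lambda>h. h + c) ` tensor_subgroup S R \<phi> N"
      by (auto simp: r_coset_def free)
    have "cls (frag_extend (\<lambda>(s, m). frag_of (s, m)) d) = \<zero>\<^bsub>T\<^esub>" if "d \<in> V" for d
    proof -
      from that obtain h where "h \<in> tensor_subgroup S R \<phi> N" "d = h + c" unfolding V by auto
      then have "d \<in> Z" using Z_add sub c by auto
      moreover have "frag_extend (\<lambda>(s, m). frag_of (s, m)) d = d"
      proof -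
        have "(\<lambda>(s, m). frag_of (s, m)) = (frag_of :: 's \<times> 'm \<Rightarrow> _)" by (rule ext) auto
        then have "frag_extend (\<lambda>(s, m). frag_of (s, m)) d = frag_extend frag_of d" by (simp only:)
        also have "\<dots> = d" by (rule frag_expansion[symmetric])
        finally show ?thesis .
      qed
      ultimately show ?thesis using ZH by (simp add: cls_eq_zero_iff)
    qed
    moreover have "V \<noteq> {}" using V sub by auto
    ultimately have "(\<Union>d\<in>V. cls (frag_extend (\<lambda>(s, m). frag_of (s, m)) d)) = \<zero>\<^bsub>T\<^esub>"
      by (intro SUP_eq_const)
    then show ?thesis by (simp add: tensor_map_def)
  qed
  have "0 \<in> carrier (tensor_free S N)" by (simp add: Z Z_def)
  then have "tensor_subgroup S R \<phi> N #>\<^bsub>tensor_free S N\<^esub> 0 \<in> carrier (tensor_module S R \<phi> N)"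
    unfolding tensor_module_def RCOSETS_def by auto
  with map show ?thesis unfolding N_def[symmetric] by (metis (no_types, lifting) image_cong image_constant)
qed

subsection \<open>Frobenius powers and tight closure for cyclic modules\<close>

definition frobenius_power :: "('a, 'c) ring_scheme \<Rightarrow> nat \<Rightarrow> 'a set \<Rightarrow> 'a set" where
  "frobenius_power R q I = Idl\<^bsub>R\<^esub> (frobenius R q ` I)"

definition ideal_tight_closure :: "('a, 'c) ring_scheme \<Rightarrow> nat \<Rightarrow> 'a set \<Rightarrow> 'a set" where
  "ideal_tight_closure R p I = {r \<in> carrier R. \<exists>c\<in>off_minimal_primes R. \<exists>e0. \<forall>e\<ge>e0.
     c \<otimes>\<^bsub>R\<^esub> r [^]\<^bsub>R\<^esub> (p ^ e) \<in> frobenius_power R (p ^ e) I}"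

lemma base_change_frobenius:
  assumes "module R M" "frobenius R q \<in> ring_hom R R"
  shows "base_change R M R (frobenius R q)"
proof -
  interpret module R M by fact
  show ?thesis by unfold_locales fact
qed

lemma cyclic_module_PS_functor:
  assumes "frobenius R q \<in> ring_hom R R" and M: "cyclic_module R M u I"
  shows "cyclic_module R (PS_functor R q M) (PS_power R q M u) (frobenius_power R q I)"
  unfolding PS_functor_def PS_power_def frobenius_power_def
  by (intro base_change.cyclic_module_base_change base_change_frobenius assms cyclic_moduleD(1)[OF M])

lemma PS_power_smult:
  assumes "frobenius R q \<in> ring_hom R R" and "module R M" "r \<in> carrier R" "m \<in> carrier M"
  shows "PS_power R q M (r \<odot>\<^bsub>M\<^esub> m) = (r [^]\<^bsub>R\<^esub> q) \<odot>\<^bsub>PS_functor R q M\<^esub> PS_power R q M m"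
proof -
  interpret base_change R M R "frobenius R q" using assms(2,1) by (rule base_change_frobenius)
  have "r [^]\<^bsub>R\<^esub> q = frobenius R q r" by (simp add: frobenius_def)
  then show ?thesis
    using assms(3,4) \<phi>_closed[OF assms(3)]
    by (simp add: PS_power_def PS_functor_def pure_tensor_smult smult_pure_tensor)
qed

lemma PS_submodule_zero:
  assumes "frobenius R q \<in> ring_hom R R" and "module R M"
  shows "PS_submodule R q M {\<zero>\<^bsub>M\<^esub>} = {\<zero>\<^bsub>PS_functor R q M\<^esub>}"
  unfolding PS_submodule_def PS_functor_def
  by (rule base_change.tensor_map_zero_submodule[OF base_change_frobenius[OF assms(2,1)]])

text \<open>The power of r u is r^q times the power of u, and the latter generates the Frobenius
  functor with annihilator \<open>frobenius_power\<close>. The module condition thus becomes the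
  ideal condition on r.\<close>

lemma tight_closure_zero_cyclic:
  assumes frob: "\<And>e. frobenius R (p ^ e) \<in> ring_hom R R" and M: "cyclic_module R M u I"
  shows "tight_closure R p M {\<zero>\<^bsub>M\<^esub>} = (\<lambda>r. r \<odot>\<^bsub>M\<^esub> u) ` ideal_tight_closure R p I"
proof -
  interpret module R M using M by (rule cyclic_moduleD)
  note u = cyclic_moduleD(2)[OF M]
  have iff: "c \<odot>\<^bsub>PS_functor R (p ^ e) M\<^esub> PS_power R (p ^ e) M (r \<odot>\<^bsub>M\<^esub> u) \<in> PS_submodule R (p ^ e) M {\<zero>\<^bsub>M\<^esub>}
      \<longleftrightarrow> c \<otimes>\<^bsub>R\<^esub> r [^]\<^bsub>R\<^esub> (p ^ e) \<in> frobenius_power R (p ^ e) I"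
    if "c \<in> carrier R" "r \<in> carrier R" for c r e
  proof -
    note F = cyclic_module_PS_functor[OF frob M, of e]
    interpret F: module R "PS_functor R (p ^ e) M" using F by (rule cyclic_moduleD)
    have "c \<odot>\<^bsub>PS_functor R (p ^ e) M\<^esub> PS_power R (p ^ e) M (r \<odot>\<^bsub>M\<^esub> u)
        = (c \<otimes>\<^bsub>R\<^esub> r [^]\<^bsub>R\<^esub> (p ^ e)) \<odot>\<^bsub>PS_functor R (p ^ e) M\<^esub> PS_power R (p ^ e) M u"
      using that u cyclic_moduleD(2)[OF F]
      by (simp add: PS_power_smult[OF frob module_axioms] F.smult_assoc1)
    then show ?thesis
      using that by (subst cyclic_moduleD(4)[OF F]) (simp add: PS_submodule_zero[OF frob module_axioms])
  qed
  have off: "c \<in> carrier R" if "c \<in> off_minimal_primes R" for c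
    using that by (simp add: off_minimal_primes_def)
  show ?thesis
  proof
    show "tight_closure R p M {\<zero>\<^bsub>M\<^esub>} \<subseteq> (\<lambda>r. r \<odot>\<^bsub>M\<^esub> u) ` ideal_tight_closure R p I"
    proof
      fix m assume m: "m \<in> tight_closure R p M {\<zero>\<^bsub>M\<^esub>}"
      then have "m \<in> carrier M" by (simp add: tight_closure_def)
      then obtain r where r: "r \<in> carrier R" "m = r \<odot>\<^bsub>M\<^esub> u"
        using cyclic_moduleD(3)[OF M] by blast
      from m obtain c e0 where c: "c \<in> off_minimal_primes R"
        "\<forall>e\<ge>e0. c \<odot>\<^bsub>PS_functor R (p ^ e) M\<^esub> PS_power R (p ^ e) M m \<in> PS_submodule R (p ^ e) M {\<zero>\<^bsub>M\<^esub>}"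
        unfolding tight_closure_def by blast
      from c(2) have "\<forall>e\<ge>e0. c \<otimes>\<^bsub>R\<^esub> r [^]\<^bsub>R\<^esub> (p ^ e) \<in> frobenius_power R (p ^ e) I"
        unfolding r(2) iff[OF off[OF c(1)] r(1)] .
      with r(1) c(1) have "r \<in> ideal_tight_closure R p I"
        unfolding ideal_tight_closure_def by blast
      with r(2) show "m \<in> (\<lambda>r. r \<odot>\<^bsub>M\<^esub> u) ` ideal_tight_closure R p I" by (rule image_eqI)
    qed
    show "(\<lambda>r. r \<odot>\<^bsub>M\<^esub> u) ` ideal_tight_closure R p I \<subseteq> tight_closure R p M {\<zero>\<^bsub>M\<^esub>}"
    proof (rule image_subsetI)
      fix r assume "r \<in> ideal_tight_closure R p I"
      then obtain c e0 where c: "r \<in> carrier R" "c \<in> off_minimal_primes R"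
        "\<forall>e\<ge>e0. c \<otimes>\<^bsub>R\<^esub> r [^]\<^bsub>R\<^esub> (p ^ e) \<in> frobenius_power R (p ^ e) I"
        unfolding ideal_tight_closure_def by blast
      have "r \<odot>\<^bsub>M\<^esub> u \<in> carrier M" using u c(1) by simp
      moreover from c(3) have "\<forall>e\<ge>e0. c \<odot>\<^bsub>PS_functor R (p ^ e) M\<^esub> PS_power R (p ^ e) M (r \<odot>\<^bsub>M\<^esub> u)
          \<in> PS_submodule R (p ^ e) M {\<zero>\<^bsub>M\<^esub>}"
        unfolding iff[OF off[OF c(2)] c(1)] .
      ultimately show "r \<odot>\<^bsub>M\<^esub> u \<in> tight_closure R p M {\<zero>\<^bsub>M\<^esub>}"
        using c(2) unfolding tight_closure_def by blast
    qed
  qed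
qed

section \<open>The associated primes of the Frobenius powers\<close>

subsection \<open>The ring $R_F$\<close>

definition quot_map :: "'k::field poly poly poly \<Rightarrow> 'k poly poly poly set" where
  "quot_map f = quartic_ideal +>\<^bsub>ring_of_type_algebra\<^esub> f"

lemma quartic_eq: "quartic = quartic_at [:0, 1:]"
  by (simp add: quartic_def quartic_at_def var_x_def var_y_def var_t_def coord_x_def coord_y_def cst_def)

lemma ring_of_type_algebra_sel [simp]:
  "carrier ring_of_type_algebra = (UNIV :: 'a::comm_ring_1 set)"
  "monoid.mult ring_of_type_algebra = ((*) :: 'a \<Rightarrow> 'a \<Rightarrow> 'a)"
  "ring.add ring_of_type_algebra = ((+) :: 'a \<Rightarrow> 'a \<Rightarrow> 'a)"
  "\<one>\<^bsub>ring_of_type_algebra\<^esub> = (1 :: 'a)"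
  "\<zero>\<^bsub>ring_of_type_algebra\<^esub> = (0 :: 'a)"
  by (simp_all add: ring_of_type_algebra_def)

lemma a_inv_ring_of_type_algebra: "\<ominus>\<^bsub>ring_of_type_algebra\<^esub> x = - (x :: 'a::comm_ring_1)"
proof -
  interpret cring "ring_of_type_algebra :: 'a ring" by (rule cring_from_type_algebra)
  show ?thesis by (rule minus_equality) simp_all
qed

lemma ideal_quartic_ideal: "ideal (quartic_ideal :: 'k::field poly poly poly set) ring_of_type_algebra"
proof -
  interpret cring "ring_of_type_algebra :: 'k poly poly poly ring" by (rule cring_from_type_algebra)
  show ?thesis unfolding quartic_ideal_def by (rule cgenideal_ideal) simp
qed

lemma mem_quartic_ideal: "f \<in> quartic_ideal \<longleftrightarrow> quartic_at [:0, 1:] dvd f"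
  by (auto simp: quartic_ideal_def cgenideal_def quartic_eq dvd_def mult.commute)

lemma cring_R_F: "cring (R_F TYPE('k::field))"
proof -
  interpret ideal "quartic_ideal :: 'k poly poly poly set" ring_of_type_algebra
    by (rule ideal_quartic_ideal)
  show ?thesis unfolding R_F_def
    by (rule quotient_is_cring) (rule cring_from_type_algebra)
qed

lemma quot_map_hom: "ring_hom_cring ring_of_type_algebra (R_F TYPE('k::field)) quot_map"
proof -
  interpret ideal "quartic_ideal :: 'k poly poly poly set" ring_of_type_algebra
    by (rule ideal_quartic_ideal)
  have "quot_map = (+>\<^bsub>ring_of_type_algebra\<^esub>) (quartic_ideal :: 'k poly poly poly set)"
    by (simp add: quot_map_def fun_eq_iff)
  then show ?thesis unfolding R_F_def
    using rcos_ring_hom_cring[OF cring_from_type_algebra] by simp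
qed

lemma carrier_R_F: "carrier (R_F TYPE('k::field)) = range quot_map"
  by (auto simp: R_F_def FactRing_def A_RCOSETS_def' quot_map_def)

lemma quot_map_simps:
  fixes f g :: "'k::field poly poly poly"
  shows "quot_map (f + g) = quot_map f \<oplus>\<^bsub>R_F TYPE('k)\<^esub> quot_map g"
    and "quot_map (f * g) = quot_map f \<otimes>\<^bsub>R_F TYPE('k)\<^esub> quot_map g"
    and "quot_map (0 :: 'k poly poly poly) = \<zero>\<^bsub>R_F TYPE('k)\<^esub>"
    and "quot_map (1 :: 'k poly poly poly) = \<one>\<^bsub>R_F TYPE('k)\<^esub>"
    and "quot_map f \<in> carrier (R_F TYPE('k))"
    and "quot_map (- f) = \<ominus>\<^bsub>R_F TYPE('k)\<^esub> quot_map f"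
    and "quot_map (f ^ n) = quot_map f [^]\<^bsub>R_F TYPE('k)\<^esub> n"
proof -
  interpret ring_hom_cring ring_of_type_algebra "R_F TYPE('k)" quot_map by (rule quot_map_hom)
  show mult: "quot_map (f * g) = quot_map f \<otimes>\<^bsub>R_F TYPE('k)\<^esub> quot_map g" for f g :: "'k poly poly poly"
    using hom_mult[of f g] by simp
  show one: "quot_map (1 :: 'k poly poly poly) = \<one>\<^bsub>R_F TYPE('k)\<^esub>" using hom_one by simp
  show "quot_map (f + g) = quot_map f \<oplus>\<^bsub>R_F TYPE('k)\<^esub> quot_map g" using hom_add[of f g] by simp
  show "quot_map (0 :: 'k poly poly poly) = \<zero>\<^bsub>R_F TYPE('k)\<^esub>" using hom_zero by simp
  show "quot_map f \<in> carrier (R_F TYPE('k))" unfolding carrier_R_F by simp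
  show "quot_map (- f) = \<ominus>\<^bsub>R_F TYPE('k)\<^esub> quot_map f"
    using hom_a_inv[of f] by (simp add: a_inv_ring_of_type_algebra)
  show "quot_map (f ^ n) = quot_map f [^]\<^bsub>R_F TYPE('k)\<^esub> n"
    by (induction n) (simp_all add: one mult mult.commute[of f])
qed

lemma quot_map_eq_iff: "quot_map f = quot_map g \<longleftrightarrow> quartic_at [:0, 1:] dvd f - g"
proof -
  interpret cring "ring_of_type_algebra :: 'a poly poly poly ring" by (rule cring_from_type_algebra)
  show ?thesis
    using quotient_eq_iff_same_a_r_cos[OF ideal_quartic_ideal, of f g]
    by (simp add: quot_map_def mem_quartic_ideal minus_eq a_inv_ring_of_type_algebra)
qed

section \<open>Ideals of \<open>R_F\<close> as images of ideals of k[t][x,y]\<close>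

definition poly_ideal :: "'a::comm_ring_1 set \<Rightarrow> bool" where
  "poly_ideal A \<longleftrightarrow> 0 \<in> A \<and> (\<forall>f\<in>A. \<forall>g\<in>A. f + g \<in> A) \<and> (\<forall>f\<in>A. \<forall>g. g * f \<in> A)"

lemma ideal_quot_map_image:
  fixes A :: "'k::field poly poly poly set"
  assumes A: "poly_ideal A"
  shows "ideal (quot_map ` A) (R_F TYPE('k))"
proof (rule idealI)
  interpret R: cring "R_F TYPE('k)" by (rule cring_R_F)
  show "ring (R_F TYPE('k))" by (rule R.ring_axioms)
  have neg: "- f \<in> A" if "f \<in> A" for f
  proof -
    have "(- 1) * f \<in> A" using A that unfolding poly_ideal_def by blast
    then show ?thesis by simp
  qed
  have sub: "quot_map ` A \<subseteq> carrier (R_F TYPE('k))" by (auto simp: quot_map_simps)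
  show "subgroup (quot_map ` A) (add_monoid (R_F TYPE('k)))"
  proof (rule R.add.subgroupI)
    show "quot_map ` A \<subseteq> carrier (R_F TYPE('k))" by (rule sub)
    show "quot_map ` A \<noteq> {}" using A by (auto simp: poly_ideal_def)
    fix a assume "a \<in> quot_map ` A"
    then obtain f where f: "f \<in> A" "a = quot_map f" by blast
    then show "\<ominus>\<^bsub>R_F TYPE('k)\<^esub> a \<in> quot_map ` A"
      using neg by (simp flip: quot_map_simps)
    fix b assume "b \<in> quot_map ` A"
    then obtain g where g: "g \<in> A" "b = quot_map g" by blast
    have "f + g \<in> A" using A f g unfolding poly_ideal_def by blast
    then show "a \<oplus>\<^bsub>R_F TYPE('k)\<^esub> b \<in> quot_map ` A" by (simp add: f g flip: quot_map_simps)
  qed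
  fix a x assume "a \<in> quot_map ` A" "x \<in> carrier (R_F TYPE('k))"
  then obtain f g where f: "f \<in> A" "a = quot_map f" and g: "x = quot_map g"
    unfolding carrier_R_F by blast
  have "g * f \<in> A" using A f(1) unfolding poly_ideal_def by blast
  then show "x \<otimes>\<^bsub>R_F TYPE('k)\<^esub> a \<in> quot_map ` A" by (simp add: f g flip: quot_map_simps)
  then show "a \<otimes>\<^bsub>R_F TYPE('k)\<^esub> x \<in> quot_map ` A"
    by (simp add: f g mult.commute[of g] flip: quot_map_simps)
qed

text \<open>The transfer principle: an ideal that contains F is the full preimage of its
  image.\<close>

lemma quot_map_mem_image:
  assumes A: "poly_ideal A" and "quartic_at [:0, 1:] \<in> A"
  shows "quot_map f \<in> quot_map ` A \<longleftrightarrow> f \<in> A"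
proof
  assume "quot_map f \<in> quot_map ` A"
  then obtain g where g: "g \<in> A" "quot_map f = quot_map g" by blast
  then obtain h where "f - g = h * quartic_at [:0, 1:]"
    unfolding quot_map_eq_iff dvd_def by (auto simp: mult.commute)
  then have "f = g + h * quartic_at [:0, 1:]" by (simp add: algebra_simps)
  moreover have "h * quartic_at [:0, 1:] \<in> A" using assms unfolding poly_ideal_def by blast
  ultimately show "f \<in> A" using A g(1) unfolding poly_ideal_def by blast
qed blast

text \<open>Evaluation at the origin, a ring homomorphism to the coefficients. It induces the
  identification of \<open>R_F\<close> modulo (x, y) with k[t].\<close>

definition const_coeff :: "'a::comm_ring_1 poly poly \<Rightarrow> 'a" where
  "const_coeff f = coeff (coeff f 0) 0"

lemma const_coeff_simps [simp]:
  fixes f g :: "'a::comm_ring_1 poly poly"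
  shows "const_coeff (f + g) = const_coeff f + const_coeff g"
  "const_coeff (f * g) = const_coeff f * const_coeff g"
  "const_coeff (0 :: 'a poly poly) = 0" "const_coeff (coord_x :: 'a poly poly) = 0"
  "const_coeff (coord_y :: 'a poly poly) = 0" "const_coeff (cst a :: 'a poly poly) = a"
  "const_coeff (quartic_at t :: 'a poly poly) = 0"
proof -
  show mult: "const_coeff (f * g) = const_coeff f * const_coeff g" for f g :: "'a poly poly"
    by (simp add: const_coeff_def coeff_mult)
  show x: "const_coeff (coord_x :: 'a poly poly) = 0" "const_coeff (coord_y :: 'a poly poly) = 0"
    by (simp_all add: const_coeff_def coord_x_def coord_y_def)
  show "const_coeff (quartic_at t :: 'a poly poly) = 0" unfolding quartic_at_def mult x by simp
qed (simp_all add: const_coeff_def cst_def)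

lemma const_coeff_decomp: "\<exists>u v. f = cst (const_coeff f) + coord_x * u + coord_y * v"
  unfolding const_coeff_def by (rule poly_poly_decomp)

text \<open>Every parametrized line passes through the origin at parameter 0.\<close>

lemma coeff_restrict_line_0: "coeff (restrict_line a b f) 0 = const_coeff f"
proof -
  obtain u v where "f = cst (const_coeff f) + coord_x * u + coord_y * v"
    using const_coeff_decomp by blast
  then have "restrict_line a b f = restrict_line a b (cst (const_coeff f) + coord_x * u + coord_y * v)"
    by (rule arg_cong)
  then show ?thesis by (simp add: coeff_mult)
qed

lemma poly_ideal_const_coeff: "poly_ideal {f. a dvd const_coeff f}"
  by (auto simp: poly_ideal_def)

lemma poly_ideal_bracket_ideal: "poly_ideal (bracket_ideal t n)"
  using bracket_idealI[of 0 n 0 0 t]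
  by (simp add: poly_ideal_def bracket_ideal_add bracket_ideal_mult)

lemma poly_ideal_order_ideal: "poly_ideal (order_ideal t n)"
  unfolding poly_ideal_def using order_ideal_add order_ideal_mult_left
  by (auto simp: order_ideal_def)

lemma poly_ideal_restrict_line: "poly_ideal {f. restrict_line a b f = 0}"
  by (auto simp: poly_ideal_def)

lemma bracket_ideal_1: "bracket_ideal t 1 = {f. const_coeff f = 0}"
proof
  show "bracket_ideal t 1 \<subseteq> {f. const_coeff f = 0}"
    by (auto simp: bracket_ideal_def)
  show "{f. const_coeff f = 0} \<subseteq> bracket_ideal t 1"
  proof clarify
    fix f :: "'a poly poly" assume "const_coeff f = 0"
    then obtain u v where "f = u * coord_x ^ 1 + v * coord_y ^ 1 + 0 * quartic_at t"
      using const_coeff_decomp[of f] by (auto simp: mult.commute)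
    then show "f \<in> bracket_ideal t 1" by (simp only: bracket_idealI)
  qed
qed

lemma quot_map_mem_bracket_ideal:
  "quot_map f \<in> quot_map ` bracket_ideal [:0, 1:] n \<longleftrightarrow> f \<in> bracket_ideal [:0, 1:] n"
  by (intro quot_map_mem_image poly_ideal_bracket_ideal bracket_ideal_quartic dvd_refl)

lemma quot_map_mem_order_ideal:
  "quot_map f \<in> quot_map ` order_ideal [:0, 1:] n \<longleftrightarrow> f \<in> order_ideal [:0, 1:] n"
  by (intro quot_map_mem_image poly_ideal_order_ideal order_ideal_quartic)

lemma xy_ideal_eq: "xy_ideal TYPE('k::field) = quot_map ` bracket_ideal [:0, 1:] 1"
proof -
  interpret R: cring "R_F TYPE('k)" by (rule cring_R_F)
  have xy: "xy_ideal TYPE('k) = Idl\<^bsub>R_F TYPE('k)\<^esub> {quot_map coord_x, quot_map coord_y}"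
    by (simp add: xy_ideal_def quot_map_def var_x_def var_y_def coord_x_def coord_y_def)
  have sub: "{quot_map coord_x, quot_map coord_y} \<subseteq> carrier (R_F TYPE('k))"
    by (simp add: quot_map_simps)
  interpret xy: ideal "xy_ideal TYPE('k)" "R_F TYPE('k)"
    unfolding xy using sub by (rule R.genideal_ideal)
  have gen: "quot_map coord_x \<in> xy_ideal TYPE('k)" "quot_map coord_y \<in> xy_ideal TYPE('k)"
    using R.genideal_self[OF sub] unfolding xy by auto
  show ?thesis
  proof
    show "xy_ideal TYPE('k) \<subseteq> quot_map ` bracket_ideal [:0, 1:] 1"
      unfolding xy bracket_ideal_1 using poly_ideal_const_coeff[of "0 :: 'k poly"]
      by (intro R.genideal_minimal ideal_quot_map_image) auto
    show "quot_map ` bracket_ideal [:0, 1:] 1 \<subseteq> xy_ideal TYPE('k)"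
    proof (rule image_subsetI)
      fix f :: "'k poly poly poly" assume "f \<in> bracket_ideal [:0, 1:] 1"
      then have "const_coeff f = 0" unfolding bracket_ideal_1 by simp
      then obtain u v where f: "f = coord_x * u + coord_y * v"
        using const_coeff_decomp[of f] by auto
      show "quot_map f \<in> xy_ideal TYPE('k)"
        unfolding f quot_map_simps by (intro xy.a_closed xy.I_r_closed gen quot_map_simps)
    qed
  qed
qed

lemma ideal_xy_ideal: "ideal (xy_ideal TYPE('k::field)) (R_F TYPE('k))"
  unfolding xy_ideal_eq by (intro ideal_quot_map_image poly_ideal_bracket_ideal)

lemma quot_map_mem_xy_ideal: "quot_map f \<in> xy_ideal TYPE('k::field) \<longleftrightarrow> const_coeff f = 0"
  unfolding xy_ideal_eq quot_map_mem_bracket_ideal unfolding bracket_ideal_1 by simp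

text \<open>Orders of vanishing add under products, which gives one inclusion. For the other, an
  element of the order ideal is congruent modulo F to an element of \<open>origin_power\<close>, by
  \<open>order_ideal_eq\<close>.\<close>

lemma xy_ideal_power_eq:
  "xy_ideal TYPE('k::field) [^]\<^bsub>ideals_set (R_F TYPE('k))\<^esub> n = quot_map ` order_ideal [:0, 1:] n"
proof
  let ?R = "R_F TYPE('k)"
  have pow_Suc: "xy_ideal TYPE('k) [^]\<^bsub>ideals_set ?R\<^esub> Suc n
      = ideal_prod ?R (xy_ideal TYPE('k) [^]\<^bsub>ideals_set ?R\<^esub> n) (xy_ideal TYPE('k))" for n
    by (simp add: nat_pow_def ideals_set_def)
  have zero: "xy_ideal TYPE('k) [^]\<^bsub>ideals_set ?R\<^esub> (0::nat) = carrier ?R"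
    by (simp add: nat_pow_def ideals_set_def)
  show "xy_ideal TYPE('k) [^]\<^bsub>ideals_set ?R\<^esub> n \<subseteq> quot_map ` order_ideal [:0, 1:] n"
  proof (induction n)
    case 0
    show ?case unfolding zero carrier_R_F by simp
  next
    case (Suc n)
    show ?case
    proof
      fix z assume "z \<in> xy_ideal TYPE('k) [^]\<^bsub>ideals_set ?R\<^esub> Suc n"
      then have "z \<in> ideal_prod ?R (xy_ideal TYPE('k) [^]\<^bsub>ideals_set ?R\<^esub> n) (xy_ideal TYPE('k))"
        unfolding pow_Suc .
      then show "z \<in> quot_map ` order_ideal [:0, 1:] (Suc n)"
      proof (induction rule: ideal_prod.induct)
        case (prod i j)
        obtain f where f: "f \<in> order_ideal [:0, 1:] n" "i = quot_map f" using prod Suc.IH by blast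
        obtain g where g: "g \<in> bracket_ideal [:0, 1:] 1" "j = quot_map g"
          using prod unfolding xy_ideal_eq by blast
        have "g \<in> order_ideal [:0, 1:] 1"
          unfolding order_ideal_def using restrict_line_bracket_ideal[OF g(1)] by blast
        from order_ideal_mult[OF f(1) this] show ?case unfolding f g quot_map_simps(2)[symmetric] by simp
      next
        case (sum i j)
        then obtain f g where "f \<in> order_ideal [:0, 1:] (Suc n)" "i = quot_map f"
          and "g \<in> order_ideal [:0, 1:] (Suc n)" "j = quot_map g" by blast
        then show ?case
          using order_ideal_add[of f _ _ g] by (simp flip: quot_map_simps(1))
      qed
    qed
  qed
  have orig: "quot_map ` origin_power n \<subseteq> xy_ideal TYPE('k) [^]\<^bsub>ideals_set ?R\<^esub> n"
  proof (induction n)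
    case 0
    show ?case unfolding zero carrier_R_F by auto
  next
    case (Suc n)
    show ?case
    proof (rule image_subsetI)
      fix f :: "'k poly poly poly" assume "f \<in> origin_power (Suc n)"
      then obtain u v where f: "f = u * coord_x + v * coord_y" "u \<in> origin_power n" "v \<in> origin_power n"
        by (auto simp: mult.commute)
      have uv: "quot_map u \<in> xy_ideal TYPE('k) [^]\<^bsub>ideals_set ?R\<^esub> n"
        "quot_map v \<in> xy_ideal TYPE('k) [^]\<^bsub>ideals_set ?R\<^esub> n" using Suc.IH f by blast+
      have xy: "quot_map coord_x \<in> xy_ideal TYPE('k)" "quot_map coord_y \<in> xy_ideal TYPE('k)"
        unfolding quot_map_mem_xy_ideal by simp_all
      show "quot_map f \<in> xy_ideal TYPE('k) [^]\<^bsub>ideals_set ?R\<^esub> Suc n"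
        unfolding f quot_map_simps pow_Suc
        by (intro ideal_prod.sum ideal_prod.prod uv xy)
    qed
  qed
  show "quot_map ` order_ideal [:0, 1:] n \<subseteq> xy_ideal TYPE('k) [^]\<^bsub>ideals_set ?R\<^esub> n"
  proof (rule image_subsetI)
    fix f :: "'k poly poly poly" assume "f \<in> order_ideal [:0, 1:] n"
    then obtain g where g: "g \<in> origin_power n" "quartic_at [:0, 1:] dvd f - g"
      using order_ideal_eq[of "[:0, 1:] :: 'k poly"] by (auto simp: one_pCons)
    then have "quot_map f = quot_map g" by (simp add: quot_map_eq_iff)
    then show "quot_map f \<in> xy_ideal TYPE('k) [^]\<^bsub>ideals_set ?R\<^esub> n" using g(1) orig by auto
  qed
qed

subsection \<open>Frobenius powers in $R_F$\<close>

lemma frobenius_quot_map: "frobenius (R_F TYPE('k::field)) q (quot_map f) = quot_map (f ^ q)"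
  by (simp add: frobenius_def quot_map_simps)

lemma prime_characteristic: "CHAR('k::field) = p \<Longrightarrow> p > 0 \<Longrightarrow> Factorial_Ring.prime p"
  using prime_CHAR_semidom[where 'a='k] by auto

lemma power_add_characteristic:
  fixes f g :: "'k::field poly poly poly"
  assumes "CHAR('k) = p" "p > 0"
  shows "(f + g) ^ p ^ e = f ^ p ^ e + g ^ p ^ e"
  using prime_characteristic[OF assms] assms freshmans_dream'[of "p ^ e" e f g] by simp

lemma frobenius_hom_R_F:
  assumes "CHAR('k::field) = p" "p > 0"
  shows "frobenius (R_F TYPE('k)) (p ^ e) \<in> ring_hom (R_F TYPE('k)) (R_F TYPE('k))"
proof (rule ring_hom_memI)
  interpret R: cring "R_F TYPE('k)" by (rule cring_R_F)
  show "frobenius (R_F TYPE('k)) (p ^ e) \<one>\<^bsub>R_F TYPE('k)\<^esub> = \<one>\<^bsub>R_F TYPE('k)\<^esub>"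
    by (simp add: frobenius_def)
  fix a assume a: "a \<in> carrier (R_F TYPE('k))"
  then show "frobenius (R_F TYPE('k)) (p ^ e) a \<in> carrier (R_F TYPE('k))"
    by (simp add: frobenius_def)
  fix b assume b: "b \<in> carrier (R_F TYPE('k))"
  from a b obtain f g where fg: "a = quot_map f" "b = quot_map g" unfolding carrier_R_F by blast
  show "frobenius (R_F TYPE('k)) (p ^ e) (a \<otimes>\<^bsub>R_F TYPE('k)\<^esub> b)
      = frobenius (R_F TYPE('k)) (p ^ e) a \<otimes>\<^bsub>R_F TYPE('k)\<^esub> frobenius (R_F TYPE('k)) (p ^ e) b"
    unfolding fg quot_map_simps(2)[symmetric] frobenius_quot_map by (simp add: power_mult_distrib)
  show "frobenius (R_F TYPE('k)) (p ^ e) (a \<oplus>\<^bsub>R_F TYPE('k)\<^esub> b)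
      = frobenius (R_F TYPE('k)) (p ^ e) a \<oplus>\<^bsub>R_F TYPE('k)\<^esub> frobenius (R_F TYPE('k)) (p ^ e) b"
    unfolding fg quot_map_simps(1)[symmetric] frobenius_quot_map power_add_characteristic[OF assms] ..
qed

text \<open>The power p^e distributes over u x^n + v y^n + w F in characteristic p, so the powers of
  all elements already lie in the ideal of the powers of x^n and y^n.\<close>

lemma frobenius_power_bracket_ideal:
  assumes "CHAR('k::field) = p" "p > 0"
  shows "frobenius_power (R_F TYPE('k)) (p ^ e) (quot_map ` bracket_ideal [:0, 1:] n)
      = quot_map ` bracket_ideal [:0, 1:] (n * p ^ e)"
proof -
  interpret R: cring "R_F TYPE('k)" by (rule cring_R_F)
  define A :: "'k poly poly poly set set"
    where "A = frobenius (R_F TYPE('k)) (p ^ e) ` quot_map ` bracket_ideal [:0, 1:] n"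
  have A: "A = (\<lambda>f. quot_map (f ^ p ^ e)) ` bracket_ideal [:0, 1:] n"
    by (simp add: A_def image_image frobenius_quot_map)
  have carr: "A \<subseteq> carrier (R_F TYPE('k))" unfolding A by (auto simp: quot_map_simps(5))
  interpret I: ideal "Idl\<^bsub>R_F TYPE('k)\<^esub> A" "R_F TYPE('k)" using carr by (rule R.genideal_ideal)
  have "p ^ e > 0" using assms by simp
  have "f ^ p ^ e \<in> bracket_ideal [:0, 1:] (n * p ^ e)" if "f \<in> bracket_ideal [:0, 1:] n" for f :: "'k poly poly poly"
  proof -
    from that obtain u v w where "f = u * coord_x ^ n + v * coord_y ^ n + w * quartic_at [:0, 1:]"
      unfolding bracket_ideal_def by blast
    then have "f ^ p ^ e = u ^ p ^ e * coord_x ^ (n * p ^ e) + v ^ p ^ e * coord_y ^ (n * p ^ e)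
        + (w * quartic_at [:0, 1:]) ^ p ^ e"
      by (simp add: power_add_characteristic[OF assms] power_mult_distrib power_mult)
    \<comment> \<open>One factor F is kept and the rest of the power becomes the
      coefficient.\<close>
    also have "(w * quartic_at [:0, 1:]) ^ p ^ e
        = (w * (w * quartic_at [:0, 1:]) ^ (p ^ e - 1)) * quartic_at [:0, 1:]"
      using power_minus_mult[OF \<open>p ^ e > 0\<close>, of "w * quartic_at [:0, 1:]"] by (simp add: mult_ac)
    finally show ?thesis by (simp only: bracket_idealI)
  qed
  then have "Idl\<^bsub>R_F TYPE('k)\<^esub> A \<subseteq> quot_map ` bracket_ideal [:0, 1:] (n * p ^ e)"
    unfolding A by (intro R.genideal_minimal ideal_quot_map_image poly_ideal_bracket_ideal) blast
  moreover have "quot_map ` bracket_ideal [:0, 1:] (n * p ^ e) \<subseteq> Idl\<^bsub>R_F TYPE('k)\<^esub> A"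
  proof (rule image_subsetI)
    fix f :: "'k poly poly poly" assume "f \<in> bracket_ideal [:0, 1:] (n * p ^ e)"
    then obtain u v w where f: "f = u * coord_x ^ (n * p ^ e) + v * coord_y ^ (n * p ^ e) + w * quartic_at [:0, 1:]"
      unfolding bracket_ideal_def by blast
    have gen: "quot_map (c ^ p ^ e) \<in> Idl\<^bsub>R_F TYPE('k)\<^esub> A" if "c \<in> bracket_ideal [:0, 1:] n" for c
      using R.genideal_self[OF carr] that unfolding A by blast
    have xy: "quot_map (coord_x ^ (n * p ^ e)) \<in> Idl\<^bsub>R_F TYPE('k)\<^esub> A"
      "quot_map (coord_y ^ (n * p ^ e)) \<in> Idl\<^bsub>R_F TYPE('k)\<^esub> A"
      using gen[OF bracket_ideal_x[of n n 1]] gen[OF bracket_ideal_y[of n n 1]]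
      by (simp_all add: power_mult)
    have "quot_map f = quot_map (u * coord_x ^ (n * p ^ e) + v * coord_y ^ (n * p ^ e))"
      unfolding quot_map_eq_iff f by simp
    also have "\<dots> \<in> Idl\<^bsub>R_F TYPE('k)\<^esub> A"
      unfolding quot_map_simps(1,2) by (intro I.a_closed I.I_l_closed xy quot_map_simps(5))
    finally show "quot_map f \<in> Idl\<^bsub>R_F TYPE('k)\<^esub> A" .
  qed
  ultimately show ?thesis unfolding frobenius_power_def A_def by blast
qed

subsection \<open>Minimal primes\<close>

lemma primeideal_quot_map_image:
  fixes A :: "'k::field poly poly poly set"
  assumes A: "poly_ideal A" "quartic_at [:0, 1:] \<in> A" and "1 \<notin> A"
    and prime: "\<And>f g. f * g \<in> A \<Longrightarrow> f \<in> A \<or> g \<in> A"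
  shows "primeideal (quot_map ` A) (R_F TYPE('k))"
proof (rule primeidealI)
  show "ideal (quot_map ` A) (R_F TYPE('k))" using A(1) by (rule ideal_quot_map_image)
  show "cring (R_F TYPE('k))" by (rule cring_R_F)
  have "quot_map 1 \<notin> quot_map ` A" using quot_map_mem_image[OF A] \<open>1 \<notin> A\<close> by blast
  then show "carrier (R_F TYPE('k)) \<noteq> quot_map ` A" using quot_map_simps(5)[of 1] by blast
  fix a b assume "a \<in> carrier (R_F TYPE('k))" "b \<in> carrier (R_F TYPE('k))"
  then obtain f g where fg: "a = quot_map f" "b = quot_map g" unfolding carrier_R_F by blast
  assume "a \<otimes>\<^bsub>R_F TYPE('k)\<^esub> b \<in> quot_map ` A"
  then have "f * g \<in> A"
    unfolding fg quot_map_simps(2)[symmetric] quot_map_mem_image[OF A] .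
  then show "a \<in> quot_map ` A \<or> b \<in> quot_map ` A" unfolding fg using prime by blast
qed

text \<open>Functions in \<open>R_F\<close> vanishing identically on one of the lines; prime because
  restriction maps to a domain, and generated by the linear factor of the line.\<close>

definition line_prime :: "'k::field poly \<Rightarrow> 'k poly \<Rightarrow> 'k poly poly poly set set" where
  "line_prime a b = quot_map ` {f. restrict_line a b f = 0}"

lemma primeideal_line_prime:
  assumes "(a, b) \<in> lines [:0, 1:]"
  shows "primeideal (line_prime a b) (R_F TYPE('k::field))"
  unfolding line_prime_def
proof (intro primeideal_quot_map_image poly_ideal_restrict_line)
  show "quartic_at [:0, 1:] \<in> {f. restrict_line a b f = 0}"
    using restrict_line_quartic_at[OF assms] by simp
qed simp_all

lemma primeideal_const_coeff:
  fixes \<pi> :: "'k::field poly"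
  assumes "\<pi> = 0 \<or> prime_elem \<pi>"
  shows "primeideal (quot_map ` {f. \<pi> dvd const_coeff f}) (R_F TYPE('k))"
proof (intro primeideal_quot_map_image poly_ideal_const_coeff)
  have one: "const_coeff (1 :: 'k poly poly poly) = 1" by (simp add: const_coeff_def)
  show "(1 :: 'k poly poly poly) \<notin> {f. \<pi> dvd const_coeff f}"
    using assms by (auto simp: one dest: prime_elem_not_unit)
  show "f \<in> {f. \<pi> dvd const_coeff f} \<or> g \<in> {f. \<pi> dvd const_coeff f}"
    if "f * g \<in> {f. \<pi> dvd const_coeff f}" for f g
    using assms that by (auto dest: prime_elem_dvd_multD)
qed simp

lemma primeideal_xy_ideal: "primeideal (xy_ideal TYPE('k::field)) (R_F TYPE('k))"
  using primeideal_const_coeff[of "0 :: 'k poly"] unfolding xy_ideal_eq bracket_ideal_1 by simp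

lemma quot_map_mem_line_prime:
  assumes "(a, b) \<in> lines [:0, 1:]"
  shows "quot_map f \<in> line_prime a b \<longleftrightarrow> restrict_line a b f = 0"
  unfolding line_prime_def
  using quot_map_mem_image[OF poly_ideal_restrict_line, of a b f] restrict_line_quartic_at[OF assms]
  by simp

lemma primeideal_linear_factor:
  fixes P :: "'k::field poly poly poly set set"
  assumes P: "primeideal P (R_F TYPE('k))"
  shows "\<exists>a b. (a, b) \<in> lines [:0, 1:] \<and> quot_map (linear_factor a b) \<in> P"
proof -
  interpret P: primeideal P "R_F TYPE('k)" by fact
  have prime: "quot_map f \<in> P \<or> quot_map g \<in> P" if "quot_map (f * g) \<in> P" for f g :: "'k poly poly poly"
    using P.I_prime[OF quot_map_simps(5) quot_map_simps(5)] that unfolding quot_map_simps(2) by blast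
  let ?g = "linear_factor 0 1 * linear_factor 1 0 * linear_factor 1 1 * linear_factor [:0, 1:] 1 :: 'k poly poly poly"
  have "quot_map ?g = quot_map 0"
    unfolding quot_map_eq_iff quartic_at_eq_prod by simp
  then have "quot_map ?g \<in> P" using P.zero_closed by (simp add: quot_map_simps(3))
  then have "quot_map (linear_factor 0 1 * linear_factor 1 0 * linear_factor 1 1) \<in> P
      \<or> quot_map (linear_factor [:0, 1:] 1) \<in> P" by (rule prime)
  then have "quot_map (linear_factor 0 1 * linear_factor 1 0) \<in> P
      \<or> quot_map (linear_factor 1 1) \<in> P \<or> quot_map (linear_factor [:0, 1:] 1) \<in> P"
    using prime[of "linear_factor 0 1 * linear_factor 1 0" "linear_factor 1 1"] by argo
  then have "quot_map (linear_factor 0 1) \<in> P \<or> quot_map (linear_factor 1 0) \<in> P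
      \<or> quot_map (linear_factor 1 1) \<in> P \<or> quot_map (linear_factor [:0, 1:] 1) \<in> P"
    using prime[of "linear_factor 0 1" "linear_factor 1 0"] by argo
  moreover have "(0, 1) \<in> lines [:0, 1 :: 'k:]" "(1, 0) \<in> lines [:0, 1 :: 'k:]"
    "(1, 1) \<in> lines [:0, 1 :: 'k:]" "([:0, 1:], 1) \<in> lines [:0, 1 :: 'k:]"
    by (simp_all add: lines_def)
  ultimately show ?thesis by metis
qed

lemma line_prime_subset:
  assumes P: "ideal P (R_F TYPE('k::field))" and L: "(a, b) \<in> lines [:0, 1:]"
    and "quot_map (linear_factor a b) \<in> P"
  shows "line_prime a b \<subseteq> P"
  unfolding line_prime_def
proof (rule image_subsetI)
  interpret P: ideal P "R_F TYPE('k)" by fact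
  fix f assume "f \<in> {f. restrict_line a b f = 0}"
  then obtain h where "f = h * linear_factor a b"
    using restrict_line_eq_0_iff[OF L, of f] by (auto simp: dvd_def mult.commute)
  then show "quot_map f \<in> P"
    using P.I_l_closed[OF assms(3) quot_map_simps(5)] by (simp add: quot_map_simps(2))
qed

lemma lines_unique:
  fixes t :: "'a::idom"
  assumes t: "t \<noteq> 0" "t \<noteq> 1" and "(a, b) \<in> lines t" "(c, d) \<in> lines t"
    and "restrict_line a b (linear_factor c d) = 0"
  shows "(a, b) = (c, d)"
proof -
  have "d * a = c * b" using assms(5) by (simp add: restrict_line_linear_factor)
  with assms(3,4) t show ?thesis unfolding lines_def by auto
qed

text \<open>The product of the four linear factors is zero, so a prime contains one of them and with
  it the prime of that line. Distinct directions are not proportional, so no line prime contains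
  another.\<close>

lemma minimal_primes_R_F:
  "minimal_primes (R_F TYPE('k::field))
    = {line_prime a b | a b. (a, b) \<in> lines [:0, 1:]}"
proof (intro equalityI subsetI)
  fix P assume P: "P \<in> minimal_primes (R_F TYPE('k))"
  then have prime: "primeideal P (R_F TYPE('k))"
    and min: "\<And>Q. primeideal Q (R_F TYPE('k)) \<Longrightarrow> Q \<subseteq> P \<Longrightarrow> Q = P"
    by (auto simp: minimal_primes_def)
  obtain a b where L: "(a, b) \<in> lines [:0, 1:]" "quot_map (linear_factor a b) \<in> P"
    using primeideal_linear_factor[OF prime] by blast
  have "line_prime a b = P"
    using line_prime_subset[OF primeideal.axioms(1)[OF prime] L]
      primeideal_line_prime[OF L(1)] by (intro min)
  then show "P \<in> {line_prime a b | a b. (a, b) \<in> lines [:0, 1:]}"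
    using L(1) by blast
next
  fix P assume "P \<in> {line_prime a b | a b. (a, b) \<in> lines [:0, 1 :: 'k:]}"
  then obtain a b where L: "(a, b) \<in> lines [:0, 1:]" and P: "P = line_prime a b"
    by blast
  have "Q = P" if Q: "primeideal Q (R_F TYPE('k))" "Q \<subseteq> P" for Q
  proof -
    obtain c d where M: "(c, d) \<in> lines [:0, 1:]" "quot_map (linear_factor c d) \<in> Q"
      using primeideal_linear_factor[OF Q(1)] by blast
    then have "restrict_line a b (linear_factor c d) = 0"
      using Q(2) quot_map_mem_line_prime[OF L] unfolding P by blast
    then have "(a, b) = (c, d)" using L M(1) by (intro lines_unique[of "[:0, 1:]"]) (simp_all add: one_pCons)
    then have "P \<subseteq> Q"
      using line_prime_subset[OF primeideal.axioms(1)[OF Q(1)] M] unfolding P by simp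
    with Q(2) show ?thesis by blast
  qed
  moreover have "primeideal P (R_F TYPE('k))" unfolding P using L by (rule primeideal_line_prime)
  ultimately show "P \<in> minimal_primes (R_F TYPE('k))" unfolding minimal_primes_def by blast
qed

lemma quot_map_off_minimal_primes:
  "quot_map f \<in> off_minimal_primes (R_F TYPE('k::field))
    \<longleftrightarrow> (\<forall>a b. (a, b) \<in> lines [:0, 1:] \<longrightarrow> restrict_line a b f \<noteq> 0)"
proof -
  have "quot_map f \<in> \<Union> (minimal_primes (R_F TYPE('k))) \<longleftrightarrow>
      (\<exists>a b. (a, b) \<in> lines [:0, 1:] \<and> quot_map f \<in> line_prime a b)"
    unfolding minimal_primes_R_F by blast
  also have "\<dots> \<longleftrightarrow> (\<exists>a b. (a, b) \<in> lines [:0, 1:] \<and> restrict_line a b f = 0)"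
    by (intro iff_exI conj_cong refl quot_map_mem_line_prime)
  finally show ?thesis unfolding off_minimal_primes_def using quot_map_simps(5) by blast
qed

subsection \<open>Tight closure in $R_F$\<close>

text \<open>A multiplier off the minimal primes is one that is nonzero on every line, which is what
  \<open>order_ideal_of_multiplier\<close> asks for. Conversely, the test form is such a multiplier
  and works for all exponents at once.\<close>

lemma ideal_tight_closure_bracket_ideal:
  assumes p: "CHAR('k::field) = p" "p > 0"
  shows "ideal_tight_closure (R_F TYPE('k)) p (quot_map ` bracket_ideal [:0, 1:] n)
    = quot_map ` order_ideal [:0, 1:] n"
proof -
  have "p \<ge> 2" using prime_characteristic[OF p] by (rule prime_ge_2_nat)
  have iff: "quot_map c \<otimes>\<^bsub>R_F TYPE('k)\<^esub> quot_map f [^]\<^bsub>R_F TYPE('k)\<^esub> (p ^ e)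
      \<in> frobenius_power (R_F TYPE('k)) (p ^ e) (quot_map ` bracket_ideal [:0, 1:] n)
      \<longleftrightarrow> c * f ^ p ^ e \<in> bracket_ideal [:0, 1:] (n * p ^ e)" for c f :: "'k poly poly poly" and e
    unfolding quot_map_simps(2,7)[symmetric] frobenius_power_bracket_ideal[OF p]
    by (rule quot_map_mem_bracket_ideal)
  show ?thesis
  proof (intro equalityI subsetI)
    fix r assume r: "r \<in> ideal_tight_closure (R_F TYPE('k)) p (quot_map ` bracket_ideal [:0, 1:] n)"
    then obtain f where f: "r = quot_map f"
      unfolding ideal_tight_closure_def carrier_R_F by blast
    from r obtain c' e0 where c': "c' \<in> off_minimal_primes (R_F TYPE('k))"
      "\<forall>e\<ge>e0. c' \<otimes>\<^bsub>R_F TYPE('k)\<^esub> quot_map f [^]\<^bsub>R_F TYPE('k)\<^esub> (p ^ e)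
        \<in> frobenius_power (R_F TYPE('k)) (p ^ e) (quot_map ` bracket_ideal [:0, 1:] n)"
      unfolding ideal_tight_closure_def f by blast
    then have "c' \<in> carrier (R_F TYPE('k))" by (simp add: off_minimal_primes_def)
    then obtain c where c: "c' = quot_map c" unfolding carrier_R_F by blast
    have "f \<in> order_ideal [:0, 1:] n"
    proof (rule order_ideal_of_multiplier)
      show "restrict_line a b c \<noteq> 0" if "(a, b) \<in> lines [:0, 1:]" for a b
        using c'(1) that unfolding c quot_map_off_minimal_primes by blast
      show "\<exists>m>k. c * f ^ m \<in> bracket_ideal [:0, 1:] (n * m)" for k
      \<comment> \<open>The witness p^(k + e0) exceeds k and its exponent is at least e0.\<close>
      proof (intro exI conjI)
        have "k + e0 < p ^ (k + e0)" using \<open>p \<ge> 2\<close> by (intro power_gt_expt) simp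
        then show "k < p ^ (k + e0)" by simp
        show "c * f ^ p ^ (k + e0) \<in> bracket_ideal [:0, 1:] (n * p ^ (k + e0))"
          using c'(2) unfolding c iff by simp
      qed
    qed
    then show "r \<in> quot_map ` order_ideal [:0, 1:] n" unfolding f by (rule imageI)
  next
    fix r assume "r \<in> quot_map ` order_ideal [:0, 1 :: 'k:] n"
    then obtain f :: "'k poly poly poly" where f: "f \<in> order_ideal [:0, 1:] n" "r = quot_map f" by blast
    have "quot_map (test_form [:0, 1:]) \<in> off_minimal_primes (R_F TYPE('k))"
      unfolding quot_map_off_minimal_primes
      using restrict_line_test_form[of _ _ "[:0, 1:]"] by (auto simp: one_pCons)
    moreover have "\<forall>e\<ge>0. quot_map (test_form [:0, 1:]) \<otimes>\<^bsub>R_F TYPE('k)\<^esub> r [^]\<^bsub>R_F TYPE('k)\<^esub> (p ^ e)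
        \<in> frobenius_power (R_F TYPE('k)) (p ^ e) (quot_map ` bracket_ideal [:0, 1:] n)"
      unfolding f(2) iff using f(1) by (auto intro!: test_form_mult_power simp: one_pCons)
    ultimately show "r \<in> ideal_tight_closure (R_F TYPE('k)) p (quot_map ` bracket_ideal [:0, 1:] n)"
      unfolding ideal_tight_closure_def using f(2) quot_map_simps(5) by blast
  qed
qed

lemma cyclic_module_M_F:
  obtains u where "cyclic_module (R_F TYPE('k::field)) (M_F TYPE('k)) u (quot_map ` bracket_ideal [:0, 1:] 1)"
  using cyclic_module_ring_quotient[OF cring_R_F ideal_xy_ideal[where 'k='k], folded M_F_def]
  unfolding xy_ideal_eq by (rule that)

subsection \<open>Associated primes\<close>

text \<open>A nonzero element d of least degree generates the ideal of \<open>\<pi>\<close> and f.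
  It divides \<open>\<pi>\<close>, and it is not associated to \<open>\<pi>\<close> because it also
  divides f, so it is a unit.\<close>

lemma irreducible_poly_bezout:
  fixes \<pi> f :: "'k::field poly"
  assumes irr: "Factorial_Ring.irreducible \<pi>" and ndvd: "\<not> \<pi> dvd f"
  shows "\<exists>a b. a * \<pi> + b * f = 1"
proof -
  define I where "I = {a * \<pi> + b * f | a b. True}"
  have I_I: "a * \<pi> + b * f \<in> I" for a b unfolding I_def by blast
  have mult_diff: "x - c * y \<in> I" if "x \<in> I" "y \<in> I" for x y c
  proof -
    from that obtain a b a' b' where "x = a * \<pi> + b * f" "y = a' * \<pi> + b' * f"
      unfolding I_def by blast
    then have "x - c * y = (a - c * a') * \<pi> + (b - c * b') * f" by (simp add: algebra_simps)
    then show ?thesis by (simp only: I_I)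
  qed
  have \<pi>_I: "\<pi> \<in> I" and f_I: "f \<in> I" using I_I[of 1 0] I_I[of 0 1] by simp_all
  have "\<pi> \<noteq> 0" using irr by auto
  then obtain d where d: "d \<in> I \<and> d \<noteq> 0" "\<And>x. x \<in> I \<and> x \<noteq> 0 \<Longrightarrow> degree d \<le> degree x"
    using \<pi>_I ex_has_least_nat[of "\<lambda>x. x \<in> I \<and> x \<noteq> 0" \<pi> degree] by blast
  have dvd: "d dvd x" if "x \<in> I" for x
  proof -
    have eq: "x mod d = x - (x div d) * d" by (rule minus_div_mult_eq_mod[symmetric])
    have "x mod d \<in> I" unfolding eq using that d(1) by (intro mult_diff) simp_all
    then have "x mod d = 0"
      using d degree_mod_less'[of d x] by (meson not_le)
    then show ?thesis by (simp add: mod_eq_0_iff_dvd)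
  qed
  obtain k where k: "\<pi> = d * k" using dvd[OF \<pi>_I] by blast
  have "d dvd 1"
  proof (rule ccontr)
    assume "\<not> d dvd 1"
    then have "k dvd 1" using Factorial_Ring.irreducibleD[OF irr k] by blast
    then have "\<pi> dvd d" unfolding k by (metis dvd_mult_unit_iff dvd_refl mult_unit_dvd_iff)
    then show False using dvd[OF f_I] ndvd dvd_trans by blast
  qed
  then obtain c where "1 = d * c" by blast
  then have "0 - (- c) * d = 1" by (simp add: mult.commute)
  moreover have "0 - (- c) * d \<in> I" using mult_diff[of 0 d "- c"] I_I[of 0 0] d(1) by simp
  ultimately have "1 \<in> I" by metis
  then obtain a b where "1 = a * \<pi> + b * f" unfolding I_def by blast
  then show ?thesis by metis
qed

section \<open>Cancellation modulo the order ideal and the associated prime of its quotient\<close>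

lemma power_dvd_mult_cancel:
  fixes r v :: "'a::idom poly"
  assumes "coeff r 0 \<noteq> 0" "[:0, 1:] ^ n dvd r * v"
  shows "[:0, 1:] ^ n dvd v"
proof (cases "v = 0")
  case False
  have "order 0 r = 0" using assms(1) by (intro order_0I) (simp add: poly_0_coeff_0)
  moreover have nz: "r * v \<noteq> 0" using assms(1) False by auto
  ultimately have "order 0 (r * v) = order 0 v" by (simp add: order_mult)
  moreover have "r * v = 0 \<or> n \<le> order 0 (r * v)"
    using order_divides[of 0 n "r * v"] assms(2) unfolding minus_zero
    by (rule iffD1)
  ultimately have "n \<le> order 0 v" using nz by simp
  then have "[:- 0, 1:] ^ n dvd v" unfolding order_divides by (rule disjI2)
  then show ?thesis unfolding minus_zero .
next
  case True
  then show ?thesis by (simp only: dvd_0_right)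
qed

text \<open>A nonzero constant term means order 0 at the origin of every line, so multiplication by
  g leaves all orders unchanged. Hence zero divisors modulo the order ideal lie in (x, y).\<close>

lemma order_ideal_cancel:
  fixes f g :: "'a::idom poly poly"
  assumes "const_coeff g \<noteq> 0" "g * f \<in> order_ideal t n"
  shows "f \<in> order_ideal t n"
  unfolding order_ideal_def
proof (intro CollectI allI impI)
  fix a b assume "(a, b) \<in> lines t"
  then have "[:0, 1:] ^ n dvd restrict_line a b g * restrict_line a b f"
    using assms(2) by (simp add: order_ideal_def)
  with assms(1) show "[:0, 1:] ^ n dvd restrict_line a b f"
    unfolding coeff_restrict_line_0[of a b g, symmetric] by (rule power_dvd_mult_cancel)
qed

lemma const_coeff_0_order_ideal:
  assumes "const_coeff f = 0"
  shows "f \<in> order_ideal t 1"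
proof -
  have "f \<in> bracket_ideal t 1" using assms unfolding bracket_ideal_1 by simp
  from restrict_line_bracket_ideal[OF this] show ?thesis unfolding order_ideal_def by blast
qed

lemma eq_of_quot_map_mem:
  assumes "\<And>f. quot_map f \<in> A \<longleftrightarrow> quot_map f \<in> B" "A \<subseteq> range quot_map" "B \<subseteq> range quot_map"
  shows "A = B"
proof (rule Set.set_eqI)
  fix x
  show "x \<in> A \<longleftrightarrow> x \<in> B"
  proof (cases "x \<in> range quot_map")
    case True
    then obtain f where x: "x = quot_map f" by (elim rangeE)
    show ?thesis unfolding x by (rule assms(1))
  next
    case False
    with assms(2,3) show ?thesis by blast
  qed
qed

text \<open>An associated prime consists of zero divisors, hence lies in (x, y) by cancellation. It
  contains (x, y) because the n-th power of any element of (x, y) is zero modulo the order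
  ideal.\<close>

lemma Ass_order_ideal:
  assumes M: "cyclic_module (R_F TYPE('k::field)) M u (quot_map ` order_ideal [:0, 1:] n)" and "n > 0"
  shows "Ass (R_F TYPE('k)) M = {xy_ideal TYPE('k)}"
proof -
  have iff: "quot_map g \<otimes>\<^bsub>R_F TYPE('k)\<^esub> quot_map f \<in> quot_map ` order_ideal [:0, 1:] n
      \<longleftrightarrow> g * f \<in> order_ideal [:0, 1:] n" for f g :: "'k poly poly poly"
    unfolding quot_map_simps(2)[symmetric] by (rule quot_map_mem_order_ideal)
  have unique: "P = xy_ideal TYPE('k)" if P: "P \<in> Ass (R_F TYPE('k)) M" for P
  proof -
    have prime: "primeideal P (R_F TYPE('k))" using P unfolding Ass_def by blast
    interpret P: primeideal P "R_F TYPE('k)" by (rule prime)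
    obtain f :: "'k poly poly poly" where Pf:
      "P = {a \<in> carrier (R_F TYPE('k)). a \<otimes>\<^bsub>R_F TYPE('k)\<^esub> quot_map f \<in> quot_map ` order_ideal [:0, 1:] n}"
      using P unfolding Ass_cyclic_module[OF M] carrier_R_F by blast
    have P_iff: "quot_map g \<in> P \<longleftrightarrow> g * f \<in> order_ideal [:0, 1:] n" for g
      unfolding Pf using iff quot_map_simps(5) by blast
    have "\<one>\<^bsub>R_F TYPE('k)\<^esub> \<notin> P" using P.I_notcarr P.one_imp_carrier by blast
    then have f: "f \<notin> order_ideal [:0, 1:] n"
      using P_iff[of 1] by (simp add: quot_map_simps(4))
    have "const_coeff g = 0" if "quot_map g \<in> P" for g
      using that f order_ideal_cancel unfolding P_iff by blast
    moreover have "quot_map g \<in> P" if g: "const_coeff g = 0" for g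
    proof -
      have "g ^ n \<in> order_ideal [:0, 1:] n"
        using order_ideal_power[OF const_coeff_0_order_ideal[OF g], of n] by simp
      then have gn: "quot_map (g ^ n) \<in> P"
        unfolding P_iff using order_ideal_mult_left[of "g ^ n"] by (simp add: mult.commute)
      have "quot_map (g ^ k) \<in> P \<Longrightarrow> quot_map g \<in> P" for k
      proof (induction k)
        case 0
        then show ?case using \<open>\<one>\<^bsub>R_F TYPE('k)\<^esub> \<notin> P\<close> by (simp add: quot_map_simps(4))
      next
        case (Suc k)
        then have "quot_map g \<in> P \<or> quot_map (g ^ k) \<in> P"
          using P.I_prime[of "quot_map g" "quot_map (g ^ k)"]
          unfolding power_Suc quot_map_simps(2) by (simp only: quot_map_simps(5))
        then show ?case using Suc.IH by blast
      qed
      then show ?thesis using gn .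
    qed
    ultimately have "quot_map g \<in> P \<longleftrightarrow> quot_map g \<in> xy_ideal TYPE('k)" for g
      unfolding quot_map_mem_xy_ideal by (rule iffI)
    moreover have "P \<subseteq> range quot_map" using P.a_subset unfolding carrier_R_F .
    moreover have "xy_ideal TYPE('k) \<subseteq> range quot_map"
      unfolding xy_ideal_eq by (rule image_mono) simp
    ultimately show ?thesis by (rule eq_of_quot_map_mem)
  qed
  have mem: "xy_ideal TYPE('k) \<in> Ass (R_F TYPE('k)) M"
    unfolding Ass_cyclic_module[OF M]
  \<comment> \<open>The element with annihilator (x, y) is x^(n - 1). On the line y = 0 it has order
    exactly n - 1, so only multipliers vanishing at the origin can raise it to order n.\<close>
  proof (intro CollectI conjI bexI[of _ "quot_map (coord_x ^ (n - 1))"] primeideal_xy_ideal)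
    have "g * coord_x ^ (n - 1) \<in> order_ideal [:0, 1:] n \<longleftrightarrow> const_coeff g = 0" for g :: "'k poly poly poly"
    proof
      assume "g * coord_x ^ (n - 1) \<in> order_ideal [:0, 1:] n"
      moreover have "(1, 0) \<in> lines [:0, 1 :: 'k:]" by (simp add: lines_def)
      ultimately have "[:0, 1:] ^ n dvd restrict_line 1 0 (g * coord_x ^ (n - 1))"
        unfolding order_ideal_def by blast
      moreover have "[:0, 1 :: 'k poly:] ^ n = [:0, 1:] ^ (n - 1) * [:0, 1:]"
        using power_minus_mult[OF \<open>n > 0\<close>] by (rule sym)
      moreover have "restrict_line 1 0 (g * coord_x ^ (n - 1)) = [:0, 1:] ^ (n - 1) * restrict_line 1 0 g"
        unfolding restrict_line_mult restrict_line_power restrict_line_coords by (rule mult.commute)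
      ultimately have "[:0, 1:] ^ (n - 1) * [:0, 1:] dvd [:0, 1:] ^ (n - 1) * restrict_line 1 0 g"
        by (simp only:)
      then have "[:0, 1:] dvd restrict_line 1 0 g" unfolding dvd_mult_cancel_left by simp
      then have "coeff (restrict_line 1 0 g) 0 = 0" by (auto simp: dvd_def)
      then show "const_coeff g = 0" by (simp add: coeff_restrict_line_0)
    next
      assume "const_coeff g = 0"
      moreover have "coord_x ^ (n - 1) \<in> order_ideal [:0, 1:] (1 * (n - 1))"
        by (intro order_ideal_power const_coeff_0_order_ideal const_coeff_simps)
      ultimately have "g * coord_x ^ (n - 1) \<in> order_ideal [:0, 1:] (1 + 1 * (n - 1))"
        by (intro order_ideal_mult const_coeff_0_order_ideal)
      then show "g * coord_x ^ (n - 1) \<in> order_ideal [:0, 1:] n" using \<open>n > 0\<close> by simp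
    qed
    then have "a \<otimes>\<^bsub>R_F TYPE('k)\<^esub> quot_map (coord_x ^ (n - 1)) \<in> quot_map ` order_ideal [:0, 1:] n
        \<longleftrightarrow> a \<in> xy_ideal TYPE('k)" if "a \<in> carrier (R_F TYPE('k))" for a
    proof -
      from that obtain g where "a = quot_map g" unfolding carrier_R_F by (elim rangeE)
      then show ?thesis
        by (simp only: iff quot_map_mem_xy_ideal
          \<open>\<And>g. g * coord_x ^ (n - 1) \<in> order_ideal [:0, 1:] n \<longleftrightarrow> const_coeff g = 0\<close>)
    qed
    moreover have "xy_ideal TYPE('k) \<subseteq> carrier (R_F TYPE('k))"
      by (rule additive_subgroup.a_subset[OF ideal.axioms(1)[OF ideal_xy_ideal]])
    ultimately show "xy_ideal TYPE('k) = {a \<in> carrier (R_F TYPE('k)).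
        a \<otimes>\<^bsub>R_F TYPE('k)\<^esub> quot_map (coord_x ^ (n - 1)) \<in> quot_map ` order_ideal [:0, 1:] n}"
      by blast
    show "quot_map (coord_x ^ (n - 1)) \<in> carrier (R_F TYPE('k))" by (rule quot_map_simps)
  qed
  show ?thesis
  proof (intro subset_antisym subsetI)
    fix P assume "P \<in> Ass (R_F TYPE('k)) M"
    then have "P = xy_ideal TYPE('k)" by (rule unique)
    then show "P \<in> {xy_ideal TYPE('k)}" by (simp only: singleton_iff)
  next
    fix P assume "P \<in> {xy_ideal TYPE('k)}"
    then have "P = xy_ideal TYPE('k)" by (simp only: singleton_iff)
    with mem show "P \<in> Ass (R_F TYPE('k)) M" by (simp only:)
  qed
qed

section \<open>The ideals (x, y, \<pi>) and the associated primes of the Frobenius powers\<close>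

definition point_ideal :: "'k::field poly \<Rightarrow> 'k poly poly poly set set" where
  "point_ideal \<pi> = quot_map ` {f. \<pi> dvd const_coeff f}"

lemma quot_map_mem_point_ideal: "quot_map f \<in> point_ideal \<pi> \<longleftrightarrow> \<pi> dvd const_coeff f"
  unfolding point_ideal_def using quot_map_mem_image[OF poly_ideal_const_coeff, of \<pi> f] by simp

text \<open>If Q contains a further element f, a Bezout relation between \<open>\<pi>\<close> and
  the constant term of f gives a multiple of f with constant term 1 modulo \<open>\<pi>\<close>. The
  difference of 1 and this multiple lies in the point ideal, so Q contains 1.\<close>

lemma point_ideal_maximal:
  fixes \<pi> :: "'k::field poly"
  assumes irr: "Factorial_Ring.irreducible \<pi>" and Q: "primeideal Q (R_F TYPE('k))" and sub: "point_ideal \<pi> \<subseteq> Q"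
  shows "Q = point_ideal \<pi>"
proof (rule ccontr)
  interpret Q: primeideal Q "R_F TYPE('k)" by (rule Q)
  assume "Q \<noteq> point_ideal \<pi>"
  then obtain f where f: "quot_map f \<in> Q" "quot_map f \<notin> point_ideal \<pi>"
    using sub Q.a_subset unfolding carrier_R_F by blast
  then have "\<not> \<pi> dvd const_coeff f" unfolding quot_map_mem_point_ideal by blast
  then obtain a b where ab: "a * \<pi> + b * const_coeff f = 1" using irreducible_poly_bezout[OF irr] by blast
  define g where "g = 1 - cst b * f"
  have one: "const_coeff (1 :: 'k poly poly poly) = 1" by (simp add: const_coeff_def)
  have "g = 1 + cst (- b) * f" by (simp add: g_def)
  then have "const_coeff g = 1 + (- b) * const_coeff f" by (simp only: const_coeff_simps one)
  also have "\<dots> = a * \<pi>" by (simp flip: ab)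
  finally have "quot_map g \<in> Q" using sub quot_map_mem_point_ideal[of g \<pi>] by auto
  moreover have "quot_map (cst b * f) \<in> Q"
    unfolding quot_map_simps(2) using f(1) by (intro Q.I_l_closed quot_map_simps(5))
  ultimately have "quot_map (g + cst b * f) \<in> Q" unfolding quot_map_simps(1)
    by (rule additive_subgroup.a_closed[OF Q.additive_subgroup_axioms])
  then have "\<one>\<^bsub>R_F TYPE('k)\<^esub> \<in> Q" by (simp add: g_def quot_map_simps(4))
  then show False using Q.one_imp_carrier Q.I_notcarr by blast
qed

text \<open>With g the cofactor of \<open>\<pi>\<close> in the geometric sum, the class of g x^2
  y^(q - 1) has the point ideal as annihilator.\<close>

lemma point_ideal_in_Ass:
  fixes \<pi> :: "'k::field poly"
  assumes p: "CHAR('k) = p" "p > 0" and "e > 0"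
    and \<pi>: "Factorial_Ring.irreducible \<pi>" "\<pi> dvd (\<Sum>j<p ^ e - 1. [:0, 1:] ^ j)"
  shows "point_ideal \<pi> \<in> Ass (R_F TYPE('k)) (PS_functor (R_F TYPE('k)) (p ^ e) (M_F TYPE('k)))"
proof -
  obtain u where u: "cyclic_module (R_F TYPE('k)) (M_F TYPE('k)) u (quot_map ` bracket_ideal [:0, 1:] 1)"
    by (rule cyclic_module_M_F)
  note PS = cyclic_module_PS_functor[OF frobenius_hom_R_F[OF p] u, of e,
    unfolded frobenius_power_bracket_ideal[OF p] mult_1]
  have "p \<ge> 2" using prime_characteristic[OF p] by (rule prime_ge_2_nat)
  then have q: "p ^ e \<ge> 2" using \<open>e > 0\<close> self_le_power[of p e] by linarith
  obtain g where g: "(\<Sum>j<p ^ e - 1. [:0, 1:] ^ j) = \<pi> * g" using \<pi>(2) by blast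
  \<comment> \<open>The geometric sum is nonzero since its value at t = 0 is 1.\<close>
  have "poly (\<Sum>j<p ^ e - 1. [:0, 1:] ^ j) (0 :: 'k) = (\<Sum>j<p ^ e - 1. if j = 0 then 1 else 0)"
    unfolding poly_sum by (intro sum.cong) auto
  also have "\<dots> = 1" using q by simp
  finally have nz: "(\<Sum>j<p ^ e - 1. [:0, 1 :: 'k:] ^ j) \<noteq> 0" by auto
  define r where "r = quot_map (cst g * coord_x ^ 2 * coord_y ^ (p ^ e - 1))"
  have "quot_map f \<otimes>\<^bsub>R_F TYPE('k)\<^esub> r \<in> quot_map ` bracket_ideal [:0, 1:] (p ^ e)
      \<longleftrightarrow> quot_map f \<in> point_ideal \<pi>" for f
    unfolding r_def quot_map_simps(2)[symmetric] quot_map_mem_bracket_ideal quot_map_mem_point_ideal const_coeff_def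
    by (rule bracket_ideal_annihilator[OF q g nz])
  moreover have "point_ideal \<pi> \<subseteq> range quot_map" unfolding point_ideal_def by blast
  ultimately have "point_ideal \<pi> = {a \<in> carrier (R_F TYPE('k)).
      a \<otimes>\<^bsub>R_F TYPE('k)\<^esub> r \<in> quot_map ` bracket_ideal [:0, 1:] (p ^ e)}"
    unfolding carrier_R_F by blast
  moreover have "primeideal (point_ideal \<pi>) (R_F TYPE('k))"
    unfolding point_ideal_def using field_poly_irreducible_imp_prime[OF \<pi>(1)]
    by (intro primeideal_const_coeff) simp
  moreover have "r \<in> carrier (R_F TYPE('k))" unfolding r_def by (rule quot_map_simps)
  ultimately show ?thesis unfolding Ass_cyclic_module[OF PS] by blast
qed

lemma infinite_maximal_Ass:
  assumes p: "CHAR('k::field) = p" "p > 0"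
  shows "infinite (maximal_elements
    (\<Union>e\<in>{0<..}. Ass (R_F TYPE('k)) (PS_functor (R_F TYPE('k)) (p ^ e) (M_F TYPE('k)))))"
proof -
  obtain \<pi> :: "nat \<Rightarrow> 'k poly" where irr: "\<And>i. Factorial_Ring.irreducible (\<pi> i)"
    and dvd: "\<And>i. \<pi> i dvd (\<Sum>j<p ^ 2 ^ Suc i - 1. [:0, 1:] ^ j)"
    and ndvd: "\<And>i j. i < j \<Longrightarrow> \<not> \<pi> i dvd \<pi> j"
    using geometric_sum_irreducible_factors[OF p refl] by blast
  define \<A> where "\<A> = (\<Union>e\<in>{0<..}. Ass (R_F TYPE('k)) (PS_functor (R_F TYPE('k)) (p ^ e) (M_F TYPE('k))))"
  have "point_ideal (\<pi> i) \<in> maximal_elements \<A>" for i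
  proof -
    \<comment> \<open>The factor \<open>\<pi> i\<close> belongs to the Frobenius exponent e = 2^(i +
      1), as the tower of squares p^(2^i) was used to produce it.\<close>
    have "point_ideal (\<pi> i) \<in> \<A>"
      unfolding \<A>_def using point_ideal_in_Ass[OF p _ irr dvd, of i]
      by (intro UN_I[of "2 ^ Suc i"]) simp_all
    moreover have "primeideal Q (R_F TYPE('k))" if "Q \<in> \<A>" for Q
      using that unfolding \<A>_def Ass_def by blast
    ultimately show ?thesis
      unfolding maximal_elements_def using point_ideal_maximal[OF irr] by blast
  qed
  then have "range (\<lambda>i. point_ideal (\<pi> i)) \<subseteq> maximal_elements \<A>" by blast
  moreover have "inj (\<lambda>i. point_ideal (\<pi> i))"
  proof (rule linorder_injI)
    fix i j :: nat assume "i < j"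
    \<comment> \<open>The constant \<open>\<pi> j\<close> separates the two ideals, because
      \<open>\<pi> i\<close> does not divide it.\<close>
    have "quot_map (cst (\<pi> j)) \<in> point_ideal (\<pi> j)" "quot_map (cst (\<pi> j)) \<notin> point_ideal (\<pi> i)"
      unfolding quot_map_mem_point_ideal using ndvd[OF \<open>i < j\<close>] by simp_all
    then show "point_ideal (\<pi> i) \<noteq> point_ideal (\<pi> j)" by metis
  qed
  then have "infinite (range (\<lambda>i. point_ideal (\<pi> i)))" by (rule range_inj_infinite)
  ultimately show ?thesis unfolding \<A>_def[symmetric] using infinite_super by blast
qed

lemma cyclic_module_G_functor:
  assumes p: "CHAR('k::field) = p" "p > 0"
  obtains u where "cyclic_module (R_F TYPE('k)) (G_functor (R_F TYPE('k)) p e (M_F TYPE('k))) u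
    (quot_map ` order_ideal [:0, 1:] (p ^ e))"
proof -
  obtain v where v: "cyclic_module (R_F TYPE('k)) (M_F TYPE('k)) v (quot_map ` bracket_ideal [:0, 1:] 1)"
    by (rule cyclic_module_M_F)
  note PS = cyclic_module_PS_functor[OF frobenius_hom_R_F[OF p] v, of e,
    unfolded frobenius_power_bracket_ideal[OF p] mult_1]
  have "quot_map ` bracket_ideal [:0, 1:] (p ^ e) \<subseteq> quot_map ` order_ideal [:0, 1 :: 'k:] (p ^ e)"
    using restrict_line_bracket_ideal unfolding order_ideal_def by blast
  from cyclic_module_quotient[OF PS ideal_quot_map_image[OF poly_ideal_order_ideal] this refl]
  show ?thesis
    \<comment> \<open>The order ideal is rewritten backwards as a tight closure, so that its
      multiples of the generator become the submodule divided out in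
      \<open>G_functor\<close>.\<close>
    unfolding ideal_tight_closure_bracket_ideal[OF p, symmetric]
    unfolding tight_closure_zero_cyclic[OF frobenius_hom_R_F[OF p] PS, symmetric]
    unfolding G_functor_def[symmetric]
    by (rule that[unfolded ideal_tight_closure_bracket_ideal[OF p, symmetric]])
qed

theorem mainTheorem2:
  fixes p :: nat
  assumes "CHAR('k::field) = p" and "p > 0"
  shows "infinite (maximal_elements
             (\<Union>e\<in>{0<..}. Ass (R_F TYPE('k)) (PS_functor (R_F TYPE('k)) (p ^ e) (M_F TYPE('k)))))
       \<and> (\<forall>e>0. \<forall>q. q = p ^ e \<longrightarrow>
           isomorphic_modules (R_F TYPE('k))
             (G_functor (R_F TYPE('k)) p e (M_F TYPE('k)))
             (quotient_module (ring_module (R_F TYPE('k)))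
                (xy_ideal TYPE('k) [^]\<^bsub>ideals_set (R_F TYPE('k))\<^esub> q))
         \<and> Ass (R_F TYPE('k)) (G_functor (R_F TYPE('k)) p e (M_F TYPE('k))) = {xy_ideal TYPE('k)})"
proof (intro conjI allI impI)
  show "infinite (maximal_elements
      (\<Union>e\<in>{0<..}. Ass (R_F TYPE('k)) (PS_functor (R_F TYPE('k)) (p ^ e) (M_F TYPE('k)))))"
    using assms by (rule infinite_maximal_Ass)
  fix e q :: nat assume "e > 0" and q: "q = p ^ e"
  obtain u where u: "cyclic_module (R_F TYPE('k)) (G_functor (R_F TYPE('k)) p e (M_F TYPE('k))) u
      (quot_map ` order_ideal [:0, 1:] (p ^ e))"
    using assms by (rule cyclic_module_G_functor)
  show "Ass (R_F TYPE('k)) (G_functor (R_F TYPE('k)) p e (M_F TYPE('k))) = {xy_ideal TYPE('k)}"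
    by (rule Ass_order_ideal[OF u]) (use assms in simp)
  have "ideal (xy_ideal TYPE('k) [^]\<^bsub>ideals_set (R_F TYPE('k))\<^esub> q) (R_F TYPE('k))"
    unfolding xy_ideal_power_eq by (rule ideal_quot_map_image[OF poly_ideal_order_ideal])
  then obtain v where "cyclic_module (R_F TYPE('k)) (quotient_module (ring_module (R_F TYPE('k)))
      (xy_ideal TYPE('k) [^]\<^bsub>ideals_set (R_F TYPE('k))\<^esub> q)) v (quot_map ` order_ideal [:0, 1:] q)"
    using cyclic_module_ring_quotient[OF cring_R_F] unfolding xy_ideal_power_eq by blast
  \<comment> \<open>Both modules are cyclic with the image of \<open>order_ideal\<close> as
    annihilator.\<close>
  with u show "isomorphic_modules (R_F TYPE('k)) (G_functor (R_F TYPE('k)) p e (M_F TYPE('k)))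
      (quotient_module (ring_module (R_F TYPE('k)))
        (xy_ideal TYPE('k) [^]\<^bsub>ideals_set (R_F TYPE('k))\<^esub> q))"
    unfolding q by (rule isomorphic_cyclic_modules)
qed

end
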